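(* Let $T$ be a Galton-Watson tree with mean $m > 1$ and root $\rho$. Consider the linearly edge-reinforced random walk (ERRW) on $T$, started at $\rho$, with reinforcement parameter $\Delta > 0$. Let $\Delta_0$ be the solution (in the unknown $\Delta > 0$) of the equation $$\frac{\Gamma\left(\frac{2 + \Delta}{4\Delta}\right)^2}{\Gamma\left(\frac{1}{2\Delta}\right)\Gamma\left(\frac{1 + \Delta}{2\Delta}\right)} = \frac{1}{m}.$$ Then, conditional upon non-extinction of $T$, the ERRW on $T$ is (i) a.s. transient if $\Delta < \Delta_0$; (ii) a.s. recurrent if $\Delta \geq \Delta_0$. Moreover, conditional upon non-extinction of $T$, the expected return time to the root $\rho$ is always infinite.
   Context: Galton-Watson tree. Given a probability distribution $(p_k)_{k\ge0}$ on the non-negative integers, a Galton-Watson tree is the random rooted tree constructed by starting from the root $\rho$ and choosing the number of children of each node independently according to $(p_k)$. Its mean is $m=\sum_{k\ge0}k\,p_k$. Extinction is the event that the constructed tree is finite. ERRW. On a locally finite tree $T=(V,E)$ with root $\rho$, the linearly edge-reinforced random walk $(X_n)_{n\ge0}$ with parameter $\Delta$ starts at $X_0=\rho$. The edge weights are $w_0\equiv1$ and, for $n\ge1$, $$w_n(\{u,v\})=1+\Delta\sum_{i=1}^n \mathbf{1}_{\{X_{i-1},X_i\}=\{u,v\}},$$ i.e. the weight of an edge is increased by $\Delta$ upon every traversal. Given the history up to time $n$ with $X_n=u$, the walk moves to a neighbor $v$ of $u$ with probability $w_n(\{u,v\})$ divided by the sum of the weights $w_n$ of all edges incident to $u$.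 On a Galton-Watson tree, first $T$ is sampled and then the ERRW is run on the sampled $T$. For a given tree, the ERRW is a.s. recurrent if it visits $\rho$ infinitely often with probability $1$, and a.s. transient if it visits $\rho$ infinitely often with probability $0$. "Conditional upon non-extinction" means that the assertion holds for almost every realization of $T$ on the event that $T$ is infinite. The return time to the root is $\min\{n>0: X_n=\rho\}$ (with $\min\varnothing=\infty$). $\Gamma$ is the Gamma function. *)

theory Defs
  imports "HOL-Probability.Probability"
begin

text \<open>Vertices are Ulam--Harris words: the root is the empty word and the children of a vertex
  \<open>u\<close> are the words \<open>u @ [i]\<close>.\<close>

type_synonym vertex = "nat list"

inductive_set gw_tree :: "(vertex \<Rightarrow> nat) \<Rightarrow> vertex set" for N :: "vertex \<Rightarrow> nat" where
  root: "[] \<in> gw_tree N"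
| child: "u \<in> gw_tree N \<Longrightarrow> i < N u \<Longrightarrow> u @ [i] \<in> gw_tree N"

text \<open>A potential number of children is sampled for every word, independently; only the numbers
  at words that belong to the tree matter.\<close>

definition gw_offspring :: "nat pmf \<Rightarrow> (vertex \<Rightarrow> nat) measure" where
  "gw_offspring p = (\<Pi>\<^sub>M u\<in>(UNIV :: vertex set). measure_pmf p)"

definition nbrs :: "vertex set \<Rightarrow> vertex \<Rightarrow> vertex set" where
  "nbrs T u = {v. u \<in> T \<and> v \<in> T \<and> (\<exists>i. v = u @ [i] \<or> u = v @ [i])}"

definition edge_weight :: "real \<Rightarrow> (nat \<Rightarrow> vertex) \<Rightarrow> nat \<Rightarrow> vertex set \<Rightarrow> real" where
  "edge_weight \<Delta> X n e = 1 + \<Delta> * (\<Sum>i=1..n. of_bool ({X (i - 1), X i} = e))"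

text \<open>The law of \<open>X (Suc n)\<close> given \<open>X 0, \<dots>, X n\<close>. The case without neighbours is a
  dummy: it never occurs for the walk on a tree with at least two vertices.\<close>

definition errw_step :: "vertex set \<Rightarrow> real \<Rightarrow> nat \<Rightarrow> (nat \<Rightarrow> vertex) \<Rightarrow> vertex pmf" where
  "errw_step T \<Delta> n X =
    (if nbrs T (X n) = {} then return_pmf (X n)
     else embed_pmf (\<lambda>v. if v \<in> nbrs T (X n)
       then edge_weight \<Delta> X n {X n, v} / (\<Sum>v'\<in>nbrs T (X n). edge_weight \<Delta> X n {X n, v'})
       else 0))"

fun errw_kernel :: "vertex set \<Rightarrow> real \<Rightarrow> nat \<Rightarrow> (nat \<Rightarrow> vertex) \<Rightarrow> vertex measure" where
  "errw_kernel T \<Delta> 0 X = measure_pmf (return_pmf [])"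
| "errw_kernel T \<Delta> (Suc n) X = measure_pmf (errw_step T \<Delta> n X)"

lemma sets_PiM_count_space_finite:
  fixes J :: "nat set"
  assumes "finite J" "A \<subseteq> space (PiM J (\<lambda>_. count_space (UNIV :: vertex set)))"
  shows "A \<in> sets (PiM J (\<lambda>_. count_space (UNIV :: vertex set)))"
  using assms by (simp add: count_space_PiM_finite space_PiM)

interpretation errw: Ionescu_Tulcea "errw_kernel T \<Delta>" "\<lambda>_. count_space UNIV" for T \<Delta>
proof (rule Ionescu_Tulcea.intro)
  fix i :: nat
  have P: "errw_kernel T \<Delta> i X \<in> space (subprob_algebra (count_space UNIV))" for X
    by (cases i) (auto simp: space_subprob_algebra prob_space_imp_subprob_space
        measure_pmf.prob_space_axioms)
  show "errw_kernel T \<Delta> i \<in> PiM {0..<i} (\<lambda>_. count_space UNIV) \<rightarrow>\<^sub>M subprob_algebra (count_space UNIV)"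
    using P by (auto simp: measurable_def intro!: sets_PiM_count_space_finite)
  show "prob_space (errw_kernel T \<Delta> i X)"
    if "X \<in> space (PiM {0..<i} (\<lambda>_. count_space UNIV))" for X
    by (cases i) (auto simp: measure_pmf.prob_space_axioms)
qed

definition errw :: "vertex set \<Rightarrow> real \<Rightarrow> (nat \<Rightarrow> vertex) measure" where
  "errw T \<Delta> = errw.PF.lim T \<Delta>"

definition errw_recurrent :: "vertex set \<Rightarrow> real \<Rightarrow> bool" where
  "errw_recurrent T \<Delta> \<longleftrightarrow> (AE X in errw T \<Delta>. \<exists>\<^sub>\<infinity>n. X n = [])"

definition errw_transient :: "vertex set \<Rightarrow> real \<Rightarrow> bool" where
  "errw_transient T \<Delta> \<longleftrightarrow> (AE X in errw T \<Delta>. \<not> (\<exists>\<^sub>\<infinity>n. X n = []))"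

text \<open>The infimum of the empty set is \<open>\<infinity>\<close>.\<close>

definition return_time :: "(nat \<Rightarrow> vertex) \<Rightarrow> ennreal" where
  "return_time X = (INF n\<in>{n. n > 0 \<and> X n = []}. of_nat n)"

definition gamma_ratio :: "real \<Rightarrow> real" where
  "gamma_ratio \<Delta> =
    Gamma ((2 + \<Delta>) / (4 * \<Delta>)) ^ 2 / (Gamma (1 / (2 * \<Delta>)) * Gamma ((1 + \<Delta>) / (2 * \<Delta>)))"

text \<open>The remaining facts confirm that \<open>gw_tree\<close> is locally finite and that \<open>errw\<close> is the
  law of the walk described by \<open>errw_step\<close>.\<close>

lemma finite_nbrs_gw_tree: "finite (nbrs (gw_tree N) u)"
proof -
  have *: "u @ [i] \<in> gw_tree N \<Longrightarrow> i < N u" for i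
    by (erule gw_tree.cases) auto
  have "nbrs (gw_tree N) u \<subseteq> insert (butlast u) ((\<lambda>i. u @ [i]) ` {..<N u})"
    by (auto simp: nbrs_def dest: *)
  then show ?thesis
    by (rule finite_subset) auto
qed

lemma pmf_errw_step:
  assumes "\<Delta> > 0" and fin: "finite (nbrs T (X n))" and v: "v \<in> nbrs T (X n)"
  shows "pmf (errw_step T \<Delta> n X) v =
    edge_weight \<Delta> X n {X n, v} / (\<Sum>v'\<in>nbrs T (X n). edge_weight \<Delta> X n {X n, v'})"
proof -
  let ?S = "\<Sum>v'\<in>nbrs T (X n). edge_weight \<Delta> X n {X n, v'}"
  let ?f = "\<lambda>v. if v \<in> nbrs T (X n) then edge_weight \<Delta> X n {X n, v} / ?S else 0"
  have pos: "edge_weight \<Delta> X n e > 0" for e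
    using \<open>\<Delta> > 0\<close> unfolding edge_weight_def
    by (intro add_pos_nonneg mult_nonneg_nonneg sum_nonneg) auto
  have S: "?S > 0"
    using fin v by (intro sum_pos pos) auto
  have nn: "0 \<le> ?f v" for v
    by (simp add: less_imp_le[OF pos] sum_nonneg)
  have "(\<integral>\<^sup>+v. ennreal (?f v) \<partial>count_space UNIV) = (\<Sum>v\<in>nbrs T (X n). ennreal (?f v))"
    using fin by (intro nn_integral_count_space') auto
  also have "\<dots> = ennreal (\<Sum>v\<in>nbrs T (X n). ?f v)"
    by (intro sum_ennreal nn)
  also have "(\<Sum>v\<in>nbrs T (X n). ?f v) = 1"
    using S by (simp add: sum_divide_distrib[symmetric])
  finally have "pmf (embed_pmf ?f) v = ?f v"
    using nn by (intro pmf_embed_pmf) (rule nn, simp)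
  with v show ?thesis
    by (auto simp: errw_step_def)
qed

lemma sets_errw: "sets (errw T \<Delta>) = sets (\<Pi>\<^sub>M n\<in>UNIV. count_space UNIV)"
  by (simp add: errw_def)

lemma errw_C: "emeasure (errw T \<Delta>) {X. \<forall>i<n. X i = x i} =
  emeasure (errw.C T \<Delta> 0 n (\<lambda>_. undefined)) {restrict x {0..<n}}"
proof -
  have A: "{restrict x {0..<n}} \<in> sets (PiM {0..<n} (\<lambda>_. count_space UNIV))"
    by (intro sets_PiM_count_space_finite) (auto simp: space_PiM)
  have "{X. \<forall>i<n. X i = x i} = errw.PF.emb UNIV {0..<n} {restrict x {0..<n}}"
    by (auto simp: prod_emb_def space_PiM restrict_def fun_eq_iff) metis
  then have "emeasure (errw T \<Delta>) {X. \<forall>i<n. X i = x i} = emeasure (errw.CI T \<Delta> {0..<n}) {restrict x {0..<n}}"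
    using errw.lim[OF _ A] by (simp add: errw_def)
  also have "\<dots> = emeasure (errw.C T \<Delta> 0 n (\<lambda>_. undefined)) (errw.PF.emb {0..<n} {0..<n} {restrict x {0..<n}})"
    by (rule errw.emeasure_CI[OF _ A]) simp
  also have "errw.PF.emb {0..<n} {0..<n} {restrict x {0..<n}} = {restrict x {0..<n}}"
    using sets.sets_into_space[OF A] by (intro prod_emb_id) (auto simp: space_PiM)
  finally show ?thesis .
qed

lemma emeasure_errw_Suc:
  "emeasure (errw T \<Delta>) {X. \<forall>i<Suc n. X i = x i} =
    emeasure (errw T \<Delta>) {X. \<forall>i<n. X i = x i} * emeasure (errw_kernel T \<Delta> n (restrict x {0..<n})) {x n}"
proof -
  let ?C = "\<lambda>n. errw.C T \<Delta> 0 n (\<lambda>_. undefined)"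
  let ?x = "restrict x {0..<n}" and ?x' = "restrict x {0..<Suc n}"
  let ?M = "\<lambda>n. PiM {0..<n} (\<lambda>_. count_space (UNIV :: vertex set))"
  have A: "{restrict x {0..<k}} \<in> sets (?M k)" for k
    by (intro sets_PiM_count_space_finite) (auto simp: space_PiM)
  have u: "(\<lambda>_. undefined) \<in> space (?M 0)"
    by (simp add: space_PiM PiE_def extensional_def)
  have sp: "space (?C n) = space (?M n)"
    using errw.space_C[OF u] by simp
  have eP: "emeasure (errw.eP T \<Delta> n X) {?x'} =
      emeasure (errw_kernel T \<Delta> n ?x) {x n} * indicator {?x} X" if X: "X \<in> space (?M n)" for X
  proof -
    have ext: "X \<in> extensional {0..<n}"
      using X by (simp add: space_PiM PiE_def)
    have 1: "X(n := v) = ?x' \<longleftrightarrow> v = x n \<and> X = ?x" for v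
    proof
      assume *: "X(n := v) = ?x'"
      have "v = x n"
        using fun_cong[OF *, of n] by simp
      moreover have "X i = ?x i" for i
        using fun_cong[OF *, of i] ext by (cases "i < n") (auto simp: extensional_def)
      ultimately show "v = x n \<and> X = ?x"
        by auto
    qed (auto simp: fun_eq_iff restrict_def)
    have "(\<lambda>v. X(n := v)) -` {?x'} = {v. v = x n \<and> X = ?x}"
      by (simp only: vimage_def singleton_iff 1)
    also have "\<dots> = (if X = ?x then {x n} else {})"
      by auto
    finally have "(\<lambda>v. X(n := v)) -` {?x'} = (if X = ?x then {x n} else {})" .
    then show ?thesis
      by (simp add: errw.emeasure_eP[OF X A])
  qed
  have "emeasure (errw T \<Delta>) {X. \<forall>i<Suc n. X i = x i} = emeasure (?C n \<bind> errw.eP T \<Delta> n) {?x'}"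
    by (simp add: errw_C)
  also have "\<dots> = (\<integral>\<^sup>+X. emeasure (errw.eP T \<Delta> n X) {?x'} \<partial>?C n)"
  proof (rule emeasure_bind[OF _ _ A])
    show "space (?C n) \<noteq> {}"
      using prob_space.not_empty[OF errw.prob_space_C[OF u]] by simp
    show "errw.eP T \<Delta> n \<in> ?C n \<rightarrow>\<^sub>M subprob_algebra (?M (Suc n))"
      using errw.measurable_eP[of T \<Delta> n] errw.sets_C[OF u, of T \<Delta> n]
      by (simp cong: measurable_cong_sets)
  qed
  also have "\<dots> = (\<integral>\<^sup>+X. emeasure (errw_kernel T \<Delta> n ?x) {x n} * indicator {?x} X \<partial>?C n)"
    by (intro nn_integral_cong eP) (simp add: sp)
  also have "\<dots> = emeasure (errw_kernel T \<Delta> n ?x) {x n} * emeasure (?C n) {?x}"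
    using A[of n] errw.sets_C[OF u, of T \<Delta> n] by (intro nn_integral_cmult_indicator) simp
  finally show ?thesis
    by (simp add: errw_C mult.commute)
qed

lemma prob_space_errw: "prob_space (errw T \<Delta>)"
proof (rule prob_space_distrD)
  show "(\<lambda>X. restrict X {}) \<in> errw T \<Delta> \<rightarrow>\<^sub>M PiM {} (\<lambda>_. count_space UNIV)"
    unfolding errw_def by (simp cong: measurable_cong_sets)
  show "prob_space (distr (errw T \<Delta>) (PiM {} (\<lambda>_. count_space UNIV)) (\<lambda>X. restrict X {}))"
    unfolding errw_def errw.distr_lim[OF finite.emptyI] by (rule errw.PF.prob_space_P) auto
qed

lemma measure_errw_0: "measure (errw T \<Delta>) {X. X 0 = x} = of_bool (x = [])"
proof -
  interpret prob_space "errw T \<Delta>"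
    by (rule prob_space_errw)
  have "space (errw T \<Delta>) = UNIV"
    by (simp add: errw_def errw.PF.space_lim space_PiM)
  then show ?thesis
    using emeasure_errw_Suc[of T \<Delta> 0 "\<lambda>_. x"] emeasure_space_1 by (simp add: measure_def)
qed

lemma measure_errw_Suc:
  "measure (errw T \<Delta>) {X. \<forall>i\<le>Suc n. X i = x i} =
    measure (errw T \<Delta>) {X. \<forall>i\<le>n. X i = x i} * pmf (errw_step T \<Delta> n x) (x (Suc n))"
proof -
  let ?x = "restrict x {0..<Suc n}"
  have "edge_weight \<Delta> ?x n e = edge_weight \<Delta> x n e" for e
    unfolding edge_weight_def
    by (intro arg_cong2[where f = "(+)"] arg_cong2[where f = "(*)"] sum.cong refl) auto
  moreover have "?x n = x n"
    by simp
  ultimately have "errw_step T \<Delta> n ?x = errw_step T \<Delta> n x"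
    unfolding errw_step_def by (simp only:)
  then show ?thesis
    using emeasure_errw_Suc[of T \<Delta> "Suc n" x]
    by (simp add: less_Suc_eq_le measure_def enn2real_mult emeasure_pmf_single)
qed

end

theory Submission
  imports Defs "HOL-Library.Sublist"
begin

text \<open>By Polya's urn the walk is a random walk in an environment with independent transition
  probabilities, Dirichlet distributed at each vertex, with parameter \<open>a = 1/(2\<Delta>)\<close>. If \<open>A\<^sub>i\<close> is the
  ratio of the probabilities of stepping to the child \<open>i\<close> and to the parent, then
  \<open>E A\<^sub>i\<^sup>s = gmom a s\<close>, which is minimal at \<open>s = 1/4\<close>, where it is the Gamma ratio \<open>rho a\<close>. The
  probability \<open>Y\<close> of escaping below a vertex satisfies \<open>Y = S/(1+S)\<close> with \<open>S = \<Sum> A\<^sub>i Y\<^sub>i\<close>, the sum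
  running over the children.

  If \<open>m rho a \<le> 1\<close>, then \<open>E Y\<^sup>1\<^sup>/\<^sup>4 \<le> E S\<^sup>1\<^sup>/\<^sup>4 \<le> m rho a E Y\<^sup>1\<^sup>/\<^sup>4\<close>, and equality throughout forces
  \<open>S = 0\<close>. If \<open>m rho a > 1\<close>, then, since the exponent \<open>1/4\<close> is the minimum, Cramer's argument
  yields \<open>L\<close> such that the products of the \<open>A\<^sub>i\<close> along the paths of length \<open>L\<close>, truncated at \<open>1\<close>,
  have total mean above \<open>1\<close>. The resulting flow has bounded expected energy, hence \<open>Y\<close> does not vanish
  almost surely; since \<open>P(Y = 0)\<close> and the extinction probability are both the fixed point of the
  generating function below \<open>1\<close>, \<open>Y > 0\<close> on infinite trees. Finally \<open>E A\<^sub>i \<ge> 1\<close>, so that each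
  generation adds at least \<open>1\<close> to the expected length of an excursion.\<close>

section \<open>The Gamma ratio\<close>

text \<open>The origin of \<open>a\<close> is a balance on trees: between two departures towards the
  same child its edge is crossed twice, so the weights seen at departures grow by 2\<Delta>. In
  units of 2\<Delta> a child starts with 1/(2\<Delta>) = \<open>a\<close>, the parent edge, crossed
  once on arrival, with (1 + \<Delta>)/(2\<Delta>) = \<open>a\<close> + 1/2, and each choice adds 1.
  The exponent 1/4 comes from the symmetry of Gamma (a + s) Gamma (a + 1/2 - s) under s -> 1/2 - s.
  Two obstacles shape the proof. A Dirichlet vector depends on the number of children, whereas the
  tree argument wants identically distributed marks; stick breaking that starts from the parent
  makes the odds of child \<open>i\<close> a function of the sticks up to \<open>i\<close> alone.
  And the walk in the environment is never constructed as a process: averaged weights of finite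
  paths are matched with cylinder probabilities of the reinforced walk, and returns to the root
  become sums of weights over excursion words. The probability of \<open>k\<close> returns is then
  the \<open>k\<close>-th moment of a single random return probability, from which recurrence and
  transience are read off.\<close>

definition rho :: "real \<Rightarrow> real" where
  "rho a = Gamma (a + 1/4) ^ 2 / (Gamma a * Gamma (a + 1/2))"

lemma gamma_ratio_eq_rho:
  assumes "\<Delta> > 0"
  shows "gamma_ratio \<Delta> = rho (1 / (2 * \<Delta>))"
proof -
  have "(2 + \<Delta>) / (4 * \<Delta>) = 1 / (2 * \<Delta>) + 1/4" "(1 + \<Delta>) / (2 * \<Delta>) = 1 / (2 * \<Delta>) + 1/2"
    using assms by (auto simp: field_simps)
  then show ?thesis by (simp add: gamma_ratio_def rho_def)
qed

lemma pos_not_nonpos_Ints: "x > 0 \<Longrightarrow> (x :: real) \<notin> \<int>\<^sub>\<le>\<^sub>0"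
  by (auto elim!: nonpos_Ints_cases)

lemma rho_pos: "a > 0 \<Longrightarrow> rho a > 0"
  unfolding rho_def by (intro divide_pos_pos mult_pos_pos zero_less_power Gamma_real_pos) auto

lemma ln_rho:
  assumes "a > 0"
  shows "ln (rho a) = 2 * ln_Gamma (a + 1/4) - ln_Gamma a - ln_Gamma (a + 1/2)"
proof -
  have "Gamma a > 0" "Gamma (a + 1/4) > 0" "Gamma (a + 1/2) > 0"
    using assms by (auto intro!: Gamma_real_pos)
  then have "ln (Gamma (a + 1/4) ^ 2 / (Gamma a * Gamma (a + 1/2))) =
      2 * ln (Gamma (a + 1/4)) - (ln (Gamma a) + ln (Gamma (a + 1/2)))"
    by (subst ln_divide_pos) (auto simp: ln_mult_pos ln_realpow simp del: Gamma_real_pos)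
  then show ?thesis
    using assms by (simp add: rho_def ln_Gamma_real_pos)
qed

lemma DERIV_Digamma: "z > 0 \<Longrightarrow> DERIV Digamma z :> Polygamma 1 (z :: real)"
  using has_field_derivative_Polygamma[of z 0 UNIV] by (simp add: pos_not_nonpos_Ints)

text \<open>Strict concavity of \<open>Digamma\<close>: its derivative \<open>Polygamma 1\<close> is
  strictly decreasing, and the mean value points of the two quarter steps lie on either side of x +
  1/4.\<close>

lemma Digamma_midpoint_strict:
  assumes "x > (0::real)"
  shows "2 * Digamma (x + 1/4) > Digamma x + Digamma (x + 1/2)"
proof -
  have "\<exists>z>x. z < x + 1/4 \<and> Digamma (x + 1/4) - Digamma x = (x + 1/4 - x) * Polygamma 1 z"
    by (rule MVT2) (use assms in \<open>auto intro!: DERIV_Digamma simp del: One_nat_def\<close>)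
  then obtain y where y: "x < y" "y < x + 1/4" "Digamma (x + 1/4) - Digamma x = (1/4) * Polygamma 1 y"
    by auto
  have "\<exists>z>x+1/4. z < x + 1/2 \<and> Digamma (x + 1/2) - Digamma (x+1/4) = (x + 1/2 - (x+1/4)) * Polygamma 1 z"
    by (rule MVT2) (use assms in \<open>auto intro!: DERIV_Digamma simp del: One_nat_def\<close>)
  then obtain z where z: "x + 1/4 < z" "Digamma (x + 1/2) - Digamma (x + 1/4) = (1/4) * Polygamma 1 z"
    by auto
  have "Polygamma 1 z < (Polygamma 1 y :: real)"
    using y z assms by (intro Polygamma_real_strict_antimono) auto
  with y z show ?thesis by simp
qed

text \<open>The derivative of the logarithm of \<open>rho\<close> is exactly the midpoint excess of
  \<open>Digamma\<close>. Monotonicity yields uniqueness of the critical parameter and turns a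
  comparison of parameters into one of Gamma ratios.\<close>

lemma rho_strict_mono:
  assumes "0 < x" "x < y"
  shows "rho x < rho y"
proof -
  let ?g = "\<lambda>a::real. 2 * ln_Gamma (a + 1/4) - ln_Gamma a - ln_Gamma (a + 1/2)"
  have "?g x < ?g y"
  proof (rule DERIV_pos_imp_increasing[OF assms(2)])
    fix t assume t: "x \<le> t" "t \<le> y"
    then have "DERIV ?g t :> 2 * Digamma (t + 1/4) - Digamma t - Digamma (t + 1/2)"
      using assms by (auto intro!: derivative_eq_intros)
    moreover have "2 * Digamma (t + 1/4) - Digamma t - Digamma (t + 1/2) > 0"
      using Digamma_midpoint_strict[of t] t assms by simp
    ultimately show "\<exists>D. DERIV ?g t :> D \<and> D > 0" by blast
  qed
  then have "ln (rho x) < ln (rho y)" using assms by (simp add: ln_rho)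
  then show ?thesis using assms by (simp add: rho_pos)
qed

text \<open>\<open>rho\<close> is a second-order quotient of Gamma with step 1/4, so four
  consecutive factors telescope and only the functional equation of Gamma remains. This gives the
  limits of \<open>rho\<close> at 0 and at infinity without asymptotics of Gamma.\<close>

lemma rho_prod_4:
  assumes "x > 0"
  shows "rho x * rho (x + 1/4) * rho (x + 1/2) * rho (x + 3/4) = 4 * x / (4 * x + 1)"
proof -
  define g0 g1 g2 g3 where g: "g0 = Gamma x" "g1 = Gamma (x + 1/4)" "g2 = Gamma (x + 1/2)" "g3 = Gamma (x + 3/4)"
  have pos: "g0 > 0" "g1 > 0" "g2 > 0" "g3 > 0"
    using assms unfolding g by (auto intro!: Gamma_real_pos)
  have g4: "Gamma (x + 1) = x * g0" unfolding g
    using assms by (intro Gamma_plus1 pos_not_nonpos_Ints)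
  have g5: "Gamma (x + 5/4) = (x + 1/4) * g1" unfolding g
    using assms Gamma_plus1[of "x + 1/4"] by (simp add: pos_not_nonpos_Ints add.assoc)
  have r: "rho x = g1\<^sup>2 / (g0 * g2)" "rho (x + 1/4) = g2\<^sup>2 / (g1 * g3)"
    "rho (x + 1/2) = g3\<^sup>2 / (g2 * (x * g0))" "rho (x + 3/4) = (x * g0)\<^sup>2 / (g3 * ((x + 1/4) * g1))"
    unfolding rho_def g g4[unfolded g, symmetric] g5[unfolded g, symmetric] by (simp_all add: add.assoc)
  have "rho x * rho (x + 1/4) * rho (x + 1/2) * rho (x + 3/4) = x / (x + 1/4)"
    unfolding r using pos assms by (simp add: divide_simps power2_eq_square)
  also have "\<dots> = 4 * x / (4 * x + 1)" using assms by (simp add: field_simps)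
  finally show ?thesis .
qed

text \<open>By monotonicity the four factors in \<open>rho_prod_4\<close> lie between the first and
  the last one.\<close>

lemma rho_tendsto_bounds:
  assumes "x > 0"
  shows "rho x ^ 4 \<le> 4 * x / (4 * x + 1)" "4 * x / (4 * x + 1) \<le> rho (x + 3/4) ^ 4"
proof -
  have le: "rho x \<le> rho (x + 1/4)" "rho (x + 1/4) \<le> rho (x + 1/2)" "rho (x + 1/2) \<le> rho (x + 3/4)"
    using assms by (auto intro!: less_imp_le rho_strict_mono)
  have pos: "0 < rho x" using assms by (rule rho_pos)
  have "rho x ^ 4 = rho x * rho x * rho x * rho x" by (simp add: power4_eq_xxxx)
  also have "\<dots> \<le> rho x * rho (x + 1/4) * rho (x + 1/2) * rho (x + 3/4)"
    using le pos by (intro mult_mono) auto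
  finally show "rho x ^ 4 \<le> 4 * x / (4 * x + 1)" using rho_prod_4[OF assms] by simp
  have "rho x * rho (x + 1/4) * rho (x + 1/2) * rho (x + 3/4) \<le>
      rho (x + 3/4) * rho (x + 3/4) * rho (x + 3/4) * rho (x + 3/4)"
    using le pos by (intro mult_mono) auto
  then show "4 * x / (4 * x + 1) \<le> rho (x + 3/4) ^ 4"
    using rho_prod_4[OF assms] by (simp add: power4_eq_xxxx)
qed

lemma continuous_on_rho: "continuous_on {0<..} rho"
proof (rule continuous_at_imp_continuous_on, rule ballI)
  fix x :: real assume "x \<in> {0<..}"
  then show "isCont rho x"
    unfolding rho_def
    by (intro continuous_intros isCont_Gamma) (auto simp: pos_not_nonpos_Ints Gamma_eq_zero_iff)
qed

lemma ex_rho_eq: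
  assumes "0 < q" "q < 1"
  shows "\<exists>a>0. rho a = q"
proof -
  define Q where "Q = q ^ 4"
  have Q: "0 < Q" "Q < 1" using assms by (auto simp: Q_def power_less_one_iff)
  \<comment> \<open>4x/(4x+1) is at most 4x, which is Q here; the \<open>y\<close> below solves
    4y/(4y+1) = Q exactly.\<close>
  define x where "x = Q / 4"
  have x: "x > 0" using Q by (simp add: x_def)
  have "rho x ^ 4 \<le> 4 * x / (4 * x + 1)" by (rule rho_tendsto_bounds[OF x])
  also have "\<dots> \<le> Q" using Q by (simp add: x_def field_simps)
  finally have lo: "rho x \<le> q" unfolding Q_def using assms
    by (subst (asm) power_mono_iff) (auto intro: less_imp_le rho_pos x)
  define y where "y = Q / (4 * (1 - Q))"
  have y: "y > 0" using Q by (simp add: y_def)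
  have "4 * y / (4 * y + 1) = Q" using Q by (simp add: y_def field_simps)
  then have "Q \<le> rho (y + 3/4) ^ 4" using rho_tendsto_bounds(2)[OF y] by simp
  then have hi: "q \<le> rho (y + 3/4)" unfolding Q_def using assms y
    by (subst (asm) power_mono_iff) (auto intro!: less_imp_le[OF rho_pos])
  have "x \<le> y + 3/4"
  proof (rule ccontr)
    assume "\<not> ?thesis"
    then have "rho (y + 3/4) < rho x" using y by (intro rho_strict_mono) auto
    with lo hi show False by simp
  qed
  moreover have "continuous_on {x..y + 3/4} rho"
    using x by (auto intro: continuous_on_subset[OF continuous_on_rho])
  ultimately obtain a where "x \<le> a" "rho a = q"
    using lo hi IVT'[of rho x q "y + 3/4"] by blast
  with x show ?thesis by (intro exI[of _ a]) auto
qed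

lemma ex1_gamma_ratio:
  assumes "m > 1"
  shows "\<exists>!\<Delta>. \<Delta> > 0 \<and> gamma_ratio \<Delta> = 1 / m"
proof -
  obtain a where a: "a > 0" "rho a = 1 / m" using ex_rho_eq[of "1/m"] assms by auto
  have "gamma_ratio (1 / (2 * a)) = 1 / m" using a by (subst gamma_ratio_eq_rho) auto
  moreover have "\<Delta> = 1 / (2 * a)" if "\<Delta> > 0" "gamma_ratio \<Delta> = 1 / m" for \<Delta>
  proof -
    have "rho (1 / (2 * \<Delta>)) = rho a" using that a by (simp add: gamma_ratio_eq_rho)
    then have "1 / (2 * \<Delta>) = a"
      using rho_strict_mono[of "1 / (2 * \<Delta>)" a] rho_strict_mono[of a "1 / (2 * \<Delta>)"] that a
      by (metis less_irrefl linorder_neqE_linordered_idom zero_less_divide_1_iff zero_less_mult_iff zero_less_numeral)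
    then show ?thesis using that a by (auto simp: field_simps)
  qed
  ultimately show ?thesis using a by (intro ex1I[of _ "1 / (2 * a)"]) auto
qed

lemma gamma_ratio_strict_antimono:
  assumes "0 < x" "x < y"
  shows "gamma_ratio y < gamma_ratio x"
  using assms by (simp add: gamma_ratio_eq_rho rho_strict_mono frac_less2)

text \<open>The moment of order s of the ratio of two independent Gamma variables with shape
  parameters \<open>a\<close> (child) and \<open>a\<close> + 1/2 (parent), finite for -a < s < a +
  1/2.\<close>

definition gmom :: "real \<Rightarrow> real \<Rightarrow> real" where
  "gmom a s = Gamma (a + s) * Gamma (a + 1/2 - s) / (Gamma a * Gamma (a + 1/2))"

lemma gmom_quarter: "gmom a (1/4) = rho a"
  by (simp add: gmom_def rho_def power2_eq_square add.commute)

lemma gmom_pos: "a > 0 \<Longrightarrow> - a < s \<Longrightarrow> s < a + 1/2 \<Longrightarrow> gmom a s > 0"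
  by (auto simp: gmom_def intro!: divide_pos_pos mult_pos_pos Gamma_real_pos)

text \<open>The function \<open>gmom a\<close> is even about \<open>1/4\<close>, so its derivative vanishes there.\<close>

lemma gmom_near_quarter:
  assumes "a > 0" "\<delta> > 0"
  shows "\<exists>\<epsilon>>0. \<epsilon> < a \<and> exp (- \<delta> * \<epsilon>) * gmom a (1/4 + \<epsilon>) < rho a \<and> exp (- \<delta> * \<epsilon>) * gmom a (1/4 - \<epsilon>) < rho a"
proof -
  let ?f = "\<lambda>t. exp (- \<delta> * t) * gmom a (1/4 + t)"
  have nz: "Gamma a * Gamma (a + 1/2) \<noteq> 0" using assms by (auto simp: Gamma_eq_zero_iff pos_not_nonpos_Ints)
  \<comment> \<open>Only the exponential factor contributes to the slope at 0, and evenness lets one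
    \<open>e\<close> serve both signs.\<close>
  have "DERIV ?f 0 :> - \<delta> * gmom a (1/4)"
    unfolding gmom_def using assms nz
    by (auto intro!: derivative_eq_intros simp: pos_not_nonpos_Ints add.commute)
  then have "DERIV ?f 0 :> - \<delta> * rho a" by (simp add: gmom_quarter)
  moreover have "- \<delta> * rho a < 0" using assms rho_pos by simp
  ultimately obtain d where d: "d > 0" "\<And>h. 0 < h \<Longrightarrow> h < d \<Longrightarrow> ?f (0 + h) < ?f 0"
    using DERIV_neg_dec_right by blast
  define e where "e = min (d/2) (a/2)"
  have e: "e > 0" "e < d" "e < a" using d assms by (auto simp: e_def)
  have "?f e < rho a" using d(2)[of e] e by (simp add: gmom_quarter)
  moreover have "gmom a (1/4 - e) = gmom a (1/4 + e)" by (simp add: gmom_def algebra_simps)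
  ultimately show ?thesis using e by (intro exI[of _ e]) auto
qed

section \<open>Independent coordinates\<close>

text \<open>Dependence on the coordinates in \<open>K\<close> is stated pointwise, apart from
  measurability on the full product. Independence then only asks for disjoint sets of coordinates,
  and no product over a subset of the indices enters the statements.\<close>

definition depends_on :: "(('i \<Rightarrow> 'a) \<Rightarrow> 'b) \<Rightarrow> 'i set \<Rightarrow> bool" where
  "depends_on f K \<longleftrightarrow> (\<forall>\<omega> \<omega>'. (\<forall>i\<in>K. \<omega> i = \<omega>' i) \<longrightarrow> f \<omega> = f \<omega>')"

lemma indep_vars_coordinates:
  assumes "\<And>i. i \<in> I \<Longrightarrow> prob_space (M i)"
  shows "prob_space.indep_vars (PiM I M) M (\<lambda>i \<omega>. \<omega> i) I"
proof -
  interpret P: prob_space "PiM I M" using assms by (rule prob_space_PiM)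
  show ?thesis
  proof (cases "I = {}")
    case True
    then show ?thesis unfolding P.indep_vars_def P.indep_sets_def by simp
  next
    case False
    have "distr (PiM I M) (PiM I M) (\<lambda>x. \<lambda>i\<in>I. x i) = distr (PiM I M) (PiM I M) (\<lambda>x. x)"
      by (intro distr_cong) (auto simp: space_PiM)
    also have "\<dots> = PiM I M" by (simp add: distr_id)
    also have "\<dots> = PiM I (\<lambda>i. distr (PiM I M) (M i) (\<lambda>x. x i))"
      using assms by (intro PiM_cong refl distr_PiM_component[symmetric]) auto
    finally show ?thesis
      by (subst P.indep_vars_iff_distr_eq_PiM') (use False in auto)
  qed
qed

lemma nn_integral_PiM_indep:
  fixes F :: "'j \<Rightarrow> ('i \<Rightarrow> 'a) \<Rightarrow> ennreal"
  assumes M: "\<And>i. prob_space (M i)" and J: "finite J"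
    and F[measurable]: "\<And>j. j \<in> J \<Longrightarrow> F j \<in> borel_measurable (PiM UNIV M)"
    and dep: "\<And>j. j \<in> J \<Longrightarrow> depends_on (F j) (K j)"
    and disj: "disjoint_family_on K J"
  shows "(\<integral>\<^sup>+\<omega>. (\<Prod>j\<in>J. F j \<omega>) \<partial>PiM UNIV M) = (\<Prod>j\<in>J. \<integral>\<^sup>+\<omega>. F j \<omega> \<partial>PiM UNIV M)"
proof -
  interpret P: prob_space "PiM UNIV M" using M by (rule prob_space_PiM)
  have "\<exists>x. x \<in> space (M i)" for i using prob_space.not_empty[OF M] by auto
  then obtain x0 where x0: "\<And>i. x0 i \<in> space (M i)" by metis
  \<comment> \<open>Freezing the coordinates outside \<open>K j\<close> at a fixed point makes the
    function measurable on the product over \<open>K j\<close> alone and, by \<open>dep\<close>,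
    does not change its value.\<close>
  define G where "G j \<omega> = F j (\<lambda>i. if i \<in> K j then \<omega> i else x0 i)" for j \<omega>
  have "P.indep_vars M (\<lambda>i \<omega>. \<omega> i) UNIV" by (rule indep_vars_coordinates[OF M])
  then have "P.indep_vars (\<lambda>j. PiM (K j) M) (\<lambda>j \<omega>. restrict (\<lambda>i. \<omega> i) (K j)) J"
    by (rule P.indep_vars_restrict[OF _ _ disj]) auto
  moreover have "G j \<in> borel_measurable (PiM (K j) M)" if "j \<in> J" for j
  proof -
    have "(\<lambda>\<omega> i. if i \<in> K j then \<omega> i else x0 i) \<in> PiM (K j) M \<rightarrow>\<^sub>M PiM UNIV M"
    proof (rule measurable_PiM_single')
      show "(\<lambda>\<omega>. if i \<in> K j then \<omega> i else x0 i) \<in> PiM (K j) M \<rightarrow>\<^sub>M M i" if "i \<in> UNIV" for i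
        using x0[of i] by (cases "i \<in> K j") auto
    qed (auto simp: space_PiM PiE_iff x0)
    then show ?thesis unfolding G_def
      by (rule measurable_compose[OF _ F[OF that]])
  qed
  ultimately have "P.indep_vars (\<lambda>_. borel) (\<lambda>j \<omega>. G j (restrict (\<lambda>i. \<omega> i) (K j))) J"
    by (rule P.indep_vars_compose2)
  then have "(\<integral>\<^sup>+\<omega>. (\<Prod>j\<in>J. G j (restrict (\<lambda>i. \<omega> i) (K j))) \<partial>PiM UNIV M) =
      (\<Prod>j\<in>J. \<integral>\<^sup>+\<omega>. G j (restrict (\<lambda>i. \<omega> i) (K j)) \<partial>PiM UNIV M)"
    by (intro P.indep_vars_nn_integral J) auto
  moreover have "G j (restrict (\<lambda>i. \<omega> i) (K j)) = F j \<omega>" if "j \<in> J" for j \<omega>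
    using dep[OF that] unfolding G_def depends_on_def by (auto dest: spec)
  ultimately show ?thesis by (simp cong: prod.cong)
qed

lemma nn_integral_PiM_indep2:
  fixes f g :: "('i \<Rightarrow> 'a) \<Rightarrow> ennreal"
  assumes M: "\<And>i. prob_space (M i)"
    and [measurable]: "f \<in> borel_measurable (PiM UNIV M)" "g \<in> borel_measurable (PiM UNIV M)"
    and dep: "depends_on f K" "depends_on g L" and disj: "K \<inter> L = {}"
  shows "(\<integral>\<^sup>+\<omega>. f \<omega> * g \<omega> \<partial>PiM UNIV M) = (\<integral>\<^sup>+\<omega>. f \<omega> \<partial>PiM UNIV M) * (\<integral>\<^sup>+\<omega>. g \<omega> \<partial>PiM UNIV M)"
proof -
  have "(\<integral>\<^sup>+\<omega>. (\<Prod>j\<in>{True, False}. (if j then f else g) \<omega>) \<partial>PiM UNIV M) =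
      (\<Prod>j\<in>{True, False}. \<integral>\<^sup>+\<omega>. (if j then f else g) \<omega> \<partial>PiM UNIV M)"
    using dep disj by (intro nn_integral_PiM_indep[where K = "\<lambda>j. if j then K else L"] M)
      (auto simp: disjoint_family_on_def)
  then show ?thesis by simp
qed

lemma nn_integral_PiM_component:
  assumes M: "\<And>i. prob_space (M i)" and g: "g \<in> borel_measurable (M i)"
  shows "(\<integral>\<^sup>+\<omega>. g (\<omega> i) \<partial>PiM UNIV M) = (\<integral>\<^sup>+x. g x \<partial>M i)"
proof -
  have "(\<integral>\<^sup>+x. g x \<partial>M i) = (\<integral>\<^sup>+x. g x \<partial>distr (PiM UNIV M) (M i) (\<lambda>\<omega>. \<omega> i))"
    using M by (subst distr_PiM_component) auto
  also have "\<dots> = (\<integral>\<^sup>+\<omega>. g (\<omega> i) \<partial>PiM UNIV M)"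
    using g by (subst nn_integral_distr) auto
  finally show ?thesis by simp
qed

lemma nn_integral_PiM_prod:
  fixes f :: "'i \<Rightarrow> 'a \<Rightarrow> ennreal"
  assumes M: "\<And>i. prob_space (M i)" and J: "finite J"
    and f[measurable]: "\<And>i. i \<in> J \<Longrightarrow> f i \<in> borel_measurable (M i)"
  shows "(\<integral>\<^sup>+\<omega>. (\<Prod>i\<in>J. f i (\<omega> i)) \<partial>PiM UNIV M) = (\<Prod>i\<in>J. \<integral>\<^sup>+x. f i x \<partial>M i)"
proof -
  have "(\<integral>\<^sup>+\<omega>. (\<Prod>i\<in>J. f i (\<omega> i)) \<partial>PiM UNIV M) = (\<Prod>i\<in>J. \<integral>\<^sup>+\<omega>. f i (\<omega> i) \<partial>PiM UNIV M)"
    by (rule nn_integral_PiM_indep[OF M J, where K = "\<lambda>i. {i}"])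
       (auto simp: depends_on_def disjoint_family_on_def)
  also have "\<dots> = (\<Prod>i\<in>J. \<integral>\<^sup>+x. f i x \<partial>M i)"
    by (intro prod.cong refl nn_integral_PiM_component M f)
  finally show ?thesis .
qed

lemma distr_PiM_subtree:
  fixes M :: "vertex \<Rightarrow> 'a measure"
  assumes M: "\<And>i. prob_space (M i)"
  shows "distr (PiM UNIV M) (PiM UNIV (\<lambda>w. M (v @ w))) (\<lambda>\<omega> w. \<omega> (v @ w)) = PiM UNIV (\<lambda>w. M (v @ w))"
proof -
  have "inj ((@) v)" by (auto intro: injI)
  then show ?thesis using distr_PiM_reindex[of UNIV M "(@) v" UNIV] M by (simp add: restrict_UNIV)
qed

lemma measurable_subtree:
  "(\<lambda>\<omega> w. \<omega> (v @ w)) \<in> PiM UNIV M \<rightarrow>\<^sub>M PiM UNIV (\<lambda>w. M (v @ w))"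
  by (rule measurable_PiM_single') (auto simp: space_PiM)

lemma nn_integral_PiM_subtree:
  fixes M :: "vertex \<Rightarrow> 'a measure"
  assumes M: "\<And>i. prob_space (M i)" and g: "g \<in> borel_measurable (PiM UNIV (\<lambda>w. M (v @ w)))"
  shows "(\<integral>\<^sup>+\<omega>. g (\<lambda>w. \<omega> (v @ w)) \<partial>PiM UNIV M) = (\<integral>\<^sup>+\<omega>. g \<omega> \<partial>PiM UNIV (\<lambda>w. M (v @ w)))"
proof -
  let ?T = "\<lambda>\<omega> w. \<omega> (v @ w)" and ?N = "PiM UNIV (\<lambda>w. M (v @ w))"
  have m: "?T \<in> PiM UNIV M \<rightarrow>\<^sub>M ?N" by (rule measurable_subtree)
  have g': "g \<in> borel_measurable (distr (PiM UNIV M) ?N ?T)"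
    unfolding measurable_distr_eq1 by (rule g)
  have "integral\<^sup>N (distr (PiM UNIV M) ?N ?T) g = (\<integral>\<^sup>+\<omega>. g (?T \<omega>) \<partial>PiM UNIV M)"
    by (rule nn_integral_distr[OF m g'])
  then show ?thesis unfolding distr_PiM_subtree[where M = M and v = v, OF M] by (rule sym)
qed

lemma AE_PiM_subtree:
  fixes M :: "vertex \<Rightarrow> 'a measure"
  assumes M: "\<And>i. prob_space (M i)" and P: "AE \<omega> in PiM UNIV (\<lambda>w. M (v @ w)). P \<omega>"
  shows "AE \<omega> in PiM UNIV M. P (\<lambda>w. \<omega> (v @ w))"
proof -
  have "AE \<omega> in distr (PiM UNIV M) (PiM UNIV (\<lambda>w. M (v @ w))) (\<lambda>\<omega> w. \<omega> (v @ w)). P \<omega>"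
    unfolding distr_PiM_subtree[where M = M and v = v, OF M] by (rule P)
  from AE_distrD[OF measurable_subtree this] show ?thesis .
qed

text \<open>Both measures agree on finite cylinders: after Fubini, the product of the measures of
  the sections integrates factor by factor.\<close>

lemma PiM_pair_distr:
  fixes P :: "'a measure" and Q :: "'b measure"
  assumes P: "prob_space P" and Q: "prob_space Q"
  shows "distr (PiM (UNIV :: 'i set) (\<lambda>_. P) \<Otimes>\<^sub>M PiM (UNIV :: 'i set) (\<lambda>_. Q)) (PiM UNIV (\<lambda>_. P \<Otimes>\<^sub>M Q)) (\<lambda>(x, y) i. (x i, y i))
    = PiM (UNIV :: 'i set) (\<lambda>_. P \<Otimes>\<^sub>M Q)"
proof -
  interpret P: prob_space P by fact
  interpret Q: prob_space Q by fact
  interpret PQ: pair_prob_space P Q ..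
  interpret PP: product_prob_space "\<lambda>_. P" "UNIV :: 'i set" ..
  interpret QQ: product_prob_space "\<lambda>_. Q" "UNIV :: 'i set" ..
  interpret R: product_prob_space "\<lambda>_. P \<Otimes>\<^sub>M Q" "UNIV :: 'i set" ..
  let ?A = "PiM (UNIV :: 'i set) (\<lambda>_. P)" and ?B = "PiM (UNIV :: 'i set) (\<lambda>_. Q)"
  interpret AB: pair_prob_space ?A ?B ..
  have m[measurable]: "(\<lambda>(x, y) i. (x i, y i)) \<in> ?A \<Otimes>\<^sub>M ?B \<rightarrow>\<^sub>M PiM (UNIV :: 'i set) (\<lambda>_. P \<Otimes>\<^sub>M Q)"
    by (rule measurable_PiM_single') (auto simp: space_PiM space_pair_measure case_prod_beta)
  show ?thesis
  proof (rule R.PiM_eq)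
    fix J :: "'i set" and F assume J: "finite J" and F: "\<And>j. j \<in> J \<Longrightarrow> F j \<in> sets (P \<Otimes>\<^sub>M Q)"
    let ?S = "{z\<in>space (?A \<Otimes>\<^sub>M ?B). \<forall>j\<in>J. (fst z j, snd z j) \<in> F j}"
    have eqS: "(\<lambda>(x, y) i. (x i, y i)) -` prod_emb UNIV (\<lambda>_. P \<Otimes>\<^sub>M Q) J (Pi\<^sub>E J F) \<inter> space (?A \<Otimes>\<^sub>M ?B) = ?S"
    proof (rule set_eqI)
      fix z
      show "z \<in> (\<lambda>(x, y) i. (x i, y i)) -` prod_emb UNIV (\<lambda>_. P \<Otimes>\<^sub>M Q) J (Pi\<^sub>E J F) \<inter> space (?A \<Otimes>\<^sub>M ?B) \<longleftrightarrow> z \<in> ?S"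
        by (cases z) (simp add: prod_emb_iff restrict_PiE_iff space_pair_measure space_PiM PiE_iff, blast)
    qed
    have emb: "prod_emb UNIV (\<lambda>_. P \<Otimes>\<^sub>M Q) J (Pi\<^sub>E J F) \<in> sets (PiM UNIV (\<lambda>_. P \<Otimes>\<^sub>M Q))"
      using J F by (intro sets_PiM_I) auto
    have S: "?S \<in> sets (?A \<Otimes>\<^sub>M ?B)"
      using measurable_sets[OF m emb] unfolding eqS .
    have "emeasure (distr (?A \<Otimes>\<^sub>M ?B) (PiM UNIV (\<lambda>_. P \<Otimes>\<^sub>M Q)) (\<lambda>(x, y) i. (x i, y i)))
        (prod_emb UNIV (\<lambda>_. P \<Otimes>\<^sub>M Q) J (Pi\<^sub>E J F)) = emeasure (?A \<Otimes>\<^sub>M ?B) ?S"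
      by (subst emeasure_distr[OF m emb]) (simp only: eqS)
    also have "\<dots> = (\<integral>\<^sup>+x. emeasure ?B (Pair x -` ?S) \<partial>?A)"
      by (rule QQ.P.emeasure_pair_measure_alt[OF S])
    also have "\<dots> = (\<integral>\<^sup>+x. (\<Prod>j\<in>J. emeasure Q (Pair (x j) -` F j)) \<partial>?A)"
    proof (rule nn_integral_cong)
      fix x assume x: "x \<in> space ?A"
      have *: "Pair x -` ?S = {y\<in>space ?B. \<forall>j\<in>J. y j \<in> Pair (x j) -` F j}"
        using x by (auto simp: space_pair_measure)
      show "emeasure ?B (Pair x -` ?S) = (\<Prod>j\<in>J. emeasure Q (Pair (x j) -` F j))"
        unfolding * by (rule QQ.emeasure_PiM_Collect) (use J F in \<open>auto intro: sets_Pair1\<close>)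
    qed
    also have "\<dots> = (\<Prod>j\<in>J. \<integral>\<^sup>+x. emeasure Q (Pair x -` F j) \<partial>P)"
      by (rule nn_integral_PiM_prod[OF P J]) (rule Q.measurable_emeasure_Pair[OF F])
    also have "\<dots> = (\<Prod>j\<in>J. emeasure (P \<Otimes>\<^sub>M Q) (F j))"
      by (rule prod.cong[OF refl]) (rule Q.emeasure_pair_measure_alt[OF F, symmetric])
    finally show "emeasure (distr (?A \<Otimes>\<^sub>M ?B) (PiM UNIV (\<lambda>_. P \<Otimes>\<^sub>M Q)) (\<lambda>(x, y) i. (x i, y i)))
        (prod_emb UNIV (\<lambda>_. P \<Otimes>\<^sub>M Q) J (Pi\<^sub>E J F)) = (\<Prod>j\<in>J. emeasure (P \<Otimes>\<^sub>M Q) (F j))" .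
  qed simp
qed

text \<open>The tree argument works with i.i.d. pairs of an offspring number and sticks, whereas the
  theorem fixes the tree first. An almost sure statement about pairs becomes one for almost every
  tree and then almost every environment.\<close>

lemma AE_PiM_pair_iterated:
  fixes P :: "'a measure" and Q :: "'b measure"
  assumes P: "prob_space P" and Q: "prob_space Q" and "AE z in PiM (UNIV :: 'i set) (\<lambda>_. P \<Otimes>\<^sub>M Q). R (\<lambda>i. fst (z i)) (\<lambda>i. snd (z i))"
  shows "AE x in PiM (UNIV :: 'i set) (\<lambda>_. P). AE y in PiM (UNIV :: 'i set) (\<lambda>_. Q). R x y"
proof -
  let ?A = "PiM (UNIV :: 'i set) (\<lambda>_. P)" and ?B = "PiM (UNIV :: 'i set) (\<lambda>_. Q)"
  interpret A: prob_space ?A using P by (intro prob_space_PiM)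
  interpret B: prob_space ?B using Q by (intro prob_space_PiM)
  interpret AB: pair_prob_space ?A ?B ..
  have m: "(\<lambda>(x, y) i. (x i, y i)) \<in> ?A \<Otimes>\<^sub>M ?B \<rightarrow>\<^sub>M PiM (UNIV :: 'i set) (\<lambda>_. P \<Otimes>\<^sub>M Q)"
    by (rule measurable_PiM_single') (auto simp: space_PiM space_pair_measure case_prod_beta)
  have "AE z in distr (?A \<Otimes>\<^sub>M ?B) (PiM UNIV (\<lambda>_. P \<Otimes>\<^sub>M Q)) (\<lambda>(x, y) i. (x i, y i)).
      R (\<lambda>i. fst (z i)) (\<lambda>i. snd (z i))"
    by (subst PiM_pair_distr[OF P Q]) (rule assms(3))
  from AE_distrD[OF m this]
  have *: "AE z in ?A \<Otimes>\<^sub>M ?B. R (fst z) (snd z)"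
    by (simp only: case_prod_beta fst_conv snd_conv)
  from AB.AE_pair[OF *] show ?thesis by simp
qed

section \<open>Marked trees and the conductance recursion\<close>

text \<open>Series law: a unit edge (to the parent) followed by conductance \<open>s\<close>.
  Equally, the probability of escaping when the odds of escape against the parent are
  \<open>s\<close>.\<close>

definition esc :: "real \<Rightarrow> real" where "esc s = s / (1 + s)"

lemma esc_mono: "0 \<le> s \<Longrightarrow> s \<le> t \<Longrightarrow> esc s \<le> esc t"
  by (simp add: esc_def field_simps)

lemma esc_bounds: "0 \<le> s \<Longrightarrow> 0 \<le> esc s \<and> esc s \<le> s \<and> esc s \<le> 1"
  by (simp add: esc_def field_simps)

lemma esc_eq_0_iff: "0 \<le> s \<Longrightarrow> esc s = 0 \<longleftrightarrow> s = 0"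
  by (auto simp: esc_def)

lemma esc_eq_self_iff: "0 \<le> s \<Longrightarrow> esc s = s \<longleftrightarrow> s = 0"
  by (auto simp: esc_def field_simps)

lemma powr_add_le:
  fixes x y s :: real
  assumes "0 \<le> x" "0 \<le> y" "0 < s" "s \<le> 1"
  shows "(x + y) powr s \<le> x powr s + y powr s"
proof (cases "x + y = 0")
  case False
  then have p: "x + y > 0" using assms by simp
  have *: "z \<le> z powr s" if "0 \<le> z" "z \<le> 1" for z :: real
    using powr_mono'[of s 1 z] that assms by (cases "z = 0") auto
  \<comment> \<open>After normalising by x + y both parts lie in [0, 1], where z is at most z powr
    s.\<close>
  have "1 = x / (x + y) + y / (x + y)" using p by (simp add: add_divide_distrib[symmetric])
  also have "\<dots> \<le> (x / (x + y)) powr s + (y / (x + y)) powr s"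
    using assms p by (intro add_mono *) auto
  also have "\<dots> = (x powr s + y powr s) / (x + y) powr s"
    using assms by (simp add: powr_divide add_divide_distrib)
  finally show ?thesis using p by (simp add: field_simps)
qed (use assms in auto)

lemma powr_sum_le:
  fixes f :: "'b \<Rightarrow> real"
  assumes "0 < s" "s \<le> 1" "finite I" "\<And>i. i \<in> I \<Longrightarrow> 0 \<le> f i"
  shows "(\<Sum>i\<in>I. f i) powr s \<le> (\<Sum>i\<in>I. f i powr s)"
  using assms(3,4)
proof (induction I rule: finite_induct)
  case (insert i I)
  have "(f i + (\<Sum>i\<in>I. f i)) powr s \<le> f i powr s + (\<Sum>i\<in>I. f i) powr s"
    using assms insert by (intro powr_add_le) (auto intro: sum_nonneg)
  with insert show ?case by auto
qed simp

text \<open>The generating function F is convex and meets the diagonal at x and y, so it lies on or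
  above the diagonal on (y, 1). Hence (1 - F t)/(1 - t) is at most 1 there; letting t tend to 1
  gives m \<le> 1. The limit is taken in partial sums, which are polynomials in t.\<close>

lemma pgf_fixpoint_unique:
  fixes p :: "nat pmf" and x y m :: real
  assumes x: "(\<lambda>k. pmf p k * x ^ k) sums x" and y: "(\<lambda>k. pmf p k * y ^ k) sums y"
    and m: "(\<lambda>k. real k * pmf p k) sums m" and "m > 1" and xy: "0 \<le> x" "x < y" "y < 1"
  shows False
proof -
  have p1: "(\<lambda>k. pmf p k) sums 1"
  proof -
    have "(\<Sum>k. ennreal (pmf p k)) = ennreal 1"
      using nn_integral_pmf_eq_1[of p] by (simp only: nn_integral_count_space_nat ennreal_1)
    then have "(\<lambda>k. ennreal (pmf p k)) sums ennreal 1" by (metis summableI summable_sums)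
    then show ?thesis by (subst (asm) sums_ennreal) auto
  qed
  have key: "(\<Sum>k<K. pmf p k * (\<Sum>j<k. t ^ j)) \<le> 1" if t: "y < t" "t < 1" for t K
  proof -
    \<comment> \<open>The weight that writes y as a convex combination of x and t.\<close>
    define l where "l = (t - y) / (t - x)"
    have lt: "l * (t - x) = t - y" using t xy by (simp add: l_def)
    have l: "0 < l" "l < 1" using t xy by (auto simp: l_def field_simps)
    have ly: "y = l * x + (1 - l) * t" using lt by (simp add: algebra_simps)
    have st: "summable (\<lambda>k. pmf p k * t ^ k)"
      by (rule summable_comparison_test'[OF sums_summable[OF p1], of 0])
        (use t xy in \<open>auto simp: power_le_one mult_left_le abs_mult\<close>)
    define F where "F = (\<Sum>k. pmf p k * t ^ k)"
    have F: "(\<lambda>k. pmf p k * t ^ k) sums F" unfolding F_def using st by (rule summable_sums)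
    have conv: "y ^ k \<le> l * x ^ k + (1 - l) * t ^ k" for k
    proof -
      have "convex_on {0..} (\<lambda>z::real. z ^ k)"
        by (cases "even k") (auto intro: convex_power_odd convex_on_subset[OF convex_power_even])
      from convex_onD[OF this, of "1 - l" x t] show ?thesis using l ly xy t by simp
    qed
    have "y \<le> l * x + (1 - l) * F"
    proof (rule sums_le[OF _ y])
      show "(\<lambda>k. l * (pmf p k * x ^ k) + (1 - l) * (pmf p k * t ^ k)) sums (l * x + (1 - l) * F)"
        by (intro sums_add sums_mult x F)
      show "pmf p k * y ^ k \<le> l * (pmf p k * x ^ k) + (1 - l) * (pmf p k * t ^ k)" for k
        using mult_left_mono[OF conv[of k], of "pmf p k"] by (simp add: algebra_simps)
    qed
    with ly have "(1 - l) * t \<le> (1 - l) * F" by simp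
    then have tF: "t \<le> F" using l by simp
    have "(\<lambda>k. pmf p k - pmf p k * t ^ k) sums (1 - F)" by (intro sums_diff p1 F)
    \<comment> \<open>Dividing 1 - t ^ k by 1 - t leaves a sum that tends to k as t tends to
      1.\<close>
    moreover have "pmf p k - pmf p k * t ^ k = (1 - t) * (pmf p k * (\<Sum>j<k. t ^ j))" for k
    proof -
      have "pmf p k - pmf p k * t ^ k = pmf p k * (1 - t ^ k)" by (simp add: right_diff_distrib)
      also have "\<dots> = (1 - t) * (pmf p k * (\<Sum>j<k. t ^ j))" by (simp add: one_diff_power_eq)
      finally show ?thesis .
    qed
    ultimately have s: "(\<lambda>k. (1 - t) * (pmf p k * (\<Sum>j<k. t ^ j))) sums (1 - F)" by simp
    have "(\<Sum>k<K. (1 - t) * (pmf p k * (\<Sum>j<k. t ^ j))) \<le> 1 - F"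
      by (rule sum_le_suminf[OF sums_summable[OF s], of "{..<K}", unfolded sums_unique[OF s, symmetric]])
        (use t xy in \<open>auto intro!: sum_nonneg mult_nonneg_nonneg\<close>)
    then have "(1 - t) * (\<Sum>k<K. pmf p k * (\<Sum>j<k. t ^ j)) \<le> (1 - t) * 1"
      using tF by (simp add: sum_distrib_left)
    then show ?thesis using t by (subst (asm) mult_le_cancel_left_pos) auto
  qed
  have le1: "(\<Sum>k<K. real k * pmf p k) \<le> 1" for K
  proof -
    have "((\<lambda>t. \<Sum>k<K. pmf p k * (\<Sum>j<k. t ^ j)) \<longlongrightarrow> (\<Sum>k<K. pmf p k * (\<Sum>j<k. 1 ^ j))) (at_left 1)"
      by (intro tendsto_intros)
    then have "(\<Sum>k<K. pmf p k * (\<Sum>j<k. 1 ^ j)) \<le> 1"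
    proof (rule tendsto_upperbound)
      show "\<forall>\<^sub>F t in at_left 1. (\<Sum>k<K. pmf p k * (\<Sum>j<k. t ^ j)) \<le> 1"
        using eventually_at_left_real[OF xy(3)] by eventually_elim (auto intro: key)
    qed simp
    then show ?thesis by (simp add: mult.commute)
  qed
  have "m \<le> 1"
    using m by (intro LIMSEQ_le_const2[of "\<lambda>K. \<Sum>k<K. real k * pmf p k"]) (auto simp: sums_def le1)
  with \<open>m > 1\<close> show False by simp
qed

text \<open>The mark of a vertex carries its number of children and its odds towards every
  conceivable child. Marks sit independently on all words, so shifting by a prefix preserves their
  law; this is the self-similarity behind the recursions.\<close>

locale marked_tree = prob_space M for M :: "'a measure" +
  fixes deg :: "'a \<Rightarrow> nat" and A :: "nat \<Rightarrow> 'a \<Rightarrow> real"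
  assumes deg_m [measurable]: "deg \<in> M \<rightarrow>\<^sub>M count_space UNIV"
    and A_m [measurable]: "\<And>i. A i \<in> borel_measurable M"
    and A_pos: "\<And>i x. A i x > 0"
begin

abbreviation Om :: "(vertex \<Rightarrow> 'a) measure" where "Om \<equiv> PiM UNIV (\<lambda>_. M)"

sublocale Om: prob_space Om by (rule prob_space_PiM) (rule prob_space_axioms)

lemma measurable_sub:
  assumes "g \<in> Om \<rightarrow>\<^sub>M N"
  shows "(\<lambda>\<omega>. g (\<lambda>w. \<omega> (v @ w))) \<in> Om \<rightarrow>\<^sub>M N"
proof (rule measurable_compose[OF _ assms])
  show "(\<lambda>\<omega> w. \<omega> (v @ w)) \<in> Om \<rightarrow>\<^sub>M Om"
    by (rule measurable_PiM_single') (auto simp: space_PiM)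
qed

lemma measurable_child:
  assumes "g \<in> Om \<rightarrow>\<^sub>M N"
  shows "(\<lambda>\<omega>. g (\<lambda>w. \<omega> (i # w))) \<in> Om \<rightarrow>\<^sub>M N"
  using measurable_sub[OF assms, of "[i]"] by simp

lemma measurable_root: "f \<in> M \<rightarrow>\<^sub>M N \<Longrightarrow> (\<lambda>\<omega>. f (\<omega> [])) \<in> Om \<rightarrow>\<^sub>M N"
  by (rule measurable_compose[OF measurable_component_singleton]) auto

lemma nn_integral_sub:
  assumes "g \<in> borel_measurable Om"
  shows "(\<integral>\<^sup>+\<omega>. g (\<lambda>w. \<omega> (v @ w)) \<partial>Om) = (\<integral>\<^sup>+\<omega>. g \<omega> \<partial>Om)"
  using nn_integral_PiM_subtree[where M = "\<lambda>_. M", OF prob_space_axioms assms] .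

text \<open>Words shorter than \<open>v\<close> never extend \<open>v\<close>, so the two factors
  read disjoint sets of marks.\<close>

lemma nn_integral_indep_sub:
  assumes fm: "f \<in> borel_measurable Om" and g: "g \<in> borel_measurable Om"
    and f: "depends_on f {u. length u < length v}"
  shows "(\<integral>\<^sup>+\<omega>. f \<omega> * g (\<lambda>w. \<omega> (v @ w)) \<partial>Om) = (\<integral>\<^sup>+\<omega>. f \<omega> \<partial>Om) * (\<integral>\<^sup>+\<omega>. g \<omega> \<partial>Om)"
proof -
  have "(\<integral>\<^sup>+\<omega>. f \<omega> * g (\<lambda>w. \<omega> (v @ w)) \<partial>Om) = (\<integral>\<^sup>+\<omega>. f \<omega> \<partial>Om) * (\<integral>\<^sup>+\<omega>. g (\<lambda>w. \<omega> (v @ w)) \<partial>Om)"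
    by (rule nn_integral_PiM_indep2[OF prob_space_axioms fm measurable_sub[OF g] f, where L = "range ((@) v)"])
       (auto simp: depends_on_def intro!: arg_cong[of _ _ g])
  then show ?thesis by (simp add: nn_integral_sub g)
qed

lemma nn_integral_indep_sub2:
  assumes fm: "f \<in> borel_measurable Om" and g: "g \<in> borel_measurable Om" and h: "h \<in> borel_measurable Om"
    and f: "depends_on f {u. length u < length v}" and v: "length v = length v'" "v \<noteq> v'"
  shows "(\<integral>\<^sup>+\<omega>. f \<omega> * (g (\<lambda>w. \<omega> (v @ w)) * h (\<lambda>w. \<omega> (v' @ w))) \<partial>Om) =
    (\<integral>\<^sup>+\<omega>. f \<omega> \<partial>Om) * ((\<integral>\<^sup>+\<omega>. g \<omega> \<partial>Om) * (\<integral>\<^sup>+\<omega>. h \<omega> \<partial>Om))"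
proof -
  have "(\<integral>\<^sup>+\<omega>. f \<omega> * (g (\<lambda>w. \<omega> (v @ w)) * h (\<lambda>w. \<omega> (v' @ w))) \<partial>Om) =
      (\<integral>\<^sup>+\<omega>. f \<omega> \<partial>Om) * (\<integral>\<^sup>+\<omega>. g (\<lambda>w. \<omega> (v @ w)) * h (\<lambda>w. \<omega> (v' @ w)) \<partial>Om)"
    by (rule nn_integral_PiM_indep2[OF prob_space_axioms fm
        borel_measurable_times_ennreal[OF measurable_sub[OF g] measurable_sub[OF h]] f, where L = "range ((@) v) \<union> range ((@) v')"])
       (use v in \<open>auto simp: depends_on_def intro!: arg_cong2[where f = "(*)"] arg_cong[of _ _ g] arg_cong[of _ _ h]\<close>)
  also have "(\<integral>\<^sup>+\<omega>. g (\<lambda>w. \<omega> (v @ w)) * h (\<lambda>w. \<omega> (v' @ w)) \<partial>Om) =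
      (\<integral>\<^sup>+\<omega>. g (\<lambda>w. \<omega> (v @ w)) \<partial>Om) * (\<integral>\<^sup>+\<omega>. h (\<lambda>w. \<omega> (v' @ w)) \<partial>Om)"
    by (rule nn_integral_PiM_indep2[OF prob_space_axioms measurable_sub[OF g] measurable_sub[OF h], where K = "range ((@) v)" and L = "range ((@) v')"])
       (use v in \<open>auto simp: depends_on_def intro!: arg_cong[of _ _ g] arg_cong[of _ _ h]\<close>)
  finally show ?thesis by (simp add: nn_integral_sub g h)
qed

lemma nn_integral_root:
  assumes "f \<in> borel_measurable M"
  shows "(\<integral>\<^sup>+\<omega>. f (\<omega> []) \<partial>Om) = (\<integral>\<^sup>+x. f x \<partial>M)"
  by (rule nn_integral_PiM_component[OF prob_space_axioms assms])

lemma nn_integral_root_child: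
  assumes f: "f \<in> borel_measurable M" and g: "g \<in> borel_measurable Om"
  shows "(\<integral>\<^sup>+\<omega>. f (\<omega> []) * g (\<lambda>w. \<omega> (i # w)) \<partial>Om) = (\<integral>\<^sup>+x. f x \<partial>M) * (\<integral>\<^sup>+\<omega>. g \<omega> \<partial>Om)"
  using nn_integral_indep_sub[OF measurable_root[OF f] g, of "[i]"]
  by (simp add: nn_integral_root depends_on_def f)

text \<open>The branching identity. The number of terms is random and tied to the summands through
  the root mark, so the sum becomes a series in which the condition on \<open>deg\<close> belongs to
  the factor read at the root; that factor is independent of the subtree.\<close>

lemma nn_integral_sum_deg:
  assumes f [measurable]: "\<And>i. f i \<in> borel_measurable M" and g: "g \<in> borel_measurable Om"
  shows "(\<integral>\<^sup>+\<omega>. (\<Sum>i<deg (\<omega> []). f i (\<omega> []) * g (\<lambda>w. \<omega> (i # w))) \<partial>Om) =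
    (\<integral>\<^sup>+x. (\<Sum>i<deg x. f i x) \<partial>M) * (\<integral>\<^sup>+\<omega>. g \<omega> \<partial>Om)"
proof -
  have fm: "(\<lambda>x. if i < deg x then f i x else 0) \<in> borel_measurable M" for i by measurable
  note [measurable] = measurable_root[OF fm] measurable_child[OF g]
  have sum: "(\<Sum>i<n. h i) = (\<Sum>i. (if i < n then h i else 0 :: ennreal))" for n and h :: "nat \<Rightarrow> ennreal"
    by (subst suminf_finite[of "{..<n}"]) auto
  have "(\<integral>\<^sup>+\<omega>. (\<Sum>i<deg (\<omega> []). f i (\<omega> []) * g (\<lambda>w. \<omega> (i # w))) \<partial>Om) =
      (\<integral>\<^sup>+\<omega>. (\<Sum>i. (if i < deg (\<omega> []) then f i (\<omega> []) else 0) * g (\<lambda>w. \<omega> (i # w))) \<partial>Om)"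
    unfolding sum by (intro nn_integral_cong arg_cong[of _ _ suminf] ext) auto
  also have "\<dots> = (\<Sum>i. \<integral>\<^sup>+\<omega>. (if i < deg (\<omega> []) then f i (\<omega> []) else 0) * g (\<lambda>w. \<omega> (i # w)) \<partial>Om)"
    by (rule nn_integral_suminf) measurable
  also have "\<dots> = (\<Sum>i. (\<integral>\<^sup>+x. (if i < deg x then f i x else 0) \<partial>M) * (\<integral>\<^sup>+\<omega>. g \<omega> \<partial>Om))"
    by (simp only: nn_integral_root_child[OF fm g])
  also have "\<dots> = (\<Sum>i. \<integral>\<^sup>+x. (if i < deg x then f i x else 0) \<partial>M) * (\<integral>\<^sup>+\<omega>. g \<omega> \<partial>Om)"
    by (rule ennreal_suminf_multc)
  also have "(\<Sum>i. \<integral>\<^sup>+x. (if i < deg x then f i x else 0) \<partial>M) = (\<integral>\<^sup>+x. (\<Sum>i. if i < deg x then f i x else 0) \<partial>M)"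
    by (rule nn_integral_suminf[symmetric]) measurable
  finally show ?thesis unfolding sum .
qed

text \<open>The probability, starting at a vertex, of reaching generation \<open>n\<close> below it
  before stepping to its parent. Generation 0 is already reached, hence the start value 1.\<close>

primrec Yn :: "nat \<Rightarrow> (vertex \<Rightarrow> 'a) \<Rightarrow> real" where
  "Yn 0 = (\<lambda>\<omega>. 1)"
| "Yn (Suc n) = (\<lambda>\<omega>. esc (\<Sum>i<deg (\<omega> []). A i (\<omega> []) * Yn n (\<lambda>w. \<omega> (i # w))))"

lemma Yn_measurable [measurable]: "Yn n \<in> borel_measurable Om"
proof (induction n)
  case (Suc n)
  note [measurable] = measurable_child[OF Suc]
  have [measurable]: "(\<lambda>\<omega>. \<Sum>i<k. A i (\<omega> []) * Yn n (\<lambda>w. \<omega> (i # w))) \<in> borel_measurable Om" for k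
    by measurable
  have "(\<lambda>\<omega>. \<Sum>i<deg (\<omega> []). A i (\<omega> []) * Yn n (\<lambda>w. \<omega> (i # w))) \<in> borel_measurable Om"
    by (rule measurable_compose_countable[where f = "\<lambda>k \<omega>. \<Sum>i<k. A i (\<omega> []) * Yn n (\<lambda>w. \<omega> (i # w))"]) measurable
  then show ?case unfolding Yn.simps esc_def by measurable
qed simp

lemma Yn_bounds: "0 \<le> Yn n \<omega> \<and> Yn n \<omega> \<le> 1"
proof (induction n arbitrary: \<omega>)
  case (Suc n)
  then show ?case
    using esc_bounds[of "\<Sum>i<deg (\<omega> []). A i (\<omega> []) * Yn n (\<lambda>w. \<omega> (i # w))"]
    by (simp add: sum_nonneg less_imp_le[OF A_pos])
qed simp

lemma Yn_decseq: "Yn (Suc n) \<omega> \<le> Yn n \<omega>"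
proof (induction n arbitrary: \<omega>)
  case 0
  show ?case using Yn_bounds[of "Suc 0"] by (simp del: Yn.simps(2))
next
  case (Suc n)
  have "esc (\<Sum>i<deg (\<omega> []). A i (\<omega> []) * Yn (Suc n) (\<lambda>w. \<omega> (i # w))) \<le>
      esc (\<Sum>i<deg (\<omega> []). A i (\<omega> []) * Yn n (\<lambda>w. \<omega> (i # w)))"
    by (rule esc_mono)
       (use Suc Yn_bounds[of "Suc n"] in \<open>auto intro!: sum_nonneg sum_mono mult_left_mono mult_nonneg_nonneg less_imp_le[OF A_pos] simp del: Yn.simps\<close>)
  then show ?case
    using fun_cong[OF Yn.simps(2)[of "Suc n"], of \<omega>] fun_cong[OF Yn.simps(2)[of n], of \<omega>] by (simp only:)
qed

definition Ylim :: "(vertex \<Rightarrow> 'a) \<Rightarrow> real" where "Ylim \<omega> = lim (\<lambda>n. Yn n \<omega>)"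

lemma Ylim_LIMSEQ: "(\<lambda>n. Yn n \<omega>) \<longlonglongrightarrow> Ylim \<omega>"
proof -
  have "decseq (\<lambda>n. Yn n \<omega>)" by (rule decseq_SucI) (rule Yn_decseq)
  then have "convergent (\<lambda>n. Yn n \<omega>)"
    by (rule decseq_convergent[of _ 0]) (use Yn_bounds in \<open>auto simp: convergent_def\<close>)
  then show ?thesis unfolding Ylim_def by (simp add: convergent_LIMSEQ_iff)
qed

lemma Ylim_measurable [measurable]: "Ylim \<in> borel_measurable Om"
  by (rule borel_measurable_LIMSEQ_metric[OF Yn_measurable Ylim_LIMSEQ])

lemmas Ylim_child_measurable [measurable] = measurable_child[OF Ylim_measurable]

lemma Ylim_bounds: "0 \<le> Ylim \<omega> \<and> Ylim \<omega> \<le> 1"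
  using LIMSEQ_le_const[OF Ylim_LIMSEQ, of 0 \<omega>] LIMSEQ_le_const2[OF Ylim_LIMSEQ, of \<omega> 1] Yn_bounds by blast

definition Ysum :: "(vertex \<Rightarrow> 'a) \<Rightarrow> real" where
  "Ysum \<omega> = (\<Sum>i<deg (\<omega> []). A i (\<omega> []) * Ylim (\<lambda>w. \<omega> (i # w)))"

lemma Ysum_nonneg: "0 \<le> Ysum \<omega>"
  unfolding Ysum_def by (intro sum_nonneg mult_nonneg_nonneg less_imp_le[OF A_pos]) (simp add: Ylim_bounds)

lemma Ylim_eq: "Ylim \<omega> = esc (Ysum \<omega>)"
proof (rule LIMSEQ_unique)
  show "(\<lambda>n. Yn (Suc n) \<omega>) \<longlonglongrightarrow> Ylim \<omega>" using Ylim_LIMSEQ by (rule LIMSEQ_Suc)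
  have "(\<lambda>n. \<Sum>i<deg (\<omega> []). A i (\<omega> []) * Yn n (\<lambda>w. \<omega> (i # w))) \<longlonglongrightarrow> Ysum \<omega>"
    unfolding Ysum_def by (intro tendsto_intros Ylim_LIMSEQ)
  then show "(\<lambda>n. Yn (Suc n) \<omega>) \<longlonglongrightarrow> esc (Ysum \<omega>)"
    unfolding Yn.simps esc_def using Ysum_nonneg[of \<omega>] by (intro tendsto_intros) auto
qed

lemma Ysum_measurable [measurable]: "Ysum \<in> borel_measurable Om"
proof -
  have "(\<lambda>\<omega>. \<Sum>i<k. A i (\<omega> []) * Ylim (\<lambda>w. \<omega> (i # w))) \<in> borel_measurable Om" for k
    by measurable
  then show ?thesis unfolding Ysum_def
    by (rule measurable_compose_countable) measurable
qed

lemma Ylim_eq_0_iff: "Ylim \<omega> = 0 \<longleftrightarrow> (\<forall>i<deg (\<omega> []). Ylim (\<lambda>w. \<omega> (i # w)) = 0)"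
proof -
  have "Ylim \<omega> = 0 \<longleftrightarrow> Ysum \<omega> = 0" using Ylim_eq Ysum_nonneg esc_eq_0_iff by metis
  also have "\<dots> \<longleftrightarrow> (\<forall>i<deg (\<omega> []). Ylim (\<lambda>w. \<omega> (i # w)) = 0)"
    unfolding Ysum_def
    by (subst sum_nonneg_eq_0_iff)
      (auto simp: Ylim_bounds less_imp_le[OF A_pos] less_imp_neq[OF A_pos, symmetric])
  finally show ?thesis .
qed

theorem Ylim_eq_0_AE:
  assumes s: "0 < s" "s \<le> 1" and le1: "(\<integral>\<^sup>+x. (\<Sum>i<deg x. ennreal (A i x powr s)) \<partial>M) \<le> 1"
  shows "AE \<omega> in Om. Ylim \<omega> = 0"
proof -
  let ?g = "\<lambda>\<omega>. ennreal (Ylim \<omega> powr s)"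
  have "(\<integral>\<^sup>+\<omega>. ennreal (Ysum \<omega> powr s) \<partial>Om) \<le>
      (\<integral>\<^sup>+\<omega>. (\<Sum>i<deg (\<omega> []). ennreal (A i (\<omega> []) powr s) * ?g (\<lambda>w. \<omega> (i # w))) \<partial>Om)"
  proof (rule nn_integral_mono)
    fix \<omega>
    have "Ysum \<omega> powr s \<le> (\<Sum>i<deg (\<omega> []). (A i (\<omega> []) * Ylim (\<lambda>w. \<omega> (i # w))) powr s)"
      unfolding Ysum_def using s
      by (intro powr_sum_le) (auto simp: Ylim_bounds less_imp_le[OF A_pos])
    also have "\<dots> = (\<Sum>i<deg (\<omega> []). A i (\<omega> []) powr s * Ylim (\<lambda>w. \<omega> (i # w)) powr s)"
      by (intro sum.cong refl powr_mult)
    finally show "ennreal (Ysum \<omega> powr s) \<le>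
        (\<Sum>i<deg (\<omega> []). ennreal (A i (\<omega> []) powr s) * ?g (\<lambda>w. \<omega> (i # w)))"
      by (simp add: ennreal_mult[symmetric] sum_nonneg ennreal_leI)
  qed
  also have "\<dots> = (\<integral>\<^sup>+x. (\<Sum>i<deg x. ennreal (A i x powr s)) \<partial>M) * (\<integral>\<^sup>+\<omega>. ?g \<omega> \<partial>Om)"
    by (rule nn_integral_sum_deg) measurable
  also have "\<dots> \<le> 1 * (\<integral>\<^sup>+\<omega>. ?g \<omega> \<partial>Om)" using le1 by (rule mult_right_mono) simp
  finally have le: "(\<integral>\<^sup>+\<omega>. ennreal (Ysum \<omega> powr s) \<partial>Om) \<le> (\<integral>\<^sup>+\<omega>. ?g \<omega> \<partial>Om)" by simp
  have "(\<integral>\<^sup>+\<omega>. ?g \<omega> \<partial>Om) \<le> (\<integral>\<^sup>+\<omega>. 1 \<partial>Om)"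
    using s by (intro nn_integral_mono) (auto simp: ennreal_le_1 Ylim_bounds powr_le1)
  \<comment> \<open>The bound by 1 makes the integral finite, which permits subtraction; a
    nonnegative difference with integral 0 vanishes almost everywhere.\<close>
  then have fin: "(\<integral>\<^sup>+\<omega>. ?g \<omega> \<partial>Om) \<noteq> \<infinity>" by (auto simp: Om.emeasure_space_1 top_unique)
  have YS: "Ylim \<omega> \<le> Ysum \<omega>" for \<omega> unfolding Ylim_eq using esc_bounds[OF Ysum_nonneg] by simp
  have mono: "?g \<omega> \<le> ennreal (Ysum \<omega> powr s)" for \<omega>
    using s YS by (intro ennreal_leI powr_mono2) (auto simp: Ylim_bounds)
  have "(\<integral>\<^sup>+\<omega>. ennreal (Ysum \<omega> powr s) - ?g \<omega> \<partial>Om) =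
      (\<integral>\<^sup>+\<omega>. ennreal (Ysum \<omega> powr s) \<partial>Om) - (\<integral>\<^sup>+\<omega>. ?g \<omega> \<partial>Om)"
    by (rule nn_integral_diff) (use fin mono in auto)
  also have "\<dots> = 0" using le fin by (simp add: diff_eq_0_iff_ennreal top.not_eq_extremum)
  finally have "AE \<omega> in Om. ennreal (Ysum \<omega> powr s) - ?g \<omega> = 0"
    by (subst (asm) nn_integral_0_iff_AE) auto
  then show ?thesis
  proof eventually_elim
    case (elim \<omega>)
    then have "Ysum \<omega> powr s \<le> Ylim \<omega> powr s"
      by (simp add: diff_eq_0_iff_ennreal)
    then have "Ysum \<omega> \<le> Ylim \<omega>"
      using s Ysum_nonneg Ylim_bounds powr_less_mono2[of s "Ylim \<omega>" "Ysum \<omega>"] by force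
    with YS[of \<omega>] have "esc (Ysum \<omega>) = Ysum \<omega>" by (simp add: Ylim_eq)
    then show "Ylim \<omega> = 0" using Ysum_nonneg esc_eq_self_iff Ylim_eq by metis
  qed
qed

text \<open>For an event that holds at a vertex exactly when it holds at all its children, the left
  side is the measure of \<open>B\<close> itself, and this becomes the fixed point equation of the
  offspring generating function.\<close>

lemma emeasure_all_children:
  assumes B [measurable]: "B \<in> sets Om"
  shows "emeasure Om {\<omega>\<in>space Om. \<forall>i<deg (\<omega> []). (\<lambda>w. \<omega> (i # w)) \<in> B} = (\<integral>\<^sup>+x. emeasure Om B ^ deg x \<partial>M)"
proof -
  let ?y = "emeasure Om B"
  have iB: "(indicator B :: _ \<Rightarrow> ennreal) \<in> borel_measurable Om" by measurable
  note [measurable] = measurable_child[OF iB]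
  have sum: "h n = (\<Sum>k. (if n = k then 1 else 0) * h k)" for n and h :: "nat \<Rightarrow> ennreal"
    by (subst suminf_finite[of "{n}"]) auto
  have [measurable]: "{\<omega>\<in>space Om. \<forall>i<deg (\<omega> []). (\<lambda>w. \<omega> (i # w)) \<in> B} \<in> sets Om"
  proof -
    have "{\<omega>\<in>space Om. \<forall>i<deg (\<omega> []). (\<lambda>w. \<omega> (i # w)) \<in> B} =
        {\<omega>\<in>space Om. \<forall>i. i < deg (\<omega> []) \<longrightarrow> (indicator B (\<lambda>w. \<omega> (i # w)) :: ennreal) = 1}"
      by (auto simp: indicator_def)
    also have "\<dots> \<in> sets Om" by measurable
    finally show ?thesis .
  qed
  have "emeasure Om {\<omega>\<in>space Om. \<forall>i<deg (\<omega> []). (\<lambda>w. \<omega> (i # w)) \<in> B} =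
      (\<integral>\<^sup>+\<omega>. indicator {\<omega>\<in>space Om. \<forall>i<deg (\<omega> []). (\<lambda>w. \<omega> (i # w)) \<in> B} \<omega> \<partial>Om)"
    by simp
  also have "\<dots> = (\<integral>\<^sup>+\<omega>. (\<Prod>i<deg (\<omega> []). indicator B (\<lambda>w. \<omega> (i # w))) \<partial>Om)"
    by (intro nn_integral_cong) (auto simp: indicator_def prod_zero_iff)
  also have "\<dots> = (\<integral>\<^sup>+\<omega>. (\<Sum>k. (if deg (\<omega> []) = k then 1 else 0) * (\<Prod>i<k. indicator B (\<lambda>w. \<omega> (i # w)))) \<partial>Om)"
    by (intro nn_integral_cong sum)
  also have "\<dots> = (\<Sum>k. \<integral>\<^sup>+\<omega>. (if deg (\<omega> []) = k then 1 else 0) * (\<Prod>i<k. indicator B (\<lambda>w. \<omega> (i # w))) \<partial>Om)"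
    by (rule nn_integral_suminf) measurable
  also have "\<dots> = (\<Sum>k. \<integral>\<^sup>+x. (if deg x = k then 1 else 0) * ?y ^ k \<partial>M)"
  proof (intro arg_cong[of _ _ suminf] ext)
    fix k
    have "(\<integral>\<^sup>+\<omega>. (if deg (\<omega> []) = k then 1 else 0) * (\<Prod>i<k. indicator B (\<lambda>w. \<omega> (i # w))) \<partial>Om) =
        (\<integral>\<^sup>+\<omega>. (if deg (\<omega> []) = k then 1 else 0) \<partial>Om) * (\<integral>\<^sup>+\<omega>. (\<Prod>i<k. indicator B (\<lambda>w. \<omega> (i # w))) \<partial>Om)"
      by (rule nn_integral_PiM_indep2[OF prob_space_axioms, where K = "{[]}" and L = "{u. u \<noteq> []}"])
         (auto simp: depends_on_def intro!: prod.cong arg_cong[of _ _ "indicator B"])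
    also have "(\<integral>\<^sup>+\<omega>. (\<Prod>i<k. indicator B (\<lambda>w. \<omega> (i # w))) \<partial>Om) = (\<Prod>i<k. \<integral>\<^sup>+\<omega>. indicator B (\<lambda>w. \<omega> (i # w)) \<partial>Om)"
      by (rule nn_integral_PiM_indep[OF prob_space_axioms, where K = "\<lambda>i. range (\<lambda>w. i # w)"])
         (auto simp: depends_on_def disjoint_family_on_def intro!: arg_cong[of _ _ "indicator B"])
    also have "\<dots> = ?y ^ k"
      using nn_integral_sub[OF iB, of "[_]"] by simp
    finally show "(\<integral>\<^sup>+\<omega>. (if deg (\<omega> []) = k then 1 else 0) * (\<Prod>i<k. indicator B (\<lambda>w. \<omega> (i # w))) \<partial>Om) =
        (\<integral>\<^sup>+x. (if deg x = k then 1 else 0) * ?y ^ k \<partial>M)"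
      by (simp add: nn_integral_multc nn_integral_root[of "\<lambda>x. if deg x = k then 1 else 0"])
  qed
  also have "\<dots> = (\<integral>\<^sup>+x. (\<Sum>k. (if deg x = k then 1 else 0) * ?y ^ k) \<partial>M)"
    by (rule nn_integral_suminf[symmetric]) measurable
  also have "\<dots> = (\<integral>\<^sup>+x. ?y ^ deg x \<partial>M)"
    by (intro nn_integral_cong sum[symmetric])
  finally show ?thesis .
qed

end

text \<open>The inductive definition adds letters at the end of a word, while the recursions strip
  them from the front; this mediates between the two.\<close>

lemma Cons_mem_gw_tree_iff: "i # w \<in> gw_tree N \<longleftrightarrow> i < N [] \<and> w \<in> gw_tree (\<lambda>w. N (i # w))"
proof (induction w rule: rev_induct)
  case Nil
  have "[i] \<in> gw_tree N \<longleftrightarrow> i < N []"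
    by (subst gw_tree.simps) (auto intro: gw_tree.root)
  then show ?case by (simp add: gw_tree.root)
next
  case (snoc j w)
  have *: "u @ [k] \<in> gw_tree N' \<longleftrightarrow> u \<in> gw_tree N' \<and> k < N' u" for u k N'
    by (subst gw_tree.simps) auto
  show ?case using *[of "i # w" j N] *[of w j "\<lambda>w. N (i # w)"] snoc by auto
qed

lemma gw_tree_decomp: "gw_tree N = insert [] (\<Union>i<N []. (#) i ` gw_tree (\<lambda>w. N (i # w)))"
proof (rule set_eqI)
  fix v show "v \<in> gw_tree N \<longleftrightarrow> v \<in> insert [] (\<Union>i<N []. (#) i ` gw_tree (\<lambda>w. N (i # w)))"
    by (cases v) (auto simp: Cons_mem_gw_tree_iff gw_tree.root)
qed

lemma finite_gw_tree_children: "finite (gw_tree N) \<longleftrightarrow> (\<forall>i<N []. finite (gw_tree (\<lambda>w. N (i # w))))"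
proof -
  have "finite (gw_tree N) \<longleftrightarrow> finite (insert [] (\<Union>i<N []. (#) i ` gw_tree (\<lambda>w. N (i # w))))"
    using gw_tree_decomp[of N] by (rule arg_cong)
  then show ?thesis by (auto simp: finite_image_iff)
qed

text \<open>Extinction before generation \<open>n\<close>. Finiteness of the tree is the countable
  union of these conditions, hence an event, and each of them forces \<open>Yn n\<close> to
  vanish.\<close>

primrec dead :: "nat \<Rightarrow> (vertex \<Rightarrow> nat) \<Rightarrow> bool" where
  "dead 0 N \<longleftrightarrow> False"
| "dead (Suc n) N \<longleftrightarrow> (\<forall>i<N []. dead n (\<lambda>w. N (i # w)))"

lemma dead_imp_finite: "dead n N \<Longrightarrow> finite (gw_tree N)"
proof (induction n arbitrary: N)
  case (Suc n)
  then show ?case by (subst finite_gw_tree_children) auto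
qed simp

lemma dead_if_bounded: "(\<And>w. w \<in> gw_tree N \<Longrightarrow> length w < n) \<Longrightarrow> dead n N"
proof (induction n arbitrary: N)
  case 0
  from 0[OF gw_tree.root] show ?case by simp
next
  case (Suc n)
  show ?case unfolding dead.simps
  proof (intro allI impI Suc.IH)
    fix i w assume "i < N []" "w \<in> gw_tree (\<lambda>w. N (i # w))"
    then have "i # w \<in> gw_tree N" by (simp add: Cons_mem_gw_tree_iff)
    from Suc.prems[OF this] show "length w < n" by simp
  qed
qed

lemma finite_gw_tree_iff_dead: "finite (gw_tree N) \<longleftrightarrow> (\<exists>n. dead n N)"
proof
  assume fin: "finite (gw_tree N)"
  have "length w < Suc (Max (length ` gw_tree N))" if "w \<in> gw_tree N" for w
    using that fin by (simp add: less_Suc_eq_le)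
  then show "\<exists>n. dead n N" using dead_if_bounded by blast
qed (auto intro: dead_imp_finite)

text \<open>Candidates for descendants \<open>L\<close> generations down that use only the first
  \<open>D\<close> children of each vertex. The set is finite and deterministic; words outside the
  tree receive weight 0 through \<open>At\<close>.\<close>

definition words :: "nat \<Rightarrow> nat \<Rightarrow> vertex set" where
  "words D L = {v. set v \<subseteq> {..<D} \<and> length v = L}"

lemma finite_words [simp]: "finite (words D L)"
  unfolding words_def by (rule finite_lists_length_eq) simp

lemma words_0 [simp]: "words D 0 = {[]}"
  by (auto simp: words_def)

lemma sum_words_Suc:
  "(\<Sum>v\<in>words D (Suc L). f v) = (\<Sum>i<D. \<Sum>v\<in>words D L. f (i # v))"
proof -
  have "words D (Suc L) = (\<lambda>x. fst x # snd x) ` ({..<D} \<times> words D L)"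
    by (auto simp: words_def image_iff length_Suc_conv)
  moreover have "inj_on (\<lambda>x. fst x # snd x) ({..<D} \<times> words D L)"
    by (auto simp: inj_on_def)
  ultimately have "(\<Sum>v\<in>words D (Suc L). f v) = (\<Sum>x\<in>{..<D} \<times> words D L. f (fst x # snd x))"
    by (simp add: sum.reindex)
  also have "\<dots> = (\<Sum>i<D. \<Sum>v\<in>words D L. f (i # v))"
    by (simp add: sum.cartesian_product case_prod_beta)
  finally show ?thesis .
qed

text \<open>K m/(m - 1) is the fixed point of x -> x/m + K; the maximum with 1 lets the later
  inductions start at the value 1.\<close>

lemma ex_affine_invariant:
  fixes m K :: real
  assumes "m > 1" "K \<ge> 0"
  shows "\<exists>\<kappa>\<ge>1. \<kappa> / m + K \<le> \<kappa>"
proof (intro exI conjI)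
  let ?k = "max 1 (K * m / (m - 1))"
  show "1 \<le> ?k" by simp
  have "K * m \<le> ?k * (m - 1)" using assms by (simp add: pos_divide_le_eq[symmetric])
  then show "?k / m + K \<le> ?k" using assms by (simp add: field_simps)
qed

lemma sum_mult_square_le:
  fixes x y z :: "'b \<Rightarrow> real"
  assumes "\<And>i. i \<in> I \<Longrightarrow> 0 \<le> x i" "\<And>i. i \<in> I \<Longrightarrow> 0 \<le> y i" "\<And>i. i \<in> I \<Longrightarrow> (z i)\<^sup>2 \<le> x i * y i"
  shows "(\<Sum>i\<in>I. z i)\<^sup>2 \<le> (\<Sum>i\<in>I. x i) * (\<Sum>i\<in>I. y i)"
proof -
  have "\<bar>\<Sum>i\<in>I. z i\<bar> \<le> (\<Sum>i\<in>I. \<bar>z i\<bar>)" by (rule sum_abs)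
  also have "\<dots> \<le> (\<Sum>i\<in>I. sqrt (x i) * sqrt (y i))"
  proof (rule sum_mono)
    fix i assume "i \<in> I"
    then have "\<bar>z i\<bar> \<le> sqrt (x i * y i)" using assms by (intro real_le_rsqrt) simp
    then show "\<bar>z i\<bar> \<le> sqrt (x i) * sqrt (y i)" by (simp add: real_sqrt_mult)
  qed
  finally have "(\<Sum>i\<in>I. z i)\<^sup>2 \<le> (\<Sum>i\<in>I. sqrt (x i) * sqrt (y i))\<^sup>2"
    by (metis abs_ge_zero power2_abs power_mono)
  also have "\<dots> \<le> (\<Sum>i\<in>I. (sqrt (x i))\<^sup>2) * (\<Sum>i\<in>I. (sqrt (y i))\<^sup>2)"
    by (rule Cauchy_Schwarz_ineq_sum)
  also have "\<dots> = (\<Sum>i\<in>I. x i) * (\<Sum>i\<in>I. y i)" using assms by simp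
  finally show ?thesis .
qed

section \<open>Truncated odds along paths and reduction to blocks of generations\<close>

context marked_tree
begin

text \<open>Odds below the cutoff \<epsilon> are replaced by 0, as are those of missing children.
  The cutoff bounds the resistance of a block, see \<open>cblock\<close>; its loss is made small in
  the end by the choice of \<epsilon>.\<close>

definition At :: "real \<Rightarrow> nat \<Rightarrow> 'a \<Rightarrow> real" where
  "At \<epsilon> i x = (if i < deg x \<and> \<epsilon> \<le> A i x then A i x else 0)"

lemma At_nonneg: "0 \<le> At \<epsilon> i x"
  using A_pos[of i x] by (simp add: At_def)

lemma At_measurable [measurable]: "At \<epsilon> i \<in> borel_measurable M"
  unfolding At_def by measurable

primrec av :: "real \<Rightarrow> vertex \<Rightarrow> (vertex \<Rightarrow> 'a) \<Rightarrow> real" where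
  "av \<epsilon> [] = (\<lambda>\<omega>. 1)"
| "av \<epsilon> (i # v) = (\<lambda>\<omega>. At \<epsilon> i (\<omega> []) * av \<epsilon> v (\<lambda>w. \<omega> (i # w)))"

lemma av_nonneg: "0 \<le> av \<epsilon> v \<omega>"
  by (induction v arbitrary: \<omega>) (auto simp: At_nonneg)

lemma av_measurable [measurable]: "av \<epsilon> v \<in> borel_measurable Om"
proof (induction v)
  case (Cons i v)
  note [measurable] = measurable_child[OF Cons] measurable_root[OF At_measurable]
  show ?case unfolding av.simps by measurable
qed simp

lemma av_cong: "(\<And>u. length u < length v \<Longrightarrow> \<omega> u = \<omega>' u) \<Longrightarrow> av \<epsilon> v \<omega> = av \<epsilon> v \<omega>'"
proof (induction v arbitrary: \<omega> \<omega>')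
  case (Cons i v)
  have "\<omega> [] = \<omega>' []" by (rule Cons.prems) simp
  moreover have "av \<epsilon> v (\<lambda>w. \<omega> (i # w)) = av \<epsilon> v (\<lambda>w. \<omega>' (i # w))"
    by (rule Cons.IH, rule Cons.prems) simp
  ultimately show ?case by simp
qed simp

text \<open>The weight of a path is a product of independent truncated odds, so the moment sum over
  generation \<open>L\<close> is a power of the one over the first generation.\<close>

lemma sum_av_powr:
  "(\<Sum>v\<in>words D L. \<integral>\<^sup>+\<omega>. ennreal (av \<epsilon> v \<omega> powr s) \<partial>Om) = (\<Sum>i<D. \<integral>\<^sup>+x. ennreal (At \<epsilon> i x powr s) \<partial>M) ^ L"
proof (induction L)
  case 0
  show ?case by (simp add: Om.emeasure_space_1)
next
  case (Suc L)
  have "(\<integral>\<^sup>+\<omega>. ennreal (av \<epsilon> (i # v) \<omega> powr s) \<partial>Om) =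
      (\<integral>\<^sup>+x. ennreal (At \<epsilon> i x powr s) \<partial>M) * (\<integral>\<^sup>+\<omega>. ennreal (av \<epsilon> v \<omega> powr s) \<partial>Om)" for i v
  proof -
    have "(\<integral>\<^sup>+\<omega>. ennreal (av \<epsilon> (i # v) \<omega> powr s) \<partial>Om) =
        (\<integral>\<^sup>+\<omega>. ennreal (At \<epsilon> i (\<omega> []) powr s) * ennreal (av \<epsilon> v (\<lambda>w. \<omega> (i # w)) powr s) \<partial>Om)"
      by (simp add: powr_mult ennreal_mult)
    also have "\<dots> = (\<integral>\<^sup>+x. ennreal (At \<epsilon> i x powr s) \<partial>M) * (\<integral>\<^sup>+\<omega>. ennreal (av \<epsilon> v \<omega> powr s) \<partial>Om)"
      by (rule nn_integral_root_child) measurable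
    finally show ?thesis .
  qed
  then show ?case
    by (simp add: sum_words_Suc sum_distrib_left[symmetric] sum_distrib_right[symmetric] Suc)
qed

definition Sblock :: "real \<Rightarrow> nat \<Rightarrow> nat \<Rightarrow> nat \<Rightarrow> (vertex \<Rightarrow> 'a) \<Rightarrow> real" where
  "Sblock \<epsilon> D n L \<omega> = (\<Sum>v\<in>words D L. av \<epsilon> v \<omega> * Yn n (\<lambda>w. \<omega> (v @ w)))"

lemma Sblock_nonneg: "0 \<le> Sblock \<epsilon> D n L \<omega>"
  unfolding Sblock_def by (intro sum_nonneg mult_nonneg_nonneg av_nonneg) (simp add: Yn_bounds)

lemma Sblock_Suc: "Sblock \<epsilon> D n (Suc L) \<omega> = (\<Sum>i<D. At \<epsilon> i (\<omega> []) * Sblock \<epsilon> D n L (\<lambda>w. \<omega> (i # w)))"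
  unfolding Sblock_def by (simp add: sum_words_Suc sum_distrib_left mult.assoc)

text \<open>A bound for the resistance of a block: each generation adds its unit edge, and the part
  below is rescaled by 1/\<epsilon>.\<close>

primrec cblock :: "real \<Rightarrow> nat \<Rightarrow> real" where
  "cblock \<epsilon> 0 = 0"
| "cblock \<epsilon> (Suc L) = 1 + cblock \<epsilon> L / \<epsilon>"

lemma cblock_nonneg: "\<epsilon> > 0 \<Longrightarrow> 0 \<le> cblock \<epsilon> L"
  by (induction L) auto

text \<open>The network is bounded from below by the total conductance \<open>Sblock\<close> in
  series with the resistance \<open>cblock\<close>. In the induction step nonzero odds are at least
  \<epsilon>, so the block sum of each child that counts is at most 1/\<epsilon> times the new one;
  all children thus get the same denominator, and the series law turns c/\<epsilon> into 1 +
  c/\<epsilon>.\<close>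

lemma Yn_ge_block:
  assumes "\<epsilon> > 0"
  shows "Sblock \<epsilon> D n L \<omega> / (1 + cblock \<epsilon> L * Sblock \<epsilon> D n L \<omega>) \<le> Yn (n + L) \<omega>"
proof (induction L arbitrary: \<omega>)
  case 0
  show ?case by (simp add: Sblock_def)
next
  case (Suc L)
  let ?c = "cblock \<epsilon> L" and ?S = "\<lambda>i. Sblock \<epsilon> D n L (\<lambda>w. \<omega> (i # w))" and ?S' = "Sblock \<epsilon> D n (Suc L) \<omega>"
  note c = cblock_nonneg[OF assms, of L]
  let ?Y = "\<lambda>i. Yn (n + L) (\<lambda>w. \<omega> (i # w))"
  have "?S' / (1 + ?c / \<epsilon> * ?S') = (\<Sum>i<D. At \<epsilon> i (\<omega> []) * ?S i / (1 + ?c / \<epsilon> * ?S'))"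
    by (simp add: Sblock_Suc sum_divide_distrib)
  also have "\<dots> \<le> (\<Sum>i<D. At \<epsilon> i (\<omega> []) * ?Y i)"
  proof (rule sum_mono)
    fix i assume i: "i \<in> {..<D}"
    show "At \<epsilon> i (\<omega> []) * ?S i / (1 + ?c / \<epsilon> * ?S') \<le> At \<epsilon> i (\<omega> []) * ?Y i"
    proof (cases "At \<epsilon> i (\<omega> []) = 0")
      case False
      then have "\<epsilon> \<le> At \<epsilon> i (\<omega> [])" by (auto simp: At_def split: if_splits)
      then have "\<epsilon> * ?S i \<le> At \<epsilon> i (\<omega> []) * ?S i" by (intro mult_right_mono Sblock_nonneg)
      also have "\<dots> \<le> ?S'" unfolding Sblock_Suc
        by (rule member_le_sum[OF i]) (auto simp: At_nonneg Sblock_nonneg)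
      finally have "?S i \<le> ?S' / \<epsilon>" using assms by (simp add: pos_le_divide_eq mult.commute)
      then have "?c * ?S i \<le> ?c / \<epsilon> * ?S'" using mult_left_mono[OF _ c] by fastforce
      then have "?S i / (1 + ?c / \<epsilon> * ?S') \<le> ?S i / (1 + ?c * ?S i)"
        using c Sblock_nonneg by (intro divide_left_mono) (auto intro!: mult_pos_pos add_pos_nonneg simp: assms less_imp_le)
      also have "\<dots> \<le> ?Y i" by (rule Suc.IH)
      finally have "At \<epsilon> i (\<omega> []) * (?S i / (1 + ?c / \<epsilon> * ?S')) \<le> At \<epsilon> i (\<omega> []) * ?Y i"
        by (rule mult_left_mono) (rule At_nonneg)
      then show ?thesis by simp
    qed simp
  qed
  also have "\<dots> = (\<Sum>i\<in>{..<D} \<inter> {..<deg (\<omega> [])}. At \<epsilon> i (\<omega> []) * ?Y i)"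
    by (rule sum.mono_neutral_right) (auto simp: At_def)
  also have "\<dots> \<le> (\<Sum>i\<in>{..<D} \<inter> {..<deg (\<omega> [])}. A i (\<omega> []) * ?Y i)"
    by (intro sum_mono mult_right_mono) (auto simp: At_def Yn_bounds less_imp_le[OF A_pos])
  also have "\<dots> \<le> (\<Sum>i<deg (\<omega> []). A i (\<omega> []) * ?Y i)"
    by (rule sum_mono2) (auto simp: Yn_bounds less_imp_le[OF A_pos])
  finally have le: "?S' / (1 + ?c / \<epsilon> * ?S') \<le> (\<Sum>i<deg (\<omega> []). A i (\<omega> []) * ?Y i)" .
  have S'0: "0 \<le> ?S'" by (rule Sblock_nonneg)
  define x where "x = ?c / \<epsilon> * ?S'"
  have x: "0 \<le> x" using c assms S'0 by (simp add: x_def)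
  have "esc (?S' / (1 + x)) = ?S' / (1 + x + ?S')"
    using x S'0 by (simp add: esc_def divide_simps add_pos_nonneg)
  moreover have "1 + x + ?S' = 1 + cblock \<epsilon> (Suc L) * ?S'" by (simp add: x_def algebra_simps)
  ultimately have "?S' / (1 + cblock \<epsilon> (Suc L) * ?S') = esc (?S' / (1 + ?c / \<epsilon> * ?S'))"
    by (simp add: x_def)
  also have "\<dots> \<le> esc (\<Sum>i<deg (\<omega> []). A i (\<omega> []) * ?Y i)"
    using le S'0 x unfolding x_def by (intro esc_mono) auto
  also have "\<dots> = Yn (n + Suc L) \<omega>" by simp
  finally show ?case .
qed

theorem surviving_AE:
  assumes nz: "\<not> (AE \<omega> in Om. Ylim \<omega> = 0)"
    and p: "\<And>k. emeasure M {x\<in>space M. deg x = k} = ennreal (pmf p k)"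
    and m: "(\<lambda>k. real k * pmf p k) sums m" "m > 1"
  shows "AE \<omega> in Om. infinite (gw_tree (\<lambda>u. deg (\<omega> u))) \<longrightarrow> Ylim \<omega> > 0"
proof -
  have fixpt: "(\<lambda>k. pmf p k * measure Om B ^ k) sums measure Om B"
    if B: "B \<in> sets Om" and eq: "B = {\<omega>\<in>space Om. \<forall>i<deg (\<omega> []). (\<lambda>w. \<omega> (i # w)) \<in> B}" for B
  proof -
    let ?y = "measure Om B"
    have sum: "h n = (\<Sum>k. (if n = k then 1 else 0) * h k)" for n and h :: "nat \<Rightarrow> ennreal"
      by (subst suminf_finite[of "{n}"]) auto
    have [measurable]: "{x\<in>space M. deg x = k} \<in> sets M" for k by measurable
    have "ennreal ?y = emeasure Om B" by (simp add: Om.emeasure_eq_measure)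
    also have "\<dots> = (\<integral>\<^sup>+x. emeasure Om B ^ deg x \<partial>M)"
      by (subst eq) (rule emeasure_all_children[OF B])
    also have "\<dots> = (\<integral>\<^sup>+x. (\<Sum>k. (if deg x = k then 1 else 0) * ennreal ?y ^ k) \<partial>M)"
      unfolding Om.emeasure_eq_measure by (intro nn_integral_cong sum)
    also have "\<dots> = (\<Sum>k. \<integral>\<^sup>+x. (if deg x = k then 1 else 0) * ennreal ?y ^ k \<partial>M)"
      by (rule nn_integral_suminf) measurable
    also have "\<dots> = (\<Sum>k. \<integral>\<^sup>+x. ennreal ?y ^ k * indicator {x\<in>space M. deg x = k} x \<partial>M)"
      by (intro arg_cong[of _ _ suminf] ext nn_integral_cong) (auto simp: indicator_def)
    also have "\<dots> = (\<Sum>k. ennreal (pmf p k * ?y ^ k))"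
      by (subst nn_integral_cmult_indicator) (auto simp: p ennreal_mult ennreal_power mult.commute)
    finally have "(\<Sum>k. ennreal (pmf p k * ?y ^ k)) = ennreal ?y" by simp
    then have "(\<lambda>k. ennreal (pmf p k * ?y ^ k)) sums ennreal ?y" by (metis summableI summable_sums)
    then show ?thesis by (subst (asm) sums_ennreal) auto
  qed
  define B where "B = {\<omega>\<in>space Om. Ylim \<omega> = 0}"
  define F where "F = {\<omega>\<in>space Om. finite (gw_tree (\<lambda>u. deg (\<omega> u)))}"
  have child_space: "(\<lambda>w. \<omega> (i # w)) \<in> space Om" if "\<omega> \<in> space Om" for \<omega> i
    using that by (auto simp: space_PiM)
  have dead_m: "Measurable.pred Om (\<lambda>\<omega>. dead n (\<lambda>u. deg (\<omega> u)))" for n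
  proof (induction n)
    case (Suc n)
    note [measurable] = measurable_child[OF Suc]
    show ?case unfolding dead.simps by measurable
  qed simp
  have Bs: "B \<in> sets Om" unfolding B_def by measurable
  have Fs: "F \<in> sets Om" unfolding F_def finite_gw_tree_iff_dead using dead_m by measurable
  \<comment> \<open>Extinction makes the escape probability vanish surely, so once the two events
    have equal probability they agree up to a null set.\<close>
  have "F \<subseteq> B"
  proof
    fix \<omega> assume "\<omega> \<in> F"
    then obtain n where n: "dead n (\<lambda>u. deg (\<omega> u))" and sp: "\<omega> \<in> space Om"
      by (auto simp: F_def finite_gw_tree_iff_dead)
    have "dead n (\<lambda>u. deg (\<omega> u)) \<Longrightarrow> Yn n \<omega> = 0" for n \<omega>
      by (induction n arbitrary: \<omega>) (auto simp: esc_def)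
    with n have "Yn n \<omega> = 0" by blast
    moreover have "Ylim \<omega> \<le> Yn n \<omega>"
      by (rule decseq_ge[OF decseq_SucI Ylim_LIMSEQ]) (rule Yn_decseq)
    ultimately show "\<omega> \<in> B" using Ylim_bounds[of \<omega>] sp by (simp add: B_def)
  qed
  then have le: "measure Om F \<le> measure Om B" using Bs Fs by (intro Om.finite_measure_mono)
  have Beq: "(\<lambda>k. pmf p k * measure Om B ^ k) sums measure Om B"
  proof (rule fixpt[OF Bs], rule set_eqI)
    fix \<omega> show "\<omega> \<in> B \<longleftrightarrow> \<omega> \<in> {\<omega>\<in>space Om. \<forall>i<deg (\<omega> []). (\<lambda>w. \<omega> (i # w)) \<in> B}"
      using Ylim_eq_0_iff[of \<omega>] by (auto simp: B_def child_space)
  qed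
  have Feq: "(\<lambda>k. pmf p k * measure Om F ^ k) sums measure Om F"
  proof (rule fixpt[OF Fs], rule set_eqI)
    fix \<omega> show "\<omega> \<in> F \<longleftrightarrow> \<omega> \<in> {\<omega>\<in>space Om. \<forall>i<deg (\<omega> []). (\<lambda>w. \<omega> (i # w)) \<in> F}"
      using finite_gw_tree_children[of "\<lambda>u. deg (\<omega> u)"] by (auto simp: F_def child_space)
  qed
  have "measure Om B \<noteq> 1"
    using nz Om.AE_in_set_eq_1[OF Bs] by (auto simp: B_def elim!: eventually_mono)
  then have "measure Om B < 1" using Om.prob_le_1[of B] by linarith
  then have "measure Om F = measure Om B"
    using pgf_fixpoint_unique[OF Feq Beq m] le measure_nonneg[of Om F] by force
  then have "measure Om (B - F) = 0"
    using \<open>F \<subseteq> B\<close> Bs Fs by (simp add: Om.finite_measure_Diff)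
  then have "B - F \<in> null_sets Om"
    using Bs Fs by (auto simp: null_sets_def Om.emeasure_eq_measure)
  from AE_not_in[OF this] show ?thesis
  proof (rule AE_mp, intro AE_I2 impI)
    fix \<omega> assume "\<omega> \<in> space Om" "\<omega> \<notin> B - F" "infinite (gw_tree (\<lambda>u. deg (\<omega> u)))"
    then have "Ylim \<omega> \<noteq> 0" by (auto simp: B_def F_def)
    then show "Ylim \<omega> > 0" using Ylim_bounds[of \<omega>] by simp
  qed
qed

end

section \<open>Flows of bounded energy\<close>

context marked_tree
begin

definition gv :: "real \<Rightarrow> vertex \<Rightarrow> (vertex \<Rightarrow> 'a) \<Rightarrow> real" where
  "gv \<epsilon> v \<omega> = min 1 (av \<epsilon> v \<omega>)"

text \<open>The last two bounds are the purpose of the truncation: the square below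
  \<open>gv\<close> controls second moments without second moments of the odds, and the square below
  \<open>gv\<close> times \<open>av\<close> compares the truncated flow with the
  conductances.\<close>

lemma gv_bounds: "0 \<le> gv \<epsilon> v \<omega>" "gv \<epsilon> v \<omega> \<le> 1" "(gv \<epsilon> v \<omega>)\<^sup>2 \<le> gv \<epsilon> v \<omega>" "(gv \<epsilon> v \<omega>)\<^sup>2 \<le> gv \<epsilon> v \<omega> * av \<epsilon> v \<omega>"
proof -
  show *: "0 \<le> gv \<epsilon> v \<omega>" "gv \<epsilon> v \<omega> \<le> 1" using av_nonneg by (auto simp: gv_def)
  show "(gv \<epsilon> v \<omega>)\<^sup>2 \<le> gv \<epsilon> v \<omega>" using * by (simp add: power2_eq_square mult_left_le)
  show "(gv \<epsilon> v \<omega>)\<^sup>2 \<le> gv \<epsilon> v \<omega> * av \<epsilon> v \<omega>" unfolding power2_eq_square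
    using * by (intro mult_left_mono) (auto simp: gv_def)
qed

lemma gv_measurable [measurable]: "gv \<epsilon> v \<in> borel_measurable Om"
  unfolding gv_def by measurable

lemma gv_depends: "length v = n \<Longrightarrow> depends_on (\<lambda>\<omega>. ennreal (gv \<epsilon> v \<omega>)) {u. length u < n}"
  using av_cong[of v _ _ \<epsilon>] unfolding depends_on_def gv_def by (metis mem_Collect_eq)

text \<open>The flow that sends through a vertex \<open>v\<close> at distance \<open>L\<close> a share proportional to
  \<open>min 1 (av \<epsilon> v)\<close>, and (an upper bound for) its energy.\<close>

primrec Wq :: "real \<Rightarrow> nat \<Rightarrow> nat \<Rightarrow> real \<Rightarrow> nat \<Rightarrow> (vertex \<Rightarrow> 'a) \<Rightarrow> real" where
  "Wq \<epsilon> D L m 0 = (\<lambda>\<omega>. 1)"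
| "Wq \<epsilon> D L m (Suc q) = (\<lambda>\<omega>. (\<Sum>v\<in>words D L. gv \<epsilon> v \<omega> * Wq \<epsilon> D L m q (\<lambda>w. \<omega> (v @ w))) / m)"

primrec Eq :: "real \<Rightarrow> nat \<Rightarrow> nat \<Rightarrow> real \<Rightarrow> nat \<Rightarrow> (vertex \<Rightarrow> 'a) \<Rightarrow> real" where
  "Eq \<epsilon> D L m 0 = (\<lambda>\<omega>. 1)"
| "Eq \<epsilon> D L m (Suc q) = (\<lambda>\<omega>. cblock \<epsilon> L * (Wq \<epsilon> D L m (Suc q) \<omega>)\<^sup>2 +
    (\<Sum>v\<in>words D L. gv \<epsilon> v \<omega> * Eq \<epsilon> D L m q (\<lambda>w. \<omega> (v @ w))) / m\<^sup>2)"

lemma Wq_measurable [measurable]: "Wq \<epsilon> D L m q \<in> borel_measurable Om"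
proof (induction q)
  case (Suc q)
  note [measurable] = measurable_sub[OF Suc]
  show ?case unfolding Wq.simps by measurable
qed simp

lemma Eq_measurable [measurable]: "Eq \<epsilon> D L m q \<in> borel_measurable Om"
proof (induction q)
  case (Suc q)
  note [measurable] = measurable_sub[OF Suc]
  show ?case unfolding Eq.simps by measurable
qed simp

context
  fixes \<epsilon> :: real and D L :: nat and m :: real
  assumes eps: "\<epsilon> > 0" and m1: "m > 1"
    and mean: "(\<Sum>v\<in>words D L. \<integral>\<^sup>+\<omega>. ennreal (gv \<epsilon> v \<omega>) \<partial>Om) = ennreal m"
begin

abbreviation "W \<equiv> Wq \<epsilon> D L m"
abbreviation "E \<equiv> Eq \<epsilon> D L m"

lemma W_nonneg: "0 \<le> W q \<omega>"
  by (induction q arbitrary: \<omega>) (use m1 gv_bounds in \<open>auto intro!: divide_nonneg_pos sum_nonneg mult_nonneg_nonneg\<close>)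

lemma E_nonneg: "0 \<le> E q \<omega>"
  by (induction q arbitrary: \<omega>)
    (use m1 gv_bounds cblock_nonneg[OF eps] in \<open>auto intro!: add_nonneg_nonneg divide_nonneg_pos sum_nonneg mult_nonneg_nonneg\<close>)

text \<open>Thomson's principle by induction over blocks: the squared strength of a flow is at most
  the conductance times the energy. Across a block this is the Cauchy-Schwarz inequality;
  \<open>Yn_ge_block\<close> accounts for the block's own resistance, which is the term with
  \<open>cblock\<close> in the energy.\<close>

lemma W_square_le: "(W q \<omega>)\<^sup>2 \<le> Yn (q * L) \<omega> * E q \<omega>"
proof (induction q arbitrary: \<omega>)
  case 0
  show ?case by simp
next
  case (Suc q)
  let ?w = "W (Suc q) \<omega>" and ?S = "Sblock \<epsilon> D (q * L) L \<omega>"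
  let ?K = "(\<Sum>v\<in>words D L. gv \<epsilon> v \<omega> * E q (\<lambda>w. \<omega> (v @ w))) / m\<^sup>2"
  note c = cblock_nonneg[OF eps, of L]
  have S: "0 \<le> ?S" by (rule Sblock_nonneg)
  have K: "0 \<le> ?K" using m1 gv_bounds E_nonneg by (intro divide_nonneg_nonneg sum_nonneg mult_nonneg_nonneg) auto
  have "(\<Sum>v\<in>words D L. gv \<epsilon> v \<omega> * W q (\<lambda>w. \<omega> (v @ w)))\<^sup>2 \<le>
      ?S * (\<Sum>v\<in>words D L. gv \<epsilon> v \<omega> * E q (\<lambda>w. \<omega> (v @ w)))"
    unfolding Sblock_def
  proof (rule sum_mult_square_le)
    fix v
    let ?v = "\<lambda>w. \<omega> (v @ w)"
    show "0 \<le> av \<epsilon> v \<omega> * Yn (q * L) ?v" using av_nonneg Yn_bounds by simp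
    show "0 \<le> gv \<epsilon> v \<omega> * E q ?v" using gv_bounds E_nonneg by simp
    have "(gv \<epsilon> v \<omega> * W q ?v)\<^sup>2 = (gv \<epsilon> v \<omega>)\<^sup>2 * (W q ?v)\<^sup>2" by (rule power_mult_distrib)
    also have "\<dots> \<le> (gv \<epsilon> v \<omega> * av \<epsilon> v \<omega>) * (Yn (q * L) ?v * E q ?v)"
      using gv_bounds av_nonneg Suc by (intro mult_mono) auto
    finally show "(gv \<epsilon> v \<omega> * W q ?v)\<^sup>2 \<le> av \<epsilon> v \<omega> * Yn (q * L) ?v * (gv \<epsilon> v \<omega> * E q ?v)"
      by (simp add: mult_ac)
  qed
  then have wSK: "?w\<^sup>2 \<le> ?S * ?K"
    using m1 by (simp add: power_divide divide_right_mono)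
  have pos: "0 < 1 + cblock \<epsilon> L * ?S" using c S by (simp add: add_pos_nonneg)
  \<comment> \<open>Adding c ?S ?w^2 to both sides of \<open>wSK\<close> and dividing by 1 + c ?S
    makes the lower bound of \<open>Yn_ge_block\<close> appear.\<close>
  have "?w\<^sup>2 * (1 + cblock \<epsilon> L * ?S) \<le> ?S * (cblock \<epsilon> L * ?w\<^sup>2 + ?K)"
    using wSK by (simp add: algebra_simps)
  then have "?w\<^sup>2 \<le> ?S / (1 + cblock \<epsilon> L * ?S) * (cblock \<epsilon> L * ?w\<^sup>2 + ?K)"
    using pos by (simp add: pos_le_divide_eq)
  also have "\<dots> \<le> Yn (q * L + L) \<omega> * (cblock \<epsilon> L * ?w\<^sup>2 + ?K)"
    using K c by (intro mult_right_mono Yn_ge_block eps) auto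
  finally show ?case by (simp add: add.commute)
qed

lemma mean_mult: "ennreal (1 / m) * (ennreal m * x) = x"
  using m1 by (simp add: mult.assoc[symmetric] ennreal_mult[symmetric])

lemma nn_integral_gv_sub1:
  assumes f: "f \<in> borel_measurable Om"
  shows "(\<integral>\<^sup>+\<omega>. ennreal (gv \<epsilon> v \<omega>) * f (\<lambda>w. \<omega> (v @ w)) \<partial>Om) = (\<integral>\<^sup>+\<omega>. ennreal (gv \<epsilon> v \<omega>) \<partial>Om) * (\<integral>\<^sup>+\<omega>. f \<omega> \<partial>Om)"
  by (rule nn_integral_indep_sub[OF _ f gv_depends[OF refl]]) measurable

lemma ennreal_sum_gv:
  assumes "\<And>v. 0 \<le> F v"
  shows "ennreal (\<Sum>v\<in>words D L. gv \<epsilon> v \<omega> * F v) = (\<Sum>v\<in>words D L. ennreal (gv \<epsilon> v \<omega>) * ennreal (F v))"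
proof -
  have "ennreal (\<Sum>v\<in>words D L. gv \<epsilon> v \<omega> * F v) = (\<Sum>v\<in>words D L. ennreal (gv \<epsilon> v \<omega> * F v))"
    by (rule sum_ennreal[symmetric]) (simp add: assms gv_bounds)
  then show ?thesis by (simp add: ennreal_mult assms gv_bounds)
qed

lemma nn_integral_gv_sub:
  assumes [measurable]: "f \<in> borel_measurable Om"
  shows "(\<integral>\<^sup>+\<omega>. (\<Sum>v\<in>words D L. ennreal (gv \<epsilon> v \<omega>) * f (\<lambda>w. \<omega> (v @ w))) \<partial>Om) = ennreal m * (\<integral>\<^sup>+\<omega>. f \<omega> \<partial>Om)"
proof -
  note [measurable] = measurable_sub[OF assms]
  have "(\<integral>\<^sup>+\<omega>. (\<Sum>v\<in>words D L. ennreal (gv \<epsilon> v \<omega>) * f (\<lambda>w. \<omega> (v @ w))) \<partial>Om) =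
      (\<Sum>v\<in>words D L. \<integral>\<^sup>+\<omega>. ennreal (gv \<epsilon> v \<omega>) * f (\<lambda>w. \<omega> (v @ w)) \<partial>Om)"
    by (rule nn_integral_sum) measurable
  also have "\<dots> = (\<Sum>v\<in>words D L. (\<integral>\<^sup>+\<omega>. ennreal (gv \<epsilon> v \<omega>) \<partial>Om) * (\<integral>\<^sup>+\<omega>. f \<omega> \<partial>Om))"
    by (simp only: nn_integral_gv_sub1[OF assms])
  finally show ?thesis by (simp add: sum_distrib_right[symmetric] mean)
qed

text \<open>Each block is divided by its mean \<open>m\<close>, and the truncated weights are
  independent of the strengths below, so the mean strength is preserved.\<close>

lemma W_mean: "(\<integral>\<^sup>+\<omega>. ennreal (W q \<omega>) \<partial>Om) = 1"
proof (induction q)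
  case 0
  show ?case by (simp add: Om.emeasure_space_1)
next
  case (Suc q)
  have m0: "(\<lambda>\<omega>. ennreal (W q \<omega>)) \<in> borel_measurable Om" by measurable
  note [measurable] = measurable_sub[OF m0]
  have "ennreal (W (Suc q) \<omega>) = ennreal (1 / m) * (\<Sum>v\<in>words D L. ennreal (gv \<epsilon> v \<omega>) * ennreal (W q (\<lambda>w. \<omega> (v @ w))))" for \<omega>
  proof -
    let ?s = "\<Sum>v\<in>words D L. gv \<epsilon> v \<omega> * W q (\<lambda>w. \<omega> (v @ w))"
    have "0 \<le> ?s" by (intro sum_nonneg mult_nonneg_nonneg gv_bounds W_nonneg)
    then have "ennreal (1 / m * ?s) = ennreal (1 / m) * ennreal ?s"
      using m1 by (intro ennreal_mult) auto
    moreover have "W (Suc q) \<omega> = 1 / m * ?s" by simp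
    ultimately show ?thesis by (simp only: ennreal_sum_gv[OF W_nonneg])
  qed
  then have "(\<integral>\<^sup>+\<omega>. ennreal (W (Suc q) \<omega>) \<partial>Om) =
      (\<integral>\<^sup>+\<omega>. ennreal (1 / m) * (\<Sum>v\<in>words D L. ennreal (gv \<epsilon> v \<omega>) * ennreal (W q (\<lambda>w. \<omega> (v @ w)))) \<partial>Om)"
    by (simp only:)
  also have "\<dots> = ennreal (1 / m) * (\<integral>\<^sup>+\<omega>. (\<Sum>v\<in>words D L. ennreal (gv \<epsilon> v \<omega>) * ennreal (W q (\<lambda>w. \<omega> (v @ w)))) \<partial>Om)"
    by (rule nn_integral_cmult) measurable
  also have "\<dots> = 1"
    by (simp only: nn_integral_gv_sub[OF m0] Suc mean_mult)
  finally show ?case .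
qed

text \<open>Expand the square over pairs of words. Equal words give at most \<open>gv\<close> times
  the square below, hence the contraction factor m/m^2 = 1/m. Different words have independent
  subtrees of mean strength 1 and weights at most 1, so each pair costs at most 1.\<close>

lemma W_second_moment_step:
  "(\<integral>\<^sup>+\<omega>. ennreal ((W (Suc q) \<omega>)\<^sup>2) \<partial>Om) \<le>
    ennreal (1 / m) * (\<integral>\<^sup>+\<omega>. ennreal ((W q \<omega>)\<^sup>2) \<partial>Om) + ennreal ((real (card (words D L)))\<^sup>2 / m\<^sup>2)"
proof -
  let ?V = "words D L" and ?e = "\<integral>\<^sup>+\<omega>. ennreal ((W q \<omega>)\<^sup>2) \<partial>Om"
  have m2: "(\<lambda>\<omega>. ennreal (W q \<omega>)) \<in> borel_measurable Om" "(\<lambda>\<omega>. ennreal ((W q \<omega>)\<^sup>2)) \<in> borel_measurable Om"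
    by measurable
  note [measurable] = measurable_sub[OF m2(1)] measurable_sub[OF m2(2)]
  let ?G = "\<lambda>v \<omega>. ennreal (gv \<epsilon> v \<omega>)" and ?U = "\<lambda>v \<omega>. ennreal (W q (\<lambda>w. \<omega> (v @ w)))"
  have eq: "ennreal ((W (Suc q) \<omega>)\<^sup>2) = ennreal (1 / m\<^sup>2) * (\<Sum>v\<in>?V. \<Sum>v'\<in>?V. (?G v \<omega> * ?G v' \<omega>) * (?U v \<omega> * ?U v' \<omega>))" for \<omega>
  proof -
    let ?s = "\<Sum>v\<in>?V. gv \<epsilon> v \<omega> * W q (\<lambda>w. \<omega> (v @ w))"
    have s0: "0 \<le> ?s" by (intro sum_nonneg mult_nonneg_nonneg gv_bounds W_nonneg)
    have "(W (Suc q) \<omega>)\<^sup>2 = 1 / m\<^sup>2 * (?s * ?s)" by (simp add: power_divide power2_eq_square)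
    then have "ennreal ((W (Suc q) \<omega>)\<^sup>2) = ennreal (1 / m\<^sup>2 * (?s * ?s))" by (rule arg_cong)
    also have "\<dots> = ennreal (1 / m\<^sup>2) * ennreal (?s * ?s)" by (rule ennreal_mult) (use s0 in auto)
    also have "ennreal (?s * ?s) = ennreal ?s * ennreal ?s" by (rule ennreal_mult) (use s0 in auto)
    also have "ennreal ?s = (\<Sum>v\<in>?V. ?G v \<omega> * ?U v \<omega>)" by (rule ennreal_sum_gv[OF W_nonneg])
    also have "(\<Sum>v\<in>?V. ?G v \<omega> * ?U v \<omega>) * (\<Sum>v\<in>?V. ?G v \<omega> * ?U v \<omega>) =
        (\<Sum>v\<in>?V. \<Sum>v'\<in>?V. (?G v \<omega> * ?G v' \<omega>) * (?U v \<omega> * ?U v' \<omega>))"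
      unfolding sum_product by (intro sum.cong refl) (simp only: mult_ac)
    finally show ?thesis .
  qed
  have pair_le: "(\<integral>\<^sup>+\<omega>. (?G v \<omega> * ?G v' \<omega>) * (?U v \<omega> * ?U v' \<omega>) \<partial>Om) \<le> (if v = v' then (\<integral>\<^sup>+\<omega>. ?G v \<omega> \<partial>Om) * ?e else 0) + 1"
    if v: "v \<in> ?V" "v' \<in> ?V" for v v'
  proof (cases "v = v'")
    case True
    have "(\<integral>\<^sup>+\<omega>. (?G v \<omega> * ?G v' \<omega>) * (?U v \<omega> * ?U v' \<omega>) \<partial>Om) \<le>
        (\<integral>\<^sup>+\<omega>. ?G v \<omega> * ennreal ((W q (\<lambda>w. \<omega> (v @ w)))\<^sup>2) \<partial>Om)"
    proof (rule nn_integral_mono)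
      fix \<omega>
      show "(?G v \<omega> * ?G v' \<omega>) * (?U v \<omega> * ?U v' \<omega>) \<le> ?G v \<omega> * ennreal ((W q (\<lambda>w. \<omega> (v @ w)))\<^sup>2)"
        using True gv_bounds(1,3)[of \<epsilon> v \<omega>] W_nonneg
        by (simp add: ennreal_mult[symmetric] power2_eq_square mult_right_mono ennreal_leI)
    qed
    also have "\<dots> = (\<integral>\<^sup>+\<omega>. ?G v \<omega> \<partial>Om) * ?e"
      by (rule nn_integral_gv_sub1[OF m2(2)])
    also have "\<dots> \<le> (if v = v' then (\<integral>\<^sup>+\<omega>. ?G v \<omega> \<partial>Om) * ?e else 0) + 1" using True by simp
    finally show ?thesis .
  next
    case False
    have len: "length v = length v'" "length v = L" "length v' = length v" using v by (auto simp: words_def)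
    have dep: "depends_on (\<lambda>\<omega>. ?G v \<omega> * ?G v' \<omega>) {u. length u < length v}"
      using gv_depends[of v "length v" \<epsilon>] gv_depends[of v' "length v" \<epsilon>] len unfolding depends_on_def by metis
    have "(\<integral>\<^sup>+\<omega>. (?G v \<omega> * ?G v' \<omega>) * (?U v \<omega> * ?U v' \<omega>) \<partial>Om) = (\<integral>\<^sup>+\<omega>. ?G v \<omega> * ?G v' \<omega> \<partial>Om) * (1 * 1)"
      unfolding W_mean[of q, symmetric]
      by (rule nn_integral_indep_sub2[OF _ m2(1) m2(1) dep len(1) False]) measurable
    also have "\<dots> \<le> (\<integral>\<^sup>+\<omega>. 1 \<partial>Om)"
    proof (unfold mult_1_right, rule nn_integral_mono)
      fix \<omega>
      have "?G v \<omega> * ?G v' \<omega> \<le> 1 * 1"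
        using gv_bounds by (intro mult_mono) (auto simp: ennreal_le_1)
      then show "?G v \<omega> * ?G v' \<omega> \<le> 1" by simp
    qed
    also have "\<dots> = 1" by (simp add: Om.emeasure_space_1)
    finally show ?thesis using False by simp
  qed
  have "(\<integral>\<^sup>+\<omega>. ennreal ((W (Suc q) \<omega>)\<^sup>2) \<partial>Om) =
     ennreal (1 / m\<^sup>2) * (\<Sum>v\<in>?V. \<Sum>v'\<in>?V. \<integral>\<^sup>+\<omega>. (?G v \<omega> * ?G v' \<omega>) * (?U v \<omega> * ?U v' \<omega>) \<partial>Om)"
  proof -
    have tm: "(\<lambda>\<omega>. (?G v \<omega> * ?G v' \<omega>) * (?U v \<omega> * ?U v' \<omega>)) \<in> borel_measurable Om" for v v'
      by measurable
    have tm2: "(\<lambda>\<omega>. \<Sum>v'\<in>?V. (?G v \<omega> * ?G v' \<omega>) * (?U v \<omega> * ?U v' \<omega>)) \<in> borel_measurable Om" for v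
      by (intro borel_measurable_sum tm)
    have tm3: "(\<lambda>\<omega>. \<Sum>v\<in>?V. \<Sum>v'\<in>?V. (?G v \<omega> * ?G v' \<omega>) * (?U v \<omega> * ?U v' \<omega>)) \<in> borel_measurable Om"
      by (intro borel_measurable_sum tm)
    show ?thesis
      by (simp only: eq nn_integral_cmult[OF tm3] nn_integral_sum[OF tm2] nn_integral_sum[OF tm])
  qed
  also have "\<dots> \<le> ennreal (1 / m\<^sup>2) * (\<Sum>v\<in>?V. \<Sum>v'\<in>?V. (if v = v' then (\<integral>\<^sup>+\<omega>. ?G v \<omega> \<partial>Om) * ?e else 0) + 1)"
    by (intro mult_left_mono sum_mono pair_le) auto
  also have "(\<Sum>v\<in>?V. \<Sum>v'\<in>?V. (if v = v' then (\<integral>\<^sup>+\<omega>. ?G v \<omega> \<partial>Om) * ?e else 0) + 1) =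
      ennreal m * ?e + ennreal ((real (card ?V))\<^sup>2)"
    by (simp add: sum.distrib sum.delta sum_distrib_right[symmetric] mean power2_eq_square ennreal_mult ennreal_of_nat_eq_real_of_nat)
  also have "ennreal (1 / m\<^sup>2) * (ennreal m * ?e + ennreal ((real (card ?V))\<^sup>2)) =
      ennreal (1 / m) * ?e + ennreal ((real (card ?V))\<^sup>2 / m\<^sup>2)"
    using m1 by (simp add: distrib_left mult.assoc[symmetric] ennreal_mult[symmetric] power2_eq_square)
  finally show ?thesis .
qed

lemma W_second_moment: "\<exists>\<kappa>\<ge>1. \<forall>q. (\<integral>\<^sup>+\<omega>. ennreal ((W q \<omega>)\<^sup>2) \<partial>Om) \<le> ennreal \<kappa>"
proof -
  obtain \<kappa> where \<kappa>: "\<kappa> \<ge> 1" "\<kappa> / m + (real (card (words D L)))\<^sup>2 / m\<^sup>2 \<le> \<kappa>"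
    using ex_affine_invariant[OF m1, of "(real (card (words D L)))\<^sup>2 / m\<^sup>2"] by auto
  have "(\<integral>\<^sup>+\<omega>. ennreal ((W q \<omega>)\<^sup>2) \<partial>Om) \<le> ennreal \<kappa>" for q
  proof (induction q)
    case 0
    show ?case using \<kappa> by (simp add: Om.emeasure_space_1)
  next
    case (Suc q)
    note W_second_moment_step[of q]
    also have "ennreal (1 / m) * (\<integral>\<^sup>+\<omega>. ennreal ((W q \<omega>)\<^sup>2) \<partial>Om) + ennreal ((real (card (words D L)))\<^sup>2 / m\<^sup>2) \<le>
        ennreal (1 / m) * ennreal \<kappa> + ennreal ((real (card (words D L)))\<^sup>2 / m\<^sup>2)"
      by (intro add_right_mono mult_left_mono Suc) auto
    also have "\<dots> = ennreal (\<kappa> / m + (real (card (words D L)))\<^sup>2 / m\<^sup>2)"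
      using m1 \<kappa> by (simp add: ennreal_mult[symmetric] ennreal_plus[symmetric] del: ennreal_plus)
    also have "\<dots> \<le> ennreal \<kappa>" using \<kappa> by (intro ennreal_leI)
    finally show ?case .
  qed
  with \<kappa> show ?thesis by blast
qed

text \<open>The mean energy obeys an affine recursion with factor m/m^2 = 1/m, driven by the bounded
  second moment of the strength.\<close>

lemma E_bounded: "\<exists>\<kappa>\<ge>1. \<forall>q. (\<integral>\<^sup>+\<omega>. ennreal (E q \<omega>) \<partial>Om) \<le> ennreal \<kappa>"
proof -
  note c = cblock_nonneg[OF eps, of L]
  obtain k where k: "k \<ge> 1" "\<And>q. (\<integral>\<^sup>+\<omega>. ennreal ((W q \<omega>)\<^sup>2) \<partial>Om) \<le> ennreal k"
    using W_second_moment by blast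
  obtain \<kappa> where \<kappa>: "\<kappa> \<ge> 1" "\<kappa> / m + cblock \<epsilon> L * k \<le> \<kappa>"
    using ex_affine_invariant[OF m1, of "cblock \<epsilon> L * k"] c k by auto
  have "(\<integral>\<^sup>+\<omega>. ennreal (E q \<omega>) \<partial>Om) \<le> ennreal \<kappa>" for q
  proof (induction q)
    case 0
    show ?case using \<kappa> by (simp add: Om.emeasure_space_1)
  next
    case (Suc q)
    have m2: "(\<lambda>\<omega>. ennreal (E q \<omega>)) \<in> borel_measurable Om" by measurable
    note [measurable] = measurable_sub[OF m2]
    have eq: "ennreal (E (Suc q) \<omega>) = ennreal (cblock \<epsilon> L) * ennreal ((W (Suc q) \<omega>)\<^sup>2) +
        ennreal (1 / m\<^sup>2) * (\<Sum>v\<in>words D L. ennreal (gv \<epsilon> v \<omega>) * ennreal (E q (\<lambda>w. \<omega> (v @ w))))" for \<omega>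
    proof -
      let ?s = "\<Sum>v\<in>words D L. gv \<epsilon> v \<omega> * E q (\<lambda>w. \<omega> (v @ w))"
      have s0: "0 \<le> ?s" by (intro sum_nonneg mult_nonneg_nonneg gv_bounds E_nonneg)
      have "E (Suc q) \<omega> = cblock \<epsilon> L * (W (Suc q) \<omega>)\<^sup>2 + 1 / m\<^sup>2 * ?s" by simp
      then have "ennreal (E (Suc q) \<omega>) = ennreal (cblock \<epsilon> L * (W (Suc q) \<omega>)\<^sup>2 + 1 / m\<^sup>2 * ?s)" by (rule arg_cong)
      also have "\<dots> = ennreal (cblock \<epsilon> L * (W (Suc q) \<omega>)\<^sup>2) + ennreal (1 / m\<^sup>2 * ?s)"
        by (rule ennreal_plus) (use s0 c in auto)
      also have "ennreal (cblock \<epsilon> L * (W (Suc q) \<omega>)\<^sup>2) = ennreal (cblock \<epsilon> L) * ennreal ((W (Suc q) \<omega>)\<^sup>2)"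
        by (rule ennreal_mult) (use c in auto)
      also have "ennreal (1 / m\<^sup>2 * ?s) = ennreal (1 / m\<^sup>2) * ennreal ?s" by (rule ennreal_mult) (use s0 in auto)
      also have "ennreal ?s = (\<Sum>v\<in>words D L. ennreal (gv \<epsilon> v \<omega>) * ennreal (E q (\<lambda>w. \<omega> (v @ w))))"
        by (rule ennreal_sum_gv[OF E_nonneg])
      finally show ?thesis .
    qed
    have "(\<integral>\<^sup>+\<omega>. ennreal (E (Suc q) \<omega>) \<partial>Om) =
        ennreal (cblock \<epsilon> L) * (\<integral>\<^sup>+\<omega>. ennreal ((W (Suc q) \<omega>)\<^sup>2) \<partial>Om) +
        ennreal (1 / m\<^sup>2) * (\<integral>\<^sup>+\<omega>. (\<Sum>v\<in>words D L. ennreal (gv \<epsilon> v \<omega>) * ennreal (E q (\<lambda>w. \<omega> (v @ w)))) \<partial>Om)"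
    proof -
      have e1: "(\<lambda>\<omega>. ennreal ((W (Suc q) \<omega>)\<^sup>2)) \<in> borel_measurable Om"
        by (intro measurable_compose[OF _ measurable_ennreal] borel_measurable_power Wq_measurable)
      have e2: "(\<lambda>\<omega>. \<Sum>v\<in>words D L. ennreal (gv \<epsilon> v \<omega>) * ennreal (E q (\<lambda>w. \<omega> (v @ w)))) \<in> borel_measurable Om"
        by measurable
      show ?thesis
        by (simp only: eq nn_integral_add[OF borel_measurable_times_ennreal[OF borel_measurable_const e1]
              borel_measurable_times_ennreal[OF borel_measurable_const e2]] nn_integral_cmult[OF e1] nn_integral_cmult[OF e2])
    qed
    also have "(\<integral>\<^sup>+\<omega>. (\<Sum>v\<in>words D L. ennreal (gv \<epsilon> v \<omega>) * ennreal (E q (\<lambda>w. \<omega> (v @ w)))) \<partial>Om) =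
        ennreal m * (\<integral>\<^sup>+\<omega>. ennreal (E q \<omega>) \<partial>Om)"
      by (rule nn_integral_gv_sub[OF m2])
    also have "ennreal (cblock \<epsilon> L) * (\<integral>\<^sup>+\<omega>. ennreal ((W (Suc q) \<omega>)\<^sup>2) \<partial>Om) +
        ennreal (1 / m\<^sup>2) * (ennreal m * (\<integral>\<^sup>+\<omega>. ennreal (E q \<omega>) \<partial>Om)) \<le>
        ennreal (cblock \<epsilon> L) * ennreal k + ennreal (1 / m\<^sup>2) * (ennreal m * ennreal \<kappa>)"
      by (intro add_mono mult_left_mono k Suc) auto
    also have "\<dots> = ennreal (\<kappa> / m + cblock \<epsilon> L * k)"
      using m1 \<kappa> k c by (simp add: ennreal_mult[symmetric] ennreal_plus[symmetric] power2_eq_square add.commute del: ennreal_plus)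
    also have "\<dots> \<le> ennreal \<kappa>" using \<kappa> by (intro ennreal_leI)
    finally show ?case .
  qed
  with \<kappa> show ?thesis by blast
qed

text \<open>Mean strength 1 and mean energy at most \<kappa> keep the mean of \<open>Yn\<close>
  above 1/\<kappa> for every number of blocks, whereas a vanishing limit would send it to 0 by
  dominated convergence.\<close>

lemma not_AE_Ylim_eq_0: "\<not> (AE \<omega> in Om. Ylim \<omega> = 0)"
proof
  assume AE0: "AE \<omega> in Om. Ylim \<omega> = 0"
  obtain \<kappa> where \<kappa>: "\<kappa> \<ge> 1" "\<And>q. (\<integral>\<^sup>+\<omega>. ennreal (E q \<omega>) \<partial>Om) \<le> ennreal \<kappa>"
    using E_bounded by blast
  have lower: "ennreal (1 / \<kappa>) \<le> (\<integral>\<^sup>+\<omega>. ennreal (Yn (q * L) \<omega>) \<partial>Om)" for q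
  proof -
    \<comment> \<open>The inequality of arithmetic and geometric means, weighted by \<kappa>,
      replaces the product of \<open>Yn\<close> and the energy by a sum, so that expectations can be
      taken; the energy then uses up at most half of the mean strength 1.\<close>
    have le: "ennreal (W q \<omega>) \<le> ennreal (\<kappa> / 2) * ennreal (Yn (q * L) \<omega>) + ennreal (1 / (2 * \<kappa>)) * ennreal (E q \<omega>)" for \<omega>
    proof -
      let ?y = "Yn (q * L) \<omega>" and ?e = "E q \<omega>"
      have "(2 * W q \<omega>)\<^sup>2 \<le> 4 * (?y * ?e)" using W_square_le[of q \<omega>] by (simp add: power2_eq_square)
      also have "\<dots> \<le> (\<kappa> * ?y + ?e / \<kappa>)\<^sup>2"
      proof -
        have "0 \<le> (\<kappa> * ?y - ?e / \<kappa>)\<^sup>2" by simp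
        then show ?thesis using \<kappa> by (simp add: power2_eq_square algebra_simps)
      qed
      finally have "2 * W q \<omega> \<le> \<kappa> * ?y + ?e / \<kappa>"
        by (rule power2_le_imp_le) (use \<kappa> Yn_bounds E_nonneg in auto)
      then have "W q \<omega> \<le> \<kappa> / 2 * ?y + 1 / (2 * \<kappa>) * ?e" by simp
      then have "ennreal (W q \<omega>) \<le> ennreal (\<kappa> / 2 * ?y + 1 / (2 * \<kappa>) * ?e)" by (rule ennreal_leI)
      also have "\<dots> = ennreal (\<kappa> / 2) * ennreal ?y + ennreal (1 / (2 * \<kappa>)) * ennreal ?e"
        using \<kappa> Yn_bounds E_nonneg by (subst ennreal_plus) (auto simp: ennreal_mult[symmetric])
      finally show ?thesis .
    qed
    obtain y where y: "(\<integral>\<^sup>+\<omega>. ennreal (Yn (q * L) \<omega>) \<partial>Om) = ennreal y" "0 \<le> y"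
    proof -
      have "(\<integral>\<^sup>+\<omega>. ennreal (Yn (q * L) \<omega>) \<partial>Om) \<le> (\<integral>\<^sup>+\<omega>. 1 \<partial>Om)"
        using Yn_bounds by (intro nn_integral_mono) (simp add: ennreal_le_1)
      then have "(\<integral>\<^sup>+\<omega>. ennreal (Yn (q * L) \<omega>) \<partial>Om) \<noteq> top"
        by (auto simp: Om.emeasure_space_1 top_unique)
      then show ?thesis using that by (cases "\<integral>\<^sup>+\<omega>. ennreal (Yn (q * L) \<omega>) \<partial>Om") auto
    qed
    have "ennreal 1 = (\<integral>\<^sup>+\<omega>. ennreal (W q \<omega>) \<partial>Om)" by (simp add: W_mean)
    also have "\<dots> \<le> (\<integral>\<^sup>+\<omega>. ennreal (\<kappa> / 2) * ennreal (Yn (q * L) \<omega>) + ennreal (1 / (2 * \<kappa>)) * ennreal (E q \<omega>) \<partial>Om)"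
      by (intro nn_integral_mono le)
    also have "\<dots> = ennreal (\<kappa> / 2) * (\<integral>\<^sup>+\<omega>. ennreal (Yn (q * L) \<omega>) \<partial>Om) + ennreal (1 / (2 * \<kappa>)) * (\<integral>\<^sup>+\<omega>. ennreal (E q \<omega>) \<partial>Om)"
    proof -
      have e1: "(\<lambda>\<omega>. ennreal (Yn (q * L) \<omega>)) \<in> borel_measurable Om" by measurable
      have e2: "(\<lambda>\<omega>. ennreal (E q \<omega>)) \<in> borel_measurable Om" by measurable
      show ?thesis
        by (simp only: nn_integral_add[OF borel_measurable_times_ennreal[OF borel_measurable_const e1]
              borel_measurable_times_ennreal[OF borel_measurable_const e2]] nn_integral_cmult[OF e1] nn_integral_cmult[OF e2])
    qed
    also have "\<dots> \<le> ennreal (\<kappa> / 2) * ennreal y + ennreal (1 / (2 * \<kappa>)) * ennreal \<kappa>"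
      unfolding y by (intro add_left_mono mult_left_mono \<kappa>) auto
    also have "\<dots> = ennreal (\<kappa> / 2 * y + 1 / 2)"
    proof -
      have "ennreal (1 / (2 * \<kappa>)) * ennreal \<kappa> = ennreal (1 / (2 * \<kappa>) * \<kappa>)"
        by (rule ennreal_mult[symmetric]) (use \<kappa> in auto)
      also have "1 / (2 * \<kappa>) * \<kappa> = 1 / 2" using \<kappa> by simp
      finally have 1: "ennreal (1 / (2 * \<kappa>)) * ennreal \<kappa> = ennreal (1 / 2)" .
      have 2: "ennreal (\<kappa> / 2) * ennreal y = ennreal (\<kappa> / 2 * y)"
        by (rule ennreal_mult[symmetric]) (use \<kappa> y in auto)
      have "ennreal (\<kappa> / 2 * y + 1 / 2) = ennreal (\<kappa> / 2 * y) + ennreal (1 / 2)"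
        by (rule ennreal_plus) (use \<kappa> y in auto)
      then show ?thesis by (simp only: 1 2)
    qed
    finally have "1 \<le> \<kappa> / 2 * y + 1 / 2" using \<kappa> y by (subst (asm) ennreal_le_iff) auto
    then have "1 / \<kappa> \<le> y" using \<kappa> by (simp add: field_simps)
    then show ?thesis unfolding y by (rule ennreal_leI)
  qed
  have "(\<lambda>n. \<integral>\<^sup>+\<omega>. ennreal (Yn n \<omega>) \<partial>Om) \<longlonglongrightarrow> (\<integral>\<^sup>+\<omega>. ennreal (Ylim \<omega>) \<partial>Om)"
    by (rule nn_integral_dominated_convergence[where w = "\<lambda>_. 1"])
      (use Yn_bounds in \<open>auto simp: Om.emeasure_space_1 ennreal_le_1 intro!: tendsto_ennrealI Ylim_LIMSEQ\<close>)
  moreover have "(\<integral>\<^sup>+\<omega>. ennreal (Ylim \<omega>) \<partial>Om) = 0"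
    using AE0 by (subst nn_integral_0_iff_AE) (auto elim!: eventually_mono)
  ultimately have lim: "(\<lambda>n. \<integral>\<^sup>+\<omega>. ennreal (Yn n \<omega>) \<partial>Om) \<longlonglongrightarrow> 0" by simp
  \<comment> \<open>A block of length 0 has mean 1, contradicting m > 1; positive \<open>L\<close>
    makes the generations q L a subsequence.\<close>
  have "L > 0"
  proof (rule ccontr)
    assume "\<not> L > 0"
    then have "ennreal m = 1" using mean by (simp add: gv_def Om.emeasure_space_1)
    then have "m = 1" using m1 by (simp add: ennreal_eq_1)
    with m1 show False by simp
  qed
  then have "strict_mono (\<lambda>q. q * L)" by (auto simp: strict_mono_def)
  from LIMSEQ_subseq_LIMSEQ[OF lim this]
  have "(\<lambda>q. \<integral>\<^sup>+\<omega>. ennreal (Yn (q * L) \<omega>) \<partial>Om) \<longlonglongrightarrow> 0" by (simp add: o_def)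
  then have "ennreal (1 / \<kappa>) \<le> 0"
    by (rule LIMSEQ_le_const) (use lower in blast)
  then show False using \<kappa> by (auto simp: ennreal_eq_0_iff)
qed

end

end

text \<open>Cramer's window: for x between 1/K and K the truncation at 1 loses at most the factor K
  powr (3/4) against x powr (1/4), the worst case being x = 1/K. Outside, x powr (1/4) is dominated
  by a tilted power, with the gain K powr (-e).\<close>

lemma powr_quarter_le_min:
  fixes x K e :: real
  assumes "0 \<le> x" "1 \<le> K" "0 < e"
  shows "x powr (1/4) \<le> K powr (3/4) * min 1 x + K powr (- e) * (x powr (1/4 + e) + x powr (1/4 - e))"
proof (cases "x = 0")
  case False
  then have x: "0 < x" using assms by simp
  have nn: "0 \<le> K powr (3/4) * min 1 x" "0 \<le> K powr (- e) * x powr (1/4 + e)" "0 \<le> K powr (- e) * x powr (1/4 - e)"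
    using assms by auto
  consider "1 \<le> x" "x \<le> K" | "1 / K \<le> x" "x < 1" | "K < x" | "x < 1 / K" by linarith
  then show ?thesis
  proof cases
    case 1
    have "x powr (1/4) \<le> K powr (1/4)" using 1 by (intro powr_mono2) auto
    also have "\<dots> \<le> K powr (3/4)" using assms by (intro powr_mono) auto
    finally have "x powr (1/4) \<le> K powr (3/4) * min 1 x" using 1 by simp
    then show ?thesis using nn(2,3) unfolding distrib_left by linarith
  next
    case 2
    have "1 \<le> (K * x) powr (3/4)"
      using 2 assms by (intro ge_one_powr_ge_zero) (auto simp: divide_le_eq mult.commute)
    then have "x powr (1/4) * 1 \<le> x powr (1/4) * (K powr (3/4) * x powr (3/4))"
      using x assms by (intro mult_left_mono) (auto simp: powr_mult)
    also have "\<dots> = K powr (3/4) * x" using x by (simp add: powr_add[symmetric] mult.left_commute)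
    finally have "x powr (1/4) \<le> K powr (3/4) * min 1 x" using 2 by simp
    then show ?thesis using nn(2,3) unfolding distrib_left by linarith
  next
    case 3
    have "1 \<le> (x / K) powr e" using 3 assms by (intro ge_one_powr_ge_zero) auto
    also have "\<dots> = x powr e * K powr (- e)"
      using assms x by (simp add: powr_divide powr_minus field_simps)
    finally have "x powr (1/4) * 1 \<le> x powr (1/4) * (x powr e * K powr (- e))"
      by (intro mult_left_mono) auto
    also have "\<dots> = K powr (- e) * x powr (1/4 + e)" by (simp add: powr_add mult_ac)
    finally show ?thesis using nn unfolding distrib_left by linarith
  next
    case 4
    have "1 \<le> (1 / (K * x)) powr e" using 4 x assms by (intro ge_one_powr_ge_zero) (auto simp: field_simps)
    also have "\<dots> = x powr (- e) * K powr (- e)"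
      using assms x by (simp add: powr_divide powr_minus powr_mult field_simps)
    finally have "x powr (1/4) * 1 \<le> x powr (1/4) * (x powr (- e) * K powr (- e))"
      by (intro mult_left_mono) auto
    also have "\<dots> = K powr (- e) * x powr (1/4 - e)" using powr_add[of x "1/4" "- e"] by (simp add: mult_ac)
    finally show ?thesis using nn unfolding distrib_left by linarith
  qed
qed simp

section \<open>Cramer's argument: choice of the cutoff and of the block length\<close>

context marked_tree
begin

definition Qs :: "real \<Rightarrow> nat \<Rightarrow> real \<Rightarrow> ennreal" where
  "Qs \<epsilon> D s = (\<Sum>i<D. \<integral>\<^sup>+x. ennreal (At \<epsilon> i x powr s) \<partial>M)"

text \<open>With the window K = exp (\<delta> L) the two tilted sums contribute at most 2 \<mu>^L,
  negligible against \<nu>^L. So m K powr (3/4) is at least half of \<nu>^L, and \<nu> exceeds the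
  cost exp (3/4 \<delta>) of the window per generation.\<close>

lemma ex_supercritical_block:
  assumes pos: "\<delta> > 0" "e > 0" "0 \<le> \<mu>" "\<mu> < \<nu>" and \<nu>: "exp (- (3/4) * \<delta>) * \<nu> > 1"
    and Q: "ennreal \<nu> \<le> Qs \<epsilon> D (1/4)"
    and Qp: "Qs \<epsilon> D (1/4 + e) \<le> ennreal (exp (\<delta> * e) * \<mu>)"
    and Qm: "Qs \<epsilon> D (1/4 - e) \<le> ennreal (exp (\<delta> * e) * \<mu>)"
  shows "\<exists>L m. m > 1 \<and> (\<Sum>v\<in>words D L. \<integral>\<^sup>+\<omega>. ennreal (gv \<epsilon> v \<omega>) \<partial>Om) = ennreal m"
proof -
  let ?c = "exp (- (3/4) * \<delta>) * \<nu>"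
  have l0: "0 < \<nu>" using pos by linarith
  \<comment> \<open>The threshold 1/4 leaves half of \<nu>^L after removal of the tails; the
    threshold 2 compensates for that half and yields m > 1.\<close>
  have "(\<lambda>L. (\<mu> / \<nu>) ^ L) \<longlonglongrightarrow> 0" using pos l0 by (intro LIMSEQ_realpow_zero) auto
  then have "\<forall>\<^sub>F L in sequentially. (\<mu> / \<nu>) ^ L < 1/4" by (rule order_tendstoD) simp
  moreover have "\<forall>\<^sub>F L in sequentially. ?c ^ L > 2"
    using filterlim_realpow_sequentially_gt1[of ?c] \<nu>
    by (auto simp: filterlim_at_top_dense filterlim_at_infinity_imp_norm_at_top dest: filterlim_at_infinity_imp_norm_at_top)
  ultimately have "\<forall>\<^sub>F L in sequentially. (\<mu> / \<nu>) ^ L < 1/4 \<and> ?c ^ L > 2" by eventually_elim simp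
  then obtain L where L: "(\<mu> / \<nu>) ^ L < 1/4" "?c ^ L > 2"
    by (auto simp: eventually_sequentially)
  define K where "K = exp (\<delta> * real L)"
  have K1: "1 \<le> K" using pos by (simp add: K_def)
  let ?V = "words D L"
  let ?G = "\<Sum>v\<in>?V. \<integral>\<^sup>+\<omega>. ennreal (gv \<epsilon> v \<omega>) \<partial>Om"
  have "?G \<le> (\<Sum>v\<in>?V. \<integral>\<^sup>+\<omega>. 1 \<partial>Om)"
    using gv_bounds by (intro sum_mono nn_integral_mono) (simp add: ennreal_le_1)
  also have "\<dots> < top" by (simp add: Om.emeasure_space_1 of_nat_less_top)
  finally obtain m where m: "?G = ennreal m" "0 \<le> m" by (cases ?G) auto
  let ?I = "\<lambda>s. \<Sum>v\<in>?V. \<integral>\<^sup>+\<omega>. ennreal (av \<epsilon> v \<omega> powr s) \<partial>Om"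
  have I: "?I s = Qs \<epsilon> D s ^ L" for s unfolding Qs_def by (rule sum_av_powr)
  have term_le: "(\<integral>\<^sup>+\<omega>. ennreal (av \<epsilon> v \<omega> powr (1/4)) \<partial>Om) \<le>
      ennreal (K powr (3/4)) * (\<integral>\<^sup>+\<omega>. ennreal (gv \<epsilon> v \<omega>) \<partial>Om) +
      ennreal (K powr (- e)) * ((\<integral>\<^sup>+\<omega>. ennreal (av \<epsilon> v \<omega> powr (1/4 + e)) \<partial>Om) + (\<integral>\<^sup>+\<omega>. ennreal (av \<epsilon> v \<omega> powr (1/4 - e)) \<partial>Om))" for v
  proof -
    have e1: "(\<lambda>\<omega>. ennreal (gv \<epsilon> v \<omega>)) \<in> borel_measurable Om" by measurable
    have e2: "(\<lambda>\<omega>. ennreal (av \<epsilon> v \<omega> powr s)) \<in> borel_measurable Om" for s by measurable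
    have "(\<integral>\<^sup>+\<omega>. ennreal (av \<epsilon> v \<omega> powr (1/4)) \<partial>Om) \<le>
      (\<integral>\<^sup>+\<omega>. ennreal (K powr (3/4)) * ennreal (gv \<epsilon> v \<omega>) +
        ennreal (K powr (- e)) * (ennreal (av \<epsilon> v \<omega> powr (1/4 + e)) + ennreal (av \<epsilon> v \<omega> powr (1/4 - e))) \<partial>Om)"
    proof (rule nn_integral_mono)
      fix \<omega>
      have "ennreal (av \<epsilon> v \<omega> powr (1/4)) \<le> ennreal (K powr (3/4) * gv \<epsilon> v \<omega> + K powr (- e) * (av \<epsilon> v \<omega> powr (1/4 + e) + av \<epsilon> v \<omega> powr (1/4 - e)))"
        unfolding gv_def by (intro ennreal_leI powr_quarter_le_min av_nonneg K1 pos)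
      also have "\<dots> = ennreal (K powr (3/4)) * ennreal (gv \<epsilon> v \<omega>) +
        ennreal (K powr (- e)) * (ennreal (av \<epsilon> v \<omega> powr (1/4 + e)) + ennreal (av \<epsilon> v \<omega> powr (1/4 - e)))"
        using gv_bounds by (simp add: ennreal_mult ennreal_plus)
      finally show "ennreal (av \<epsilon> v \<omega> powr (1/4)) \<le> \<dots>" .
    qed
    also have "\<dots> = ennreal (K powr (3/4)) * (\<integral>\<^sup>+\<omega>. ennreal (gv \<epsilon> v \<omega>) \<partial>Om) +
      ennreal (K powr (- e)) * ((\<integral>\<^sup>+\<omega>. ennreal (av \<epsilon> v \<omega> powr (1/4 + e)) \<partial>Om) + (\<integral>\<^sup>+\<omega>. ennreal (av \<epsilon> v \<omega> powr (1/4 - e)) \<partial>Om))"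
      by (simp only: nn_integral_add[OF borel_measurable_times_ennreal[OF borel_measurable_const e1]
            borel_measurable_times_ennreal[OF borel_measurable_const borel_measurable_add[OF e2 e2]]]
          nn_integral_cmult[OF e1] nn_integral_cmult[OF borel_measurable_add[OF e2 e2]] nn_integral_add[OF e2 e2])
    finally show ?thesis .
  qed
  have "ennreal (\<nu> ^ L) = ennreal \<nu> ^ L" using l0 by (simp add: ennreal_power)
  also have "\<dots> \<le> Qs \<epsilon> D (1/4) ^ L" by (rule power_mono[OF Q]) simp
  also have "\<dots> = ?I (1/4)" by (rule I[symmetric])
  also have "\<dots> \<le> (\<Sum>v\<in>?V. ennreal (K powr (3/4)) * (\<integral>\<^sup>+\<omega>. ennreal (gv \<epsilon> v \<omega>) \<partial>Om) +
      ennreal (K powr (- e)) * ((\<integral>\<^sup>+\<omega>. ennreal (av \<epsilon> v \<omega> powr (1/4 + e)) \<partial>Om) + (\<integral>\<^sup>+\<omega>. ennreal (av \<epsilon> v \<omega> powr (1/4 - e)) \<partial>Om)))"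
    by (rule sum_mono) (rule term_le)
  also have "\<dots> = ennreal (K powr (3/4)) * ?G + ennreal (K powr (- e)) * (?I (1/4 + e) + ?I (1/4 - e))"
    by (simp only: sum.distrib sum_distrib_left distrib_left)
  also have "\<dots> \<le> ennreal (K powr (3/4)) * ennreal m + ennreal (K powr (- e)) * (ennreal (exp (\<delta> * e) * \<mu>) ^ L + ennreal (exp (\<delta> * e) * \<mu>) ^ L)"
    unfolding m I by (intro add_left_mono mult_left_mono add_mono power_mono Qp Qm) auto
  also have "\<dots> = ennreal (K powr (3/4) * m + K powr (- e) * (2 * (exp (\<delta> * e) * \<mu>) ^ L))"
  proof -
    have x0: "0 \<le> (exp (\<delta> * e) * \<mu>) ^ L" using pos by simp
    have "ennreal (exp (\<delta> * e) * \<mu>) ^ L + ennreal (exp (\<delta> * e) * \<mu>) ^ L = ennreal (2 * (exp (\<delta> * e) * \<mu>) ^ L)"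
      using pos x0 by (simp only: ennreal_power mult_nonneg_nonneg exp_ge_zero mult_2 ennreal_plus)
    then show ?thesis using m x0 by (simp only: ennreal_mult ennreal_plus powr_ge_zero mult_nonneg_nonneg zero_le_numeral)
  qed
  finally have "\<nu> ^ L \<le> K powr (3/4) * m + K powr (- e) * (2 * (exp (\<delta> * e) * \<mu>) ^ L)"
    using m pos by (subst (asm) ennreal_le_iff) auto
  also have "K powr (- e) * (2 * (exp (\<delta> * e) * \<mu>) ^ L) = 2 * \<mu> ^ L"
    by (simp add: K_def powr_def power_mult_distrib exp_of_nat_mult[symmetric] exp_minus field_simps)
  also have "2 * \<mu> ^ L \<le> \<nu> ^ L / 2"
    using L(1) l0 by (simp add: power_divide field_simps)
  finally have "\<nu> ^ L / 2 \<le> K powr (3/4) * m" by simp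
  then have le: "\<nu> ^ L \<le> 2 * (K powr (3/4) * m)" by simp
  have "?c ^ L = \<nu> ^ L / K powr (3/4)"
    by (simp add: K_def powr_def power_mult_distrib exp_of_nat_mult[symmetric] exp_minus field_simps)
  moreover have Kp: "0 < K powr (3/4)" using K1 by simp
  ultimately have "2 * K powr (3/4) < \<nu> ^ L" using L(2) by (simp add: pos_less_divide_eq)
  with le have "K powr (3/4) * 1 < K powr (3/4) * m" by simp
  then have "1 < m" using Kp by (simp only: mult_less_cancel_left_pos)
  with m show ?thesis by blast
qed

text \<open>\<open>t i\<close> will be the probability of more than \<open>i\<close> children, so
  that \<open>m\<close> is the mean offspring number.\<close>

theorem supercritical_not_AE_Ylim_eq_0:
  assumes a: "a > 0"
    and mom: "\<And>i s. - a < s - 1/4 \<Longrightarrow> s - 1/4 < a \<Longrightarrow>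
      (\<integral>\<^sup>+x. (if i < deg x then ennreal (A i x powr s) else 0) \<partial>M) = ennreal (t i * gmom a s)"
    and t: "\<And>i. 0 \<le> t i" "t sums m" and super: "m * rho a > 1"
  shows "\<not> (AE \<omega> in Om. Ylim \<omega> = 0)"
proof -
  define X where "X = m * rho a"
  have X: "X > 1" using super by (simp add: X_def)
  have m0: "0 < m" using super rho_pos[OF a] by (smt (verit) mult_nonpos_nonneg)
  \<comment> \<open>At this rate the window costs X powr (3/4) per generation, less than the growth
    X; \<open>\<nu>\<close> is placed in the gap, above \<mu> as well.\<close>
  define \<delta> where "\<delta> = ln X"
  have \<delta>: "\<delta> > 0" using X by (simp add: \<delta>_def)
  obtain e where e: "e > 0" "e < a" "exp (- \<delta> * e) * gmom a (1/4 + e) < rho a" "exp (- \<delta> * e) * gmom a (1/4 - e) < rho a"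
    using gmom_near_quarter[OF a \<delta>] by blast
  define \<mu> where "\<mu> = m * (exp (- \<delta> * e) * max (gmom a (1/4 + e)) (gmom a (1/4 - e)))"
  have gp: "0 < gmom a (1/4 + e)" "0 < gmom a (1/4 - e)" using a e by (auto intro!: gmom_pos)
  have \<mu>: "0 \<le> \<mu>" "\<mu> < X" unfolding \<mu>_def X_def using gp m0 e by (auto simp: max_def)
  define \<nu> where "\<nu> = (max \<mu> (X powr (3/4)) + X) / 2"
  have "X powr (3/4) < X powr 1" using X by (intro powr_less_mono) auto
  then have X34: "X powr (3/4) < X" using X by simp
  have \<nu>: "\<mu> < \<nu>" "X powr (3/4) < \<nu>" "\<nu> < X" using \<mu> X34 by (auto simp: \<nu>_def)
  have ex: "exp (- (3/4) * \<delta>) = inverse (X powr (3/4))"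
    using X by (simp add: \<delta>_def powr_def exp_minus[symmetric])
  have \<nu>1: "exp (- (3/4) * \<delta>) * \<nu> > 1"
    using \<nu>(2) X unfolding ex by (simp add: field_simps)
  have upper: "Qs \<epsilon> D s \<le> ennreal (m * gmom a s)" if s: "- a < s - 1/4" "s - 1/4 < a" for \<epsilon> D s
  proof -
    have g: "0 \<le> gmom a s" using gmom_pos[OF a, of s] s by auto
    have "Qs \<epsilon> D s \<le> (\<Sum>i<D. \<integral>\<^sup>+x. (if i < deg x then ennreal (A i x powr s) else 0) \<partial>M)"
      unfolding Qs_def by (intro sum_mono nn_integral_mono) (auto simp: At_def)
    also have "\<dots> = (\<Sum>i<D. ennreal (t i * gmom a s))" using mom[OF s] by simp
    also have "\<dots> = ennreal (\<Sum>i<D. t i * gmom a s)" by (rule sum_ennreal) (use t g in auto)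
    also have "\<dots> \<le> ennreal (m * gmom a s)"
    proof (rule ennreal_leI)
      have "(\<Sum>i<D. t i) \<le> m"
        using t sum_le_suminf[OF sums_summable[OF t(2)], of "{..<D}"] sums_unique[OF t(2)] by auto
      then show "(\<Sum>i<D. t i * gmom a s) \<le> m * gmom a s"
        using g by (simp add: sum_distrib_right[symmetric] mult_right_mono)
    qed
    finally show ?thesis .
  qed
  have "(\<lambda>D. (\<Sum>i<D. t i) * rho a) \<longlonglongrightarrow> X"
    unfolding X_def using t(2) unfolding sums_def by (intro tendsto_intros)
  then have "\<forall>\<^sub>F D in sequentially. \<nu> < (\<Sum>i<D. t i) * rho a" using \<nu>(3) by (rule order_tendstoD)
  then obtain D where D: "\<nu> < (\<Sum>i<D. t i) * rho a" by (auto simp: eventually_sequentially)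
  \<comment> \<open>First the number \<open>D\<close> of children, then the cutoff, is chosen so
    that the truncated sum at exponent 1/4 still exceeds \<nu>. At the exponents 1/4 + e and 1/4 - e
    truncation only decreases the sums, so the upper bounds hold for every choice.\<close>
  have "(\<lambda>n. Qs (1 / real (Suc n)) D (1/4)) \<longlonglongrightarrow> (\<Sum>i<D. \<integral>\<^sup>+x. (if i < deg x then ennreal (A i x powr (1/4)) else 0) \<partial>M)"
    unfolding Qs_def
  proof (intro tendsto_sum nn_integral_LIMSEQ)
    fix i
    show "incseq (\<lambda>n x. ennreal (At (1 / real (Suc n)) i x powr (1/4)))"
    proof (intro incseq_SucI le_funI ennreal_leI powr_mono2)
      fix n x
      have "1 / real (Suc (Suc n)) \<le> 1 / real (Suc n)" by (simp add: field_simps)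
      then show "At (1 / real (Suc n)) i x \<le> At (1 / real (Suc (Suc n))) i x"
        using A_pos[of i x] unfolding At_def by auto
    qed (auto simp: At_nonneg)
    show "(\<lambda>x. ennreal (At (1 / real (Suc n)) i x powr (1/4))) \<in> borel_measurable M" for n by measurable
    fix x
    have "\<forall>\<^sub>F n in sequentially. 1 / real (Suc n) < A i x"
      using order_tendstoD(2)[OF LIMSEQ_inverse_real_of_nat A_pos[of i x]] by (simp add: inverse_eq_divide)
    then have "\<forall>\<^sub>F n in sequentially. ennreal (At (1 / real (Suc n)) i x powr (1/4)) = (if i < deg x then ennreal (A i x powr (1/4)) else 0)"
      by eventually_elim (auto simp: At_def)
    then show "(\<lambda>n. ennreal (At (1 / real (Suc n)) i x powr (1/4))) \<longlonglongrightarrow> (if i < deg x then ennreal (A i x powr (1/4)) else 0)"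
      by (rule tendsto_eventually)
  qed
  also have "(\<Sum>i<D. \<integral>\<^sup>+x. (if i < deg x then ennreal (A i x powr (1/4)) else 0) \<partial>M) = (\<Sum>i<D. ennreal (t i * rho a))"
    using mom[of "1/4"] a by (simp add: gmom_quarter)
  also have "\<dots> = ennreal (\<Sum>i<D. t i * rho a)" by (rule sum_ennreal) (use t rho_pos[OF a] in auto)
  also have "(\<Sum>i<D. t i * rho a) = (\<Sum>i<D. t i) * rho a" by (simp add: sum_distrib_right)
  finally have "(\<lambda>n. Qs (1 / real (Suc n)) D (1/4)) \<longlonglongrightarrow> ennreal ((\<Sum>i<D. t i) * rho a)" .
  moreover have "ennreal \<nu> < ennreal ((\<Sum>i<D. t i) * rho a)"
    using D \<mu> \<nu> by (intro ennreal_lessI) auto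
  ultimately have "\<forall>\<^sub>F n in sequentially. ennreal \<nu> < Qs (1 / real (Suc n)) D (1/4)" by (rule order_tendstoD)
  then obtain n where n: "ennreal \<nu> < Qs (1 / real (Suc n)) D (1/4)" by (auto simp: eventually_sequentially)
  let ?\<epsilon> = "1 / real (Suc n)"
  have le: "m * gmom a (1/4 + e) \<le> exp (\<delta> * e) * \<mu>" "m * gmom a (1/4 - e) \<le> exp (\<delta> * e) * \<mu>"
    unfolding \<mu>_def using m0 by (auto simp: exp_minus field_simps)
  have "\<exists>L m. m > 1 \<and> (\<Sum>v\<in>words D L. \<integral>\<^sup>+\<omega>. ennreal (gv ?\<epsilon> v \<omega>) \<partial>Om) = ennreal m"
  proof (rule ex_supercritical_block[OF \<delta> e(1) \<mu>(1) \<nu>(1) \<nu>1 less_imp_le[OF n]])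
    show "Qs ?\<epsilon> D (1/4 + e) \<le> ennreal (exp (\<delta> * e) * \<mu>)"
      using upper[of "1/4 + e"] e a le by (intro order_trans[OF _ ennreal_leI[OF le(1)]]) auto
    show "Qs ?\<epsilon> D (1/4 - e) \<le> ennreal (exp (\<delta> * e) * \<mu>)"
      using upper[of "1/4 - e"] e a le by (intro order_trans[OF _ ennreal_leI[OF le(2)]]) auto
  qed
  then obtain L m' where "m' > 1" "(\<Sum>v\<in>words D L. \<integral>\<^sup>+\<omega>. ennreal (gv ?\<epsilon> v \<omega>) \<partial>Om) = ennreal m'" by blast
  then show ?thesis by (intro not_AE_Ylim_eq_0[of ?\<epsilon> m' D L]) auto
qed

end

section \<open>Beta sticks and urn moments\<close>

definition beta_measure :: "real \<Rightarrow> real \<Rightarrow> real measure" where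
  "beta_measure \<alpha> \<gamma> = density lborel (\<lambda>x. ennreal (indicator {0<..<1} x * (x powr (\<alpha> - 1) * (1 - x) powr (\<gamma> - 1)) / Beta \<alpha> \<gamma>))"

text \<open>The complement of the open unit interval is null for the Beta laws. Redirecting it to
  1/2 makes the odds positive everywhere, as the locale \<open>marked_tree\<close> demands, and not
  just almost surely.\<close>

definition clip01 :: "real \<Rightarrow> real" where "clip01 x = (if 0 < x \<and> x < 1 then x else 1/2)"

lemma clip01_bounds: "0 < clip01 x" "clip01 x < 1"
  by (auto simp: clip01_def)

lemma clip01_measurable [measurable]: "clip01 \<in> borel_measurable borel"
  unfolding clip01_def by measurable

lemma sets_beta_measure [simp, measurable_cong]: "sets (beta_measure \<alpha> \<gamma>) = sets borel"
  by (simp add: beta_measure_def)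

lemma Beta_real_pos: "\<alpha> > 0 \<Longrightarrow> \<gamma> > 0 \<Longrightarrow> Beta \<alpha> (\<gamma> :: real) > 0"
  by (simp add: Beta_def Gamma_real_pos)

text \<open>Multiplying the Beta density by powers shifts its two parameters; negative exponents
  occur in the moments of the odds.\<close>

lemma nn_integral_beta_measure:
  assumes "\<alpha> > 0" "\<gamma> > 0" "\<alpha> + p > 0" "\<gamma> + q > 0"
  shows "(\<integral>\<^sup>+x. ennreal (clip01 x powr p * (1 - clip01 x) powr q) \<partial>beta_measure \<alpha> \<gamma>) =
    ennreal (Beta (\<alpha> + p) (\<gamma> + q) / Beta \<alpha> \<gamma>)"
proof -
  note B = Beta_real_pos[OF assms(1,2)]
  let ?f = "\<lambda>x::real. x powr (\<alpha> + p - 1) * (1 - x) powr (\<gamma> + q - 1) / Beta \<alpha> \<gamma>"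
  have "(?f has_integral (Beta (\<alpha> + p) (\<gamma> + q) / Beta \<alpha> \<gamma>)) {0..1}"
    by (intro has_integral_divide has_integral_Beta_real assms)
  then have int: "(?f has_integral (Beta (\<alpha> + p) (\<gamma> + q) / Beta \<alpha> \<gamma>)) {0<..<1}"
    by (simp add: has_integral_Icc_iff_Ioo)
  have "(\<integral>\<^sup>+x. ennreal (clip01 x powr p * (1 - clip01 x) powr q) \<partial>beta_measure \<alpha> \<gamma>) =
      (\<integral>\<^sup>+x. ennreal (indicator {0<..<1} x * (x powr (\<alpha> - 1) * (1 - x) powr (\<gamma> - 1)) / Beta \<alpha> \<gamma>) *
        ennreal (clip01 x powr p * (1 - clip01 x) powr q) \<partial>lborel)"
    unfolding beta_measure_def by (rule nn_integral_density) measurable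
  also have "\<dots> = (\<integral>\<^sup>+x. ennreal (indicator {0<..<1} x * ?f x) \<partial>lborel)"
  proof (rule nn_integral_cong)
    fix x :: real
    show "ennreal (indicator {0<..<1} x * (x powr (\<alpha> - 1) * (1 - x) powr (\<gamma> - 1)) / Beta \<alpha> \<gamma>) *
        ennreal (clip01 x powr p * (1 - clip01 x) powr q) = ennreal (indicator {0<..<1} x * ?f x)"
    proof (cases "0 < x \<and> x < 1")
      case True
      have "x powr (\<alpha> + p - 1) = x powr (\<alpha> - 1) * x powr p" "(1 - x) powr (\<gamma> + q - 1) = (1 - x) powr (\<gamma> - 1) * (1 - x) powr q"
        by (simp_all add: powr_add[symmetric] algebra_simps)
      then show ?thesis using True B by (simp add: clip01_def ennreal_mult[symmetric] mult_ac)
    qed (auto simp: indicator_def)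
  qed
  also have "\<dots> = ennreal (Beta (\<alpha> + p) (\<gamma> + q) / Beta \<alpha> \<gamma>)"
    by (rule nn_integral_has_integral_lebesgue[OF _ int]) (use B in auto)
  finally show ?thesis .
qed

lemma prob_space_beta_measure:
  assumes "\<alpha> > 0" "\<gamma> > 0"
  shows "prob_space (beta_measure \<alpha> \<gamma>)"
proof
  have "(\<integral>\<^sup>+x. ennreal (clip01 x powr 0 * (1 - clip01 x) powr 0) \<partial>beta_measure \<alpha> \<gamma>) = 1"
    using nn_integral_beta_measure[of \<alpha> \<gamma> 0 0] assms Beta_real_pos[OF assms] by simp
  moreover have "clip01 x powr 0 * (1 - clip01 x) powr 0 = 1" for x using clip01_bounds[of x] by simp
  ultimately show "emeasure (beta_measure \<alpha> \<gamma>) (space (beta_measure \<alpha> \<gamma>)) = 1" by simp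
qed

text \<open>Stick breaking: the Dirichlet weights of a vertex are built up child by child, so that their
  odds against the parent do not depend on the number of children.\<close>

definition odds :: "nat \<Rightarrow> (nat \<Rightarrow> real) \<Rightarrow> real" where
  "odds i \<beta> = clip01 (\<beta> i) / (\<Prod>j\<le>i. 1 - clip01 (\<beta> j))"

lemma odds_pos: "odds i \<beta> > 0"
  unfolding odds_def by (intro divide_pos_pos prod_pos) (auto simp: clip01_bounds)

text \<open>Stick \<open>i\<close> splits child \<open>i\<close>, of parameter \<open>a\<close>,
  from the parent and the children before it, whose parameters add up to a + 1/2 + i a.\<close>

definition stick_measure :: "real \<Rightarrow> (nat \<Rightarrow> real) measure" where
  "stick_measure a = PiM UNIV (\<lambda>i. beta_measure a (a + 1/2 + real i * a))"

lemma sets_stick_measure [measurable_cong]: "sets (stick_measure a) = sets (PiM UNIV (\<lambda>_. borel))"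
  unfolding stick_measure_def by (intro sets_PiM_cong) auto

lemma prob_space_stick_measure: "a > 0 \<Longrightarrow> prob_space (stick_measure a)"
  unfolding stick_measure_def
  by (intro prob_space_PiM prob_space_beta_measure) (auto intro!: add_pos_nonneg)

lemma odds_measurable: "odds i \<in> borel_measurable (PiM UNIV (\<lambda>_. borel))"
  unfolding odds_def by measurable

lemma odds_measurable_stick [measurable]: "odds i \<in> borel_measurable (stick_measure a)"
  using odds_measurable by (simp cong: measurable_cong_sets add: measurable_cong_sets[OF sets_stick_measure refl])

text \<open>A power of the odds is a product of functions of independent sticks, each integrating to
  a quotient of Beta values. The quotients telescope in the second parameter, so \<open>i\<close>
  disappears.\<close>

lemma odds_moment:
  assumes a: "a > 0" and s: "- a < s" "s < a + 1/2"
  shows "(\<integral>\<^sup>+\<beta>. ennreal (odds i \<beta> powr s) \<partial>stick_measure a) = ennreal (gmom a s)"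
proof -
  let ?g = "\<lambda>i. a + 1/2 + real i * a"
  have g: "?g i > 0" "?g i - s > 0" for i
    using a s mult_nonneg_nonneg[of "real i" a] by linarith+
  define F where "F j x = (if j = i then clip01 x powr s else clip01 x powr 0) * (1 - clip01 x) powr (- s)" for j and x :: real
  have F0: "0 \<le> F j x" for j x by (simp add: F_def)
  have fact: "odds i \<beta> powr s = (\<Prod>j\<le>i. F j (\<beta> j))" for \<beta>
  proof -
    have "(\<Prod>j\<le>i. F j (\<beta> j)) = (\<Prod>j\<le>i. if j = i then clip01 (\<beta> j) powr s else 1) * (\<Prod>j\<le>i. (1 - clip01 (\<beta> j)) powr (- s))"
      unfolding F_def prod.distrib using clip01_bounds
      by (intro arg_cong2[where f = "(*)"] prod.cong refl) (auto simp: less_imp_neq[symmetric])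
    also have "(\<Prod>j\<le>i. if j = i then clip01 (\<beta> j) powr s else 1) = clip01 (\<beta> i) powr s" by simp
    also have "(\<Prod>j\<le>i. (1 - clip01 (\<beta> j)) powr (- s)) = (\<Prod>j\<le>i. 1 - clip01 (\<beta> j)) powr (- s)"
      by (rule prod_powr_distrib[symmetric])
    finally show ?thesis
      unfolding odds_def powr_divide powr_minus by (simp add: divide_inverse)
  qed
  have mom: "(\<integral>\<^sup>+x. ennreal (F j x) \<partial>beta_measure a (?g j)) =
      ennreal ((if j = i then Beta (a + s) (?g j - s) else Beta a (?g j - s)) / Beta a (?g j))" for j
    using nn_integral_beta_measure[OF a g(1)[of j], of s "- s"] nn_integral_beta_measure[OF a g(1)[of j], of 0 "- s"] a s g(2)[of j]
    by (auto simp: F_def)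
  have "(\<integral>\<^sup>+\<beta>. ennreal (odds i \<beta> powr s) \<partial>stick_measure a) = (\<integral>\<^sup>+\<beta>. (\<Prod>j\<le>i. ennreal (F j (\<beta> j))) \<partial>stick_measure a)"
    using F0 by (simp add: fact prod_ennreal)
  also have "\<dots> = (\<Prod>j\<le>i. \<integral>\<^sup>+x. ennreal (F j x) \<partial>beta_measure a (?g j))"
    unfolding stick_measure_def
  proof (rule nn_integral_PiM_prod)
    show "prob_space (beta_measure a (?g j))" for j using a g by (intro prob_space_beta_measure)
    show "(\<lambda>x. ennreal (F j x)) \<in> borel_measurable (beta_measure a (?g j))" for j
      unfolding F_def by measurable
  qed simp
  also have "\<dots> = (\<Prod>j\<le>i. ennreal ((if j = i then Beta (a + s) (?g j - s) else Beta a (?g j - s)) / Beta a (?g j)))"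
    by (simp only: mom)
  also have "\<dots> = ennreal (\<Prod>j\<le>i. (if j = i then Beta (a + s) (?g j - s) else Beta a (?g j - s)) / Beta a (?g j))"
    using a s g by (intro prod_ennreal) (auto intro!: divide_nonneg_nonneg less_imp_le[OF Beta_real_pos])
  also have "(\<Prod>j\<le>i. (if j = i then Beta (a + s) (?g j - s) else Beta a (?g j - s)) / Beta a (?g j)) =
      (\<Prod>j<i. Beta a (?g j - s) / Beta a (?g j)) * (Beta (a + s) (?g i - s) / Beta a (?g i))"
    by (simp add: lessThan_Suc_atMost[symmetric])
  \<comment> \<open>Telescoping, because a + ?g j = ?g (Suc j).\<close>
  also have "(\<Prod>j<i. Beta a (?g j - s) / Beta a (?g j)) =
      Gamma (a + 1/2 - s) * Gamma (?g i) / (Gamma (a + 1/2) * Gamma (?g i - s))"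
  proof (induction i)
    case 0
    have "Gamma (a + 1/2) > 0" "Gamma (a + 1/2 - s) > 0" using a s by (auto intro!: Gamma_real_pos)
    then show ?case by simp
  next
    case (Suc i)
    have pos: "Gamma a > 0" "Gamma (?g i) > 0" "Gamma (?g i - s) > 0" "Gamma (?g (Suc i)) > 0" "Gamma (?g (Suc i) - s) > 0"
      "Gamma (a + 1/2) > 0"
      using a g(1)[of i] g(2)[of i] g(1)[of "Suc i"] g(2)[of "Suc i"] by (auto intro!: Gamma_real_pos simp del: of_nat_Suc)
    have "Beta a (?g i - s) / Beta a (?g i) = Gamma (?g i - s) * Gamma (?g (Suc i)) / (Gamma (?g (Suc i) - s) * Gamma (?g i))"
    proof -
      have e: "a + (?g i - s) = ?g (Suc i) - s" "a + ?g i = ?g (Suc i)" by (simp_all add: algebra_simps)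
      show ?thesis using pos unfolding Beta_def e by (simp del: of_nat_Suc)
    qed
    then show ?case using pos by (simp add: Suc del: of_nat_Suc)
  qed
  also have "Gamma (a + 1/2 - s) * Gamma (?g i) / (Gamma (a + 1/2) * Gamma (?g i - s)) * (Beta (a + s) (?g i - s) / Beta a (?g i)) = gmom a s"
  proof -
    have "0 < a + ?g i" using a g(1)[of i] by linarith
    note pos = Gamma_real_pos[OF g(1)[of i]] Gamma_real_pos[OF g(2)[of i]] Gamma_real_pos[OF this]
    have e: "a + s + (?g i - s) = a + ?g i" by simp
    show ?thesis using pos unfolding Beta_def gmom_def e by (simp add: divide_simps)
  qed
  finally show ?thesis .
qed

text \<open>Because \<open>gmom a (1/2) = 1\<close>, the bound \<open>x \<ge> 2 \<surd>x - 1\<close> suffices; the mean may be infinite.\<close>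

lemma odds_mean_ge_1:
  assumes a: "a > 0"
  shows "(\<integral>\<^sup>+\<beta>. ennreal (odds i \<beta>) \<partial>stick_measure a) \<ge> 1"
proof -
  interpret prob_space "stick_measure a" using a by (rule prob_space_stick_measure)
  have "Gamma a > 0" "Gamma (a + 1/2) > 0" using a by (auto intro!: Gamma_real_pos)
  then have "gmom a (1/2) = 1" by (simp add: gmom_def)
  then have half: "(\<integral>\<^sup>+\<beta>. ennreal (odds i \<beta> powr (1/2)) \<partial>stick_measure a) = 1"
    using odds_moment[OF a, of "1/2" i] a by simp
  have "2 * (\<integral>\<^sup>+\<beta>. ennreal (odds i \<beta> powr (1/2)) \<partial>stick_measure a) = (\<integral>\<^sup>+\<beta>. 2 * ennreal (odds i \<beta> powr (1/2)) \<partial>stick_measure a)"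
    by (rule nn_integral_cmult[symmetric]) measurable
  also have "\<dots> \<le> (\<integral>\<^sup>+\<beta>. ennreal (odds i \<beta>) + 1 \<partial>stick_measure a)"
  proof (rule nn_integral_mono)
    fix \<beta>
    let ?x = "odds i \<beta> powr (1/2)"
    have "?x * ?x = odds i \<beta>" using odds_pos[of i \<beta>] by (simp add: powr_half_sqrt)
    moreover have "0 \<le> (?x - 1)\<^sup>2" by simp
    ultimately have "2 * ?x \<le> odds i \<beta> + 1" by (simp add: power2_eq_square algebra_simps)
    then have "ennreal (2 * ?x) \<le> ennreal (odds i \<beta> + 1)" by (rule ennreal_leI)
    then show "2 * ennreal ?x \<le> ennreal (odds i \<beta>) + 1"
      using odds_pos[of i \<beta>] by (simp add: ennreal_mult)
  qed
  also have "\<dots> = (\<integral>\<^sup>+\<beta>. ennreal (odds i \<beta>) \<partial>stick_measure a) + 1"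
    by (subst nn_integral_add) (auto simp: emeasure_space_1)
  finally have "1 + 1 \<le> 1 + (\<integral>\<^sup>+\<beta>. ennreal (odds i \<beta>) \<partial>stick_measure a)"
    by (simp add: half add.commute)
  then show ?thesis by (simp only: ennreal_add_left_cancel_le) simp
qed

text \<open>Urn moments. \<open>R i x y\<close> stands for the moment \<open>E (\<beta>\<^sub>i\<^sup>x (1 - \<beta>\<^sub>i)\<^sup>y)\<close>, \<open>c0\<close> counts the draws
  of the parent and \<open>c i\<close> those of the child \<open>i\<close>.\<close>

definition urn_moment :: "(nat \<Rightarrow> nat \<Rightarrow> nat \<Rightarrow> real) \<Rightarrow> nat \<Rightarrow> nat \<Rightarrow> (nat \<Rightarrow> nat) \<Rightarrow> real" where
  "urn_moment R d c0 c = (\<Prod>i<d. R i (c i) (c0 + (\<Sum>j<i. c j)))"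

context
  fixes R :: "nat \<Rightarrow> nat \<Rightarrow> nat \<Rightarrow> real" and a base :: real
  assumes R1: "\<And>i x y. R i (Suc x) y * (a + base + real i * a + x + y) = R i x y * (a + x)"
    and R2: "\<And>i x y. R i x (Suc y) * (a + base + real i * a + x + y) = R i x y * (base + real i * a + y)"
begin

lemma urn_moment_parent:
  "urn_moment R d (Suc c0) c * (base + real d * a + c0 + real (\<Sum>j<d. c j)) = urn_moment R d c0 c * (base + c0)"
proof (induction d)
  case (Suc d)
  let ?y = "c0 + (\<Sum>j<d. c j)"
  let ?s = "base + real d * a + c0 + real (\<Sum>j<d. c j)"
  have "urn_moment R (Suc d) (Suc c0) c * (base + real (Suc d) * a + c0 + real (\<Sum>j<Suc d. c j)) =
      urn_moment R d (Suc c0) c * (R d (c d) (Suc ?y) * (a + base + real d * a + c d + ?y))"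
    by (simp add: urn_moment_def algebra_simps)
  also have "\<dots> = (urn_moment R d (Suc c0) c * ?s) * R d (c d) ?y"
    unfolding R2 by (simp add: algebra_simps)
  also have "\<dots> = urn_moment R (Suc d) c0 c * (base + c0)"
    unfolding Suc by (simp add: urn_moment_def)
  finally show ?case .
qed (simp add: urn_moment_def)

text \<open>Sticks before \<open>k\<close> are untouched, stick \<open>k\<close> supplies the factor
  a + c k by \<open>R1\<close>, and every later stick sees one more draw on its complementary side,
  as in \<open>R2\<close>.\<close>

lemma urn_moment_child:
  "k < d \<Longrightarrow> urn_moment R d c0 (c(k := Suc (c k))) * (base + real d * a + c0 + real (\<Sum>j<d. c j)) = urn_moment R d c0 c * (a + c k)"
proof (induction d)
  case (Suc d)
  let ?c' = "c(k := Suc (c k))"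
  let ?y = "c0 + (\<Sum>j<d. c j)"
  let ?s = "base + real d * a + c0 + real (\<Sum>j<d. c j)"
  show ?case
  proof (cases "k = d")
    case True
    have 1: "urn_moment R d c0 ?c' = urn_moment R d c0 c"
      unfolding urn_moment_def using True by (intro prod.cong refl arg_cong2[where f = "R _"] arg_cong2[where f = "(+)"] sum.cong) auto
    have 2: "(\<Sum>j<d. ?c' j) = (\<Sum>j<d. c j)" using True by (intro sum.cong) auto
    have "urn_moment R (Suc d) c0 ?c' = urn_moment R d c0 c * R d (Suc (c d)) ?y"
      using True 2 by (simp add: urn_moment_def 1[unfolded urn_moment_def] del: fun_upd_apply) (simp add: True)
    then have "urn_moment R (Suc d) c0 ?c' * (base + real (Suc d) * a + c0 + real (\<Sum>j<Suc d. c j)) =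
        urn_moment R d c0 c * (R d (Suc (c d)) ?y * (a + base + real d * a + c d + ?y))"
      by (simp add: algebra_simps)
    also have "\<dots> = urn_moment R (Suc d) c0 c * (a + c k)"
      unfolding R1 using True by (simp add: urn_moment_def)
    finally show ?thesis .
  next
    case False
    then have k: "k < d" using Suc.prems by simp
    have "(\<Sum>j<d. ?c' j) = Suc (\<Sum>j<d. c j)"
      using k by (subst (1 2) sum.remove[of "{..<d}" k]) auto
    then have "urn_moment R (Suc d) c0 ?c' = urn_moment R d c0 ?c' * R d (c d) (Suc ?y)"
      using False by (simp add: urn_moment_def)
    then have "urn_moment R (Suc d) c0 ?c' * (base + real (Suc d) * a + c0 + real (\<Sum>j<Suc d. c j)) =
        urn_moment R d c0 ?c' * (R d (c d) (Suc ?y) * (a + base + real d * a + c d + ?y))"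
      by (simp add: algebra_simps)
    also have "\<dots> = (urn_moment R d c0 ?c' * ?s) * R d (c d) ?y"
      unfolding R2 by (simp add: algebra_simps)
    also have "\<dots> = urn_moment R (Suc d) c0 c * (a + c k)"
      unfolding Suc.IH[OF k] by (simp add: urn_moment_def)
    finally show ?thesis .
  qed
qed simp

end

section \<open>The walk as a mixture of random walks in random environment\<close>

text \<open>Before the first departure from a vertex other than the root its parent edge has been
  crossed once, so its weight in units of 2\<Delta> is (1 + \<Delta>)/(2\<Delta>) = a + 1/2.\<close>

definition par_base :: "real \<Rightarrow> vertex \<Rightarrow> real" where
  "par_base a u = (if u = [] then 0 else a + 1/2)"

text \<open>The root has no parent. There the first stick is frozen at \<open>1\<close> (in \<open>bt\<close>), and the parameter \<open>1\<close>
  of the unused first coordinate is a dummy.\<close>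

definition env_sticks :: "real \<Rightarrow> vertex \<Rightarrow> (nat \<Rightarrow> real) measure" where
  "env_sticks a u = PiM UNIV (\<lambda>i. beta_measure a (if u = [] \<and> i = 0 then 1 else par_base a u + real i * a))"

definition env :: "real \<Rightarrow> (vertex \<Rightarrow> nat \<Rightarrow> real) measure" where
  "env a = PiM UNIV (env_sticks a)"

definition bt :: "vertex \<Rightarrow> (nat \<Rightarrow> real) \<Rightarrow> nat \<Rightarrow> real" where
  "bt u \<beta> i = (if u = [] \<and> i = 0 then 1 else clip01 (\<beta> i))"

definition pp :: "nat \<Rightarrow> (nat \<Rightarrow> real) \<Rightarrow> real" where "pp d b = (\<Prod>j<d. 1 - b j)"

text \<open>Pieces are broken off from the last child backwards: \<open>b i\<close> is the share of
  child \<open>i\<close> among the parent and the children up to \<open>i\<close>, and the later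
  sticks scale it down. What no child takes, \<open>pp\<close>, goes to the parent.\<close>

definition pc :: "nat \<Rightarrow> (nat \<Rightarrow> real) \<Rightarrow> nat \<Rightarrow> real" where "pc d b i = b i * (\<Prod>j\<in>{i<..<d}. 1 - b j)"

lemma bt_bounds: "0 < bt u \<beta> i" "bt u \<beta> i \<le> 1"
  using clip01_bounds[of "\<beta> i"] by (auto simp: bt_def)

lemma pc_Suc: "i < d \<Longrightarrow> pc (Suc d) b i = pc d b i * (1 - b d)"
proof -
  assume "i < d"
  then have "{i<..<Suc d} = insert d {i<..<d}" by auto
  then show ?thesis by (simp add: pc_def)
qed

lemma pc_Suc_self: "pc (Suc d) b d = b d"
proof -
  have "{d<..<Suc d} = {}" by auto
  then show ?thesis by (simp add: pc_def)
qed

lemma pp_Suc: "pp (Suc d) b = pp d b * (1 - b d)"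
  by (simp add: pp_def)

lemma pp_plus_pc: "pp d b + (\<Sum>i<d. pc d b i) = 1"
proof (induction d)
  case (Suc d)
  have "pp (Suc d) b + (\<Sum>i<Suc d. pc (Suc d) b i) = (pp d b + (\<Sum>i<d. pc d b i)) * (1 - b d) + b d"
    by (simp add: pp_Suc pc_Suc pc_Suc_self sum_distrib_right distrib_right)
  then show ?case by (simp add: Suc)
qed (simp add: pp_def)

definition urn_mono :: "nat \<Rightarrow> nat \<Rightarrow> (nat \<Rightarrow> nat) \<Rightarrow> (nat \<Rightarrow> real) \<Rightarrow> real" where
  "urn_mono d c0 c b = pp d b ^ c0 * (\<Prod>i<d. pc d b i ^ c i)"

text \<open>Regrouping by sticks: 1 - b i is a factor of the step probability to the parent and to
  every child before \<open>i\<close>. The right side is a product of functions of independent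
  sticks.\<close>

lemma urn_mono_eq: "urn_mono d c0 c b = (\<Prod>i<d. b i ^ c i * (1 - b i) ^ (c0 + (\<Sum>j<i. c j)))"
proof (induction d)
  case (Suc d)
  have "urn_mono (Suc d) c0 c b = urn_mono d c0 c b * (b d ^ c d * ((1 - b d) ^ c0 * (\<Prod>i<d. (1 - b d) ^ c i)))"
    by (simp add: urn_mono_def pp_Suc pc_Suc pc_Suc_self power_mult_distrib prod.distrib mult_ac)
  then show ?case by (simp add: Suc power_add power_sum)
qed (simp add: urn_mono_def pp_def)

definition stick_mom :: "real \<Rightarrow> vertex \<Rightarrow> nat \<Rightarrow> nat \<Rightarrow> nat \<Rightarrow> real" where
  "stick_mom a u i x y = (if u = [] \<and> i = 0 then (if y = 0 then 1 else 0)
    else Beta (a + x) (par_base a u + real i * a + y) / Beta a (par_base a u + real i * a))"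

lemma par_base_pos:
  assumes "a > 0" "\<not> (u = [] \<and> i = 0)"
  shows "par_base a u + real i * a > 0"
  using assms mult_nonneg_nonneg[of "real i" a] by (auto simp: par_base_def intro: add_pos_nonneg)

lemma prob_space_env_coord: "a > 0 \<Longrightarrow> prob_space (beta_measure a (if u = [] \<and> i = 0 then 1 else par_base a u + real i * a))"
  using par_base_pos[of a u i] by (intro prob_space_beta_measure) auto

lemma prob_space_env_sticks: "a > 0 \<Longrightarrow> prob_space (env_sticks a u)"
  unfolding env_sticks_def by (intro prob_space_PiM prob_space_env_coord)

lemma sets_env_sticks [measurable_cong]: "sets (env_sticks a u) = sets (PiM UNIV (\<lambda>_. borel))"
  unfolding env_sticks_def by (intro sets_PiM_cong) auto

lemma prob_space_env: "a > 0 \<Longrightarrow> prob_space (env a)"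
  unfolding env_def by (intro prob_space_PiM prob_space_env_sticks)

lemma env_sticks_child: "v \<noteq> [] \<Longrightarrow> env_sticks a v = stick_measure a"
  by (simp add: env_sticks_def stick_measure_def par_base_def)

lemma nn_integral_stick_mom:
  assumes a: "a > 0"
  shows "(\<integral>\<^sup>+x. ennreal ((if u = [] \<and> i = 0 then 1 else clip01 x) ^ m * (1 - (if u = [] \<and> i = 0 then 1 else clip01 x)) ^ n)
      \<partial>beta_measure a (if u = [] \<and> i = 0 then 1 else par_base a u + real i * a)) = ennreal (stick_mom a u i m n)"
proof (cases "u = [] \<and> i = 0")
  case True
  interpret prob_space "beta_measure a 1" using a by (intro prob_space_beta_measure) auto
  show ?thesis using True emeasure_space_1 by (auto simp: stick_mom_def power_0_left)
next
  case False
  have *: "clip01 x ^ m * (1 - clip01 x) ^ n = clip01 x powr real m * (1 - clip01 x) powr real n" for x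
    using clip01_bounds[of x] by (simp add: powr_realpow)
  have "(\<integral>\<^sup>+x. ennreal (clip01 x ^ m * (1 - clip01 x) ^ n) \<partial>beta_measure a (par_base a u + real i * a)) =
      ennreal (Beta (a + m) (par_base a u + real i * a + n) / Beta a (par_base a u + real i * a))"
    unfolding * by (rule nn_integral_beta_measure) (use a par_base_pos[OF a False] in auto)
  then show ?thesis by (simp only: stick_mom_def if_not_P[OF False])
qed

lemma stick_mom_nonneg: "a > 0 \<Longrightarrow> 0 \<le> stick_mom a u i m n"
proof (cases "u = [] \<and> i = 0")
  case False
  assume a: "a > 0"
  note g = par_base_pos[OF a False]
  have "0 < Beta (a + m) (par_base a u + real i * a + n)" "0 < Beta a (par_base a u + real i * a)"
    using a g by (auto intro!: Beta_real_pos add_pos_nonneg)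
  then show ?thesis using False by (simp add: stick_mom_def)
qed (simp add: stick_mom_def)

lemma stick_mom_0: "a > 0 \<Longrightarrow> stick_mom a u i 0 0 = 1"
proof (cases "u = [] \<and> i = 0")
  case False
  assume a: "a > 0"
  show ?thesis using False Beta_real_pos[OF a par_base_pos[OF a False]] by (simp add: stick_mom_def)
qed (simp add: stick_mom_def)

lemma stick_mom_Suc1:
  assumes a: "a > 0"
  shows "stick_mom a u i (Suc x) y * (a + par_base a u + real i * a + x + y) = stick_mom a u i x y * (a + x)"
proof (cases "u = [] \<and> i = 0")
  case True
  then show ?thesis by (simp add: stick_mom_def par_base_def)
next
  case False
  let ?g = "par_base a u + real i * a"
  have "a + real x \<notin> \<int>\<^sub>\<le>\<^sub>0" using a by (intro pos_not_nonpos_Ints) auto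
  from Beta_plus1_left[OF this, of "?g + y"]
  have "Beta (a + real (Suc x)) (?g + y) * (a + x + (?g + y)) = Beta (a + x) (?g + y) * (a + x)" by (simp add: algebra_simps)
  moreover have "a + par_base a u + real i * a + x + y = a + x + (?g + y)" by simp
  ultimately show ?thesis using False by (simp only: stick_mom_def if_False times_divide_eq_left)
qed

lemma stick_mom_Suc2:
  assumes a: "a > 0"
  shows "stick_mom a u i x (Suc y) * (a + par_base a u + real i * a + x + y) = stick_mom a u i x y * (par_base a u + real i * a + y)"
proof (cases "u = [] \<and> i = 0")
  case True
  then show ?thesis by (simp add: stick_mom_def par_base_def)
next
  case False
  let ?g = "par_base a u + real i * a"
  have "?g + y \<notin> \<int>\<^sub>\<le>\<^sub>0" using par_base_pos[OF a False] by (intro pos_not_nonpos_Ints) auto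
  from Beta_plus1_right[OF this, of "a + x"]
  have "Beta (a + x) (?g + real (Suc y)) * (a + x + (?g + y)) = Beta (a + x) (?g + y) * (?g + y)" by (simp add: algebra_simps)
  moreover have "a + par_base a u + real i * a + x + y = a + x + (?g + y)" by simp
  ultimately show ?thesis using False by (simp only: stick_mom_def if_False times_divide_eq_left)
qed

lemma urn_mono_measurable [measurable]: "(\<lambda>\<beta>. urn_mono d c0 c (bt u \<beta>)) \<in> borel_measurable (env_sticks a u)"
proof -
  have "(\<lambda>\<beta>. bt u \<beta> i) \<in> borel_measurable (PiM UNIV (\<lambda>_. borel))" for i
    unfolding bt_def by measurable
  then have "(\<lambda>\<beta>. urn_mono d c0 c (bt u \<beta>)) \<in> borel_measurable (PiM UNIV (\<lambda>_. borel))"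
    unfolding urn_mono_eq by measurable
  then show ?thesis by (simp add: measurable_cong_sets[OF sets_env_sticks refl])
qed

lemma urn_mono_nonneg: "0 \<le> urn_mono d c0 c (bt u \<beta>)"
  unfolding urn_mono_eq using bt_bounds[of u \<beta>] by (intro prod_nonneg mult_nonneg_nonneg) (auto intro: less_imp_le)

lemma nn_integral_urn_mono:
  assumes a: "a > 0"
  shows "(\<integral>\<^sup>+\<beta>. ennreal (urn_mono d c0 c (bt u \<beta>)) \<partial>env_sticks a u) = ennreal (urn_moment (stick_mom a u) d c0 c)"
proof -
  let ?cl = "\<lambda>i x. if u = [] \<and> i = 0 then 1 else clip01 x" and ?y = "\<lambda>i. c0 + (\<Sum>j<i. c j)"
  have "(\<integral>\<^sup>+\<beta>. ennreal (urn_mono d c0 c (bt u \<beta>)) \<partial>env_sticks a u) =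
      (\<integral>\<^sup>+\<beta>. (\<Prod>i<d. ennreal (?cl i (\<beta> i) ^ c i * (1 - ?cl i (\<beta> i)) ^ ?y i)) \<partial>env_sticks a u)"
  proof (rule nn_integral_cong)
    fix \<beta> :: "nat \<Rightarrow> real"
    have "0 \<le> ?cl i (\<beta> i)" "0 \<le> 1 - ?cl i (\<beta> i)" for i
      using clip01_bounds[of "\<beta> i"] by auto
    then show "ennreal (urn_mono d c0 c (bt u \<beta>)) = (\<Prod>i<d. ennreal (?cl i (\<beta> i) ^ c i * (1 - ?cl i (\<beta> i)) ^ ?y i))"
      unfolding urn_mono_eq bt_def by (intro prod_ennreal[symmetric] mult_nonneg_nonneg zero_le_power)
  qed
  also have "\<dots> = (\<Prod>i<d. \<integral>\<^sup>+x. ennreal (?cl i x ^ c i * (1 - ?cl i x) ^ ?y i)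
      \<partial>beta_measure a (if u = [] \<and> i = 0 then 1 else par_base a u + real i * a))"
    unfolding env_sticks_def
    by (rule nn_integral_PiM_prod[OF prob_space_env_coord[OF a]]) (simp, measurable)
  also have "\<dots> = (\<Prod>i<d. ennreal (stick_mom a u i (c i) (?y i)))"
    by (intro prod.cong refl nn_integral_stick_mom a)
  also have "\<dots> = ennreal (urn_moment (stick_mom a u) d c0 c)"
    unfolding urn_moment_def by (intro prod_ennreal stick_mom_nonneg a)
  finally show ?thesis .
qed

section \<open>Crossing counts and step probabilities along nearest-neighbour paths\<close>

lemma snoc_mem_gw_tree_iff: "u @ [i] \<in> gw_tree N \<longleftrightarrow> u \<in> gw_tree N \<and> i < N u"
  by (subst gw_tree.simps) auto

lemma nbrs_gw_tree:
  assumes "u \<in> gw_tree N"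
  shows "nbrs (gw_tree N) u = (\<lambda>i. u @ [i]) ` {..<N u} \<union> (if u = [] then {} else {butlast u})"
proof (rule set_eqI)
  fix v
  have "(\<exists>i. u = v @ [i]) \<longleftrightarrow> u \<noteq> [] \<and> v = butlast u"
    by (metis append_butlast_last_id snoc_eq_iff_butlast)
  moreover have "v \<in> nbrs (gw_tree N) u \<longleftrightarrow> (\<exists>i<N u. v = u @ [i]) \<or> (\<exists>i. u = v @ [i])"
    unfolding nbrs_def using assms snoc_mem_gw_tree_iff[of u _ N] snoc_mem_gw_tree_iff[of v _ N] by blast
  ultimately show "v \<in> nbrs (gw_tree N) u \<longleftrightarrow> v \<in> (\<lambda>i. u @ [i]) ` {..<N u} \<union> (if u = [] then {} else {butlast u})"
    by (cases "u = []") auto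
qed

lemma butlast_neq_snoc [simp]: "butlast u \<noteq> u @ [k]" "u @ [k] \<noteq> butlast u"
proof -
  show "butlast u \<noteq> u @ [k]" by (rule notI, drule arg_cong[of _ _ length], simp)
  then show "u @ [k] \<noteq> butlast u" by metis
qed

primrec cnt :: "(nat \<Rightarrow> vertex) \<Rightarrow> nat \<Rightarrow> vertex \<Rightarrow> vertex \<Rightarrow> nat" where
  "cnt x 0 u v = 0"
| "cnt x (Suc n) u v = cnt x n u v + of_bool (x n = u \<and> x (Suc n) = v)"

definition nnpath :: "(vertex \<Rightarrow> nat) \<Rightarrow> (nat \<Rightarrow> vertex) \<Rightarrow> nat \<Rightarrow> bool" where
  "nnpath N x n \<longleftrightarrow> x 0 = [] \<and> (\<forall>i<n. x (Suc i) \<in> nbrs (gw_tree N) (x i))"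

lemma nnpath_mem: "nnpath N x n \<Longrightarrow> x n \<in> gw_tree N"
  by (cases n) (auto simp: nnpath_def nbrs_def gw_tree.root)

lemma nnpath_Suc: "nnpath N x (Suc n) \<longleftrightarrow> nnpath N x n \<and> x (Suc n) \<in> nbrs (gw_tree N) (x n)"
  by (auto simp: nnpath_def less_Suc_eq)

text \<open>The edge above \<open>u @ [i]\<close> is the only way into and out of the subtree below
  it, so crossings alternate in direction and the surplus tells on which side the walk is. Hence
  departure counts alone determine the edge weights.\<close>

lemma cnt_balance:
  "nnpath N x n \<Longrightarrow> cnt x n u (u @ [i]) = cnt x n (u @ [i]) u + of_bool (prefix (u @ [i]) (x n))"
proof (induction n)
  case 0
  then show ?case by (simp add: nnpath_def)
next
  case (Suc n)
  then have IH: "cnt x n u (u @ [i]) = cnt x n (u @ [i]) u + of_bool (prefix (u @ [i]) (x n))"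
    and nb: "x (Suc n) \<in> nbrs (gw_tree N) (x n)" by (auto simp: nnpath_Suc)
  from nb obtain j where "x (Suc n) = x n @ [j] \<or> x n = x (Suc n) @ [j]" by (auto simp: nbrs_def)
  then show ?case
  proof
    assume j: "x (Suc n) = x n @ [j]"
    have "prefix (u @ [i]) (x (Suc n)) \<longleftrightarrow> u @ [i] = x n @ [j] \<or> prefix (u @ [i]) (x n)"
      unfolding j by (rule prefix_snoc)
    moreover have "\<not> (u @ [i] = x n @ [j] \<and> prefix (u @ [i]) (x n))" by (auto dest: prefix_length_le)
    moreover have "\<not> (x n = u @ [i] \<and> x n @ [j] = u)" by auto
    ultimately show ?case using IH by (auto simp: j of_bool_def)
  next
    assume j: "x n = x (Suc n) @ [j]"
    have "prefix (u @ [i]) (x n) \<longleftrightarrow> u @ [i] = x (Suc n) @ [j] \<or> prefix (u @ [i]) (x (Suc n))"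
      unfolding j by (rule prefix_snoc)
    moreover have "\<not> (u @ [i] = x (Suc n) @ [j] \<and> prefix (u @ [i]) (x (Suc n)))" by (auto dest: prefix_length_le)
    moreover have "\<not> (x n = u \<and> x (Suc n) = u @ [i])" using j by auto
    ultimately show ?case using IH j by (auto simp: of_bool_def)
  qed
qed

lemma edge_weight_cnt:
  "edge_weight \<Delta> x n {u, u @ [i]} = 1 + \<Delta> * (real (cnt x n u (u @ [i])) + real (cnt x n (u @ [i]) u))"
proof -
  have "(\<Sum>k=1..n. of_bool ({x (k - 1), x k} = {u, u @ [i]})) = real (cnt x n u (u @ [i])) + real (cnt x n (u @ [i]) u)"
  proof (induction n)
    case (Suc n)
    have "{x n, x (Suc n)} = {u, u @ [i]} \<longleftrightarrow> x n = u \<and> x (Suc n) = u @ [i] \<or> x n = u @ [i] \<and> x (Suc n) = u"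
      by (auto simp: doubleton_eq_iff)
    then show ?case using Suc by (auto simp: of_bool_def)
  qed simp
  then show ?thesis by (simp add: edge_weight_def)
qed

definition par_cnt :: "(nat \<Rightarrow> vertex) \<Rightarrow> nat \<Rightarrow> vertex \<Rightarrow> nat" where
  "par_cnt x n u = (if u = [] then 0 else cnt x n u (butlast u))"

definition child_cnt :: "(nat \<Rightarrow> vertex) \<Rightarrow> nat \<Rightarrow> vertex \<Rightarrow> nat \<Rightarrow> nat" where
  "child_cnt x n u i = cnt x n u (u @ [i])"

definition pr :: "(vertex \<Rightarrow> nat) \<Rightarrow> (vertex \<Rightarrow> nat \<Rightarrow> real) \<Rightarrow> vertex \<Rightarrow> vertex \<Rightarrow> real" where
  "pr N e u v = (if \<exists>i. v = u @ [i] then pc (N u) (bt u (e u)) (last v) else pp (N u) (bt u (e u)))"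

context
  fixes \<Delta> a :: real and N :: "vertex \<Rightarrow> nat"
  assumes Delta: "\<Delta> > 0" and a_eq: "a = 1 / (2 * \<Delta>)"
begin

lemma a_pos: "a > 0" and two_Delta_a: "2 * \<Delta> * a = 1"
  using Delta by (auto simp: a_eq)

definition urn_total :: "(nat \<Rightarrow> vertex) \<Rightarrow> nat \<Rightarrow> vertex \<Rightarrow> real" where
  "urn_total x n u = par_base a u + real (N u) * a + par_cnt x n u + real (\<Sum>j<N u. child_cnt x n u j)"

text \<open>At its current vertex the walk has come back from every visit to a child, so a child
  edge was crossed twice per departure; \<open>two_Delta_a\<close> rewrites the initial weight 1 as
  2 \<Delta> a.\<close>

lemma edge_weight_child:
  assumes "nnpath N x n"
  shows "edge_weight \<Delta> x n {x n, x n @ [i]} = 2 * \<Delta> * (a + child_cnt x n (x n) i)"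
proof -
  have "\<not> prefix (x n @ [i]) (x n)" by (auto dest: prefix_length_le)
  then show ?thesis
    using cnt_balance[OF assms, of "x n" i] two_Delta_a
    by (simp add: edge_weight_cnt child_cnt_def algebra_simps)
qed

text \<open>The parent edge has one crossing more than twice the departures towards the parent; this
  extra \<Delta> is the 1/2 in \<open>par_base\<close>.\<close>

lemma edge_weight_parent:
  assumes "nnpath N x n" "x n \<noteq> []"
  shows "edge_weight \<Delta> x n {x n, butlast (x n)} = 2 * \<Delta> * (par_base a (x n) + par_cnt x n (x n))"
proof -
  define p k where "p = butlast (x n)" and "k = last (x n)"
  have x: "x n = p @ [k]" using assms by (simp add: p_def k_def)
  have "edge_weight \<Delta> x n {p, p @ [k]} = 1 + \<Delta> * (real (cnt x n p (p @ [k])) + real (cnt x n (p @ [k]) p))"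
    by (rule edge_weight_cnt)
  moreover have "cnt x n p (p @ [k]) = cnt x n (p @ [k]) p + 1"
    using cnt_balance[OF assms(1), of p k] x by simp
  ultimately have "edge_weight \<Delta> x n {p @ [k], p} = 1 + \<Delta> * (2 * real (cnt x n (p @ [k]) p) + 1)"
    by (simp add: insert_commute)
  then show ?thesis
    using two_Delta_a unfolding x par_base_def par_cnt_def by (simp add: algebra_simps)
qed

lemma sum_edge_weights:
  assumes "nnpath N x n"
  shows "(\<Sum>v\<in>nbrs (gw_tree N) (x n). edge_weight \<Delta> x n {x n, v}) = 2 * \<Delta> * urn_total x n (x n)"
proof -
  let ?u = "x n"
  have ch: "(\<Sum>v\<in>(\<lambda>i. ?u @ [i]) ` {..<N ?u}. edge_weight \<Delta> x n {?u, v}) =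
      2 * \<Delta> * (real (N ?u) * a + real (\<Sum>j<N ?u. child_cnt x n ?u j))"
    by (subst sum.reindex) (auto simp: inj_on_def edge_weight_child[OF assms] sum_distrib_left[symmetric] sum.distrib)
  have nb: "nbrs (gw_tree N) ?u = (\<lambda>i. ?u @ [i]) ` {..<N ?u} \<union> (if ?u = [] then {} else {butlast ?u})"
    by (rule nbrs_gw_tree[OF nnpath_mem[OF assms]])
  show ?thesis
  proof (cases "?u = []")
    case True
    then show ?thesis using ch nb by (simp add: urn_total_def par_base_def par_cnt_def)
  next
    case False
    have "butlast ?u \<notin> (\<lambda>i. ?u @ [i]) ` {..<N ?u}" by auto
    moreover have "nbrs (gw_tree N) ?u = insert (butlast ?u) ((\<lambda>i. ?u @ [i]) ` {..<N ?u})" using nb False by simp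
    ultimately have "(\<Sum>v\<in>nbrs (gw_tree N) ?u. edge_weight \<Delta> x n {?u, v}) =
        edge_weight \<Delta> x n {?u, butlast ?u} + (\<Sum>v\<in>(\<lambda>i. ?u @ [i]) ` {..<N ?u}. edge_weight \<Delta> x n {?u, v})"
      by simp
    then show ?thesis using ch edge_weight_parent[OF assms False] False
      by (simp add: urn_total_def algebra_simps)
  qed
qed

lemma pmf_step_child:
  assumes "nnpath N x n" "i < N (x n)"
  shows "pmf (errw_step (gw_tree N) \<Delta> n x) (x n @ [i]) = (a + child_cnt x n (x n) i) / urn_total x n (x n)"
proof -
  have "x n @ [i] \<in> nbrs (gw_tree N) (x n)"
    using assms by (simp add: nbrs_gw_tree[OF nnpath_mem[OF assms(1)]])
  from pmf_errw_step[where T = "gw_tree N" and X = x and n = n, OF Delta finite_nbrs_gw_tree this]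
  show ?thesis using Delta by (simp add: sum_edge_weights[OF assms(1)] edge_weight_child[OF assms(1)])
qed

lemma pmf_step_parent:
  assumes "nnpath N x n" "x n \<noteq> []"
  shows "pmf (errw_step (gw_tree N) \<Delta> n x) (butlast (x n)) = (par_base a (x n) + par_cnt x n (x n)) / urn_total x n (x n)"
proof -
  have "butlast (x n) \<in> nbrs (gw_tree N) (x n)"
    using assms by (simp add: nbrs_gw_tree[OF nnpath_mem[OF assms(1)]])
  from pmf_errw_step[where T = "gw_tree N" and X = x and n = n, OF Delta finite_nbrs_gw_tree this]
  show ?thesis using Delta by (simp add: sum_edge_weights[OF assms(1)] edge_weight_parent[OF assms])
qed

lemma cnt_step_cases:
  assumes "nnpath N x (Suc n)"
  obtains (child) k where "k < N (x n)" "x (Suc n) = x n @ [k]"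
      "child_cnt x (Suc n) (x n) = (child_cnt x n (x n))(k := Suc (child_cnt x n (x n) k))"
      "par_cnt x (Suc n) (x n) = par_cnt x n (x n)"
      "\<And>e. pr N e (x n) (x (Suc n)) = pc (N (x n)) (bt (x n) (e (x n))) k"
    | (parent) "x n \<noteq> []" "x (Suc n) = butlast (x n)"
      "child_cnt x (Suc n) (x n) = child_cnt x n (x n)"
      "par_cnt x (Suc n) (x n) = Suc (par_cnt x n (x n))"
      "\<And>e. pr N e (x n) (x (Suc n)) = pp (N (x n)) (bt (x n) (e (x n)))"
proof -
  let ?u = "x n"
  from assms have nb: "x (Suc n) \<in> nbrs (gw_tree N) ?u" and mem: "?u \<in> gw_tree N"
    by (auto simp: nnpath_Suc nnpath_mem)
  from nb consider k where "k < N ?u" "x (Suc n) = ?u @ [k]" | "?u \<noteq> []" "x (Suc n) = butlast ?u"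
    unfolding nbrs_gw_tree[OF mem] by (auto split: if_splits)
  then show thesis
  proof cases
    case 1
    show thesis
      by (rule child[OF 1]) (use 1 in \<open>auto simp: child_cnt_def par_cnt_def pr_def fun_eq_iff\<close>)
  next
    case 2
    show thesis
      by (rule parent[OF 2]) (use 2 in \<open>auto simp: child_cnt_def par_cnt_def pr_def fun_eq_iff\<close>)
  qed
qed

lemma cnt_step_other:
  assumes "u \<noteq> x n"
  shows "child_cnt x (Suc n) u = child_cnt x n u" "par_cnt x (Suc n) u = par_cnt x n u"
  using assms by (auto simp: child_cnt_def par_cnt_def fun_eq_iff)

lemma urn_total_pos:
  assumes "nnpath N x (Suc n)"
  shows "urn_total x n (x n) > 0"
  using assms
proof (cases rule: cnt_step_cases)
  case (child k)
  then have "real (N (x n)) * a > 0" using a_pos by simp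
  moreover have "par_base a (x n) \<ge> 0" using a_pos by (simp add: par_base_def)
  moreover have "0 \<le> real (par_cnt x n (x n))" "0 \<le> real (\<Sum>j<N (x n). child_cnt x n (x n) j)"
    by (rule of_nat_0_le_iff)+
  ultimately show ?thesis unfolding urn_total_def by linarith
next
  case parent
  then have "par_base a (x n) > 0" using a_pos by (simp add: par_base_def)
  moreover have "0 \<le> real (par_cnt x n (x n))" "0 \<le> real (\<Sum>j<N (x n). child_cnt x n (x n) j)"
    by (rule of_nat_0_le_iff)+
  moreover have "0 \<le> real (N (x n)) * a" using a_pos by simp
  ultimately show ?thesis unfolding urn_total_def by linarith
qed

lemma cnt_0: "child_cnt x 0 u i = 0" "par_cnt x 0 u = 0"
  by (simp_all add: child_cnt_def par_cnt_def)

text \<open>A step changes the counts of the departed vertex only, and there the ratio of the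
  moments is the step probability. \<open>F\<close> may be any finite set containing the departed
  vertices and stays fixed during the induction.\<close>

lemma measure_path:
  assumes "finite F"
  shows "nnpath N x n \<Longrightarrow> x ` {..<n} \<subseteq> F \<Longrightarrow>
    measure (errw (gw_tree N) \<Delta>) {X. \<forall>i\<le>n. X i = x i} =
    (\<Prod>u\<in>F. urn_moment (stick_mom a u) (N u) (par_cnt x n u) (child_cnt x n u))"
proof (induction n)
  case 0
  have "urn_moment (stick_mom a u) (N u) (par_cnt x 0 u) (child_cnt x 0 u) = 1" for u
    by (simp add: urn_moment_def cnt_0 stick_mom_0 a_pos)
  then show ?case using 0 by (simp add: measure_errw_0 nnpath_def)
next
  case (Suc n)
  let ?u = "x n"
  let ?U = "\<lambda>n u. urn_moment (stick_mom a u) (N u) (par_cnt x n u) (child_cnt x n u)"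
  have path: "nnpath N x n" using Suc.prems by (simp add: nnpath_Suc)
  have u: "?u \<in> F" using Suc.prems by auto
  note R1 = stick_mom_Suc1[OF a_pos] and R2 = stick_mom_Suc2[OF a_pos]
  note tot = urn_total_pos[OF Suc.prems(1)]
  have step: "?U (Suc n) ?u = ?U n ?u * pmf (errw_step (gw_tree N) \<Delta> n x) (x (Suc n))"
    using Suc.prems(1)
  proof (cases rule: cnt_step_cases)
    case (child k)
    have "?U (Suc n) ?u * urn_total x n ?u = ?U n ?u * (a + child_cnt x n ?u k)"
      unfolding child(3,4) urn_total_def
      by (rule urn_moment_child[OF R1 R2 child(1)])
    then show ?thesis using tot child(1,2) by (simp add: pmf_step_child[OF path] field_simps)
  next
    case parent
    have "?U (Suc n) ?u * urn_total x n ?u = ?U n ?u * (par_base a ?u + par_cnt x n ?u)"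
      unfolding parent(3,4) urn_total_def
      by (rule urn_moment_parent[OF R1 R2])
    then show ?thesis using tot parent(1,2) by (simp add: pmf_step_parent[OF path] field_simps)
  qed
  have "(\<Prod>u\<in>F. ?U (Suc n) u) = ?U (Suc n) ?u * (\<Prod>u\<in>F - {?u}. ?U (Suc n) u)"
    using assms u by (rule prod.remove)
  also have "(\<Prod>u\<in>F - {?u}. ?U (Suc n) u) = (\<Prod>u\<in>F - {?u}. ?U n u)"
    by (intro prod.cong refl) (simp add: cnt_step_other)
  also have "?U (Suc n) ?u * (\<Prod>u\<in>F - {?u}. ?U n u) = (\<Prod>u\<in>F. ?U n u) * pmf (errw_step (gw_tree N) \<Delta> n x) (x (Suc n))"
    using assms u by (simp add: step prod.remove[of F ?u])
  also have "\<dots> = measure (errw (gw_tree N) \<Delta>) {X. \<forall>i\<le>Suc n. X i = x i}"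
    using Suc.IH[OF path] Suc.prems by (simp add: measure_errw_Suc lessThan_Suc)
  finally show ?case by simp
qed

lemma env_path_weight:
  assumes "finite F"
  shows "nnpath N x n \<Longrightarrow> x ` {..<n} \<subseteq> F \<Longrightarrow>
    (\<Prod>i<n. pr N e (x i) (x (Suc i))) = (\<Prod>u\<in>F. urn_mono (N u) (par_cnt x n u) (child_cnt x n u) (bt u (e u)))"
proof (induction n)
  case 0
  then show ?case by (simp add: urn_mono_def cnt_0)
next
  case (Suc n)
  let ?u = "x n"
  let ?U = "\<lambda>n u. urn_mono (N u) (par_cnt x n u) (child_cnt x n u) (bt u (e u))"
  have path: "nnpath N x n" using Suc.prems by (simp add: nnpath_Suc)
  have u: "?u \<in> F" using Suc.prems by auto
  have step: "?U (Suc n) ?u = ?U n ?u * pr N e ?u (x (Suc n))"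
    using Suc.prems(1)
  proof (cases rule: cnt_step_cases)
    case (child k)
    have "(\<Prod>i<N ?u. pc (N ?u) b i ^ (c(k := Suc (c k))) i) = pc (N ?u) b k * (\<Prod>i<N ?u. pc (N ?u) b i ^ c i)" for b c
      using child(1) by (subst (1 2) prod.remove[of "{..<N ?u}" k]) (auto intro!: prod.cong)
    then show ?thesis unfolding child(3-5) urn_mono_def by simp
  next
    case parent
    show ?thesis unfolding parent(3-5) urn_mono_def by simp
  qed
  have "(\<Prod>u\<in>F. ?U (Suc n) u) = ?U (Suc n) ?u * (\<Prod>u\<in>F - {?u}. ?U (Suc n) u)"
    using assms u by (rule prod.remove)
  also have "(\<Prod>u\<in>F - {?u}. ?U (Suc n) u) = (\<Prod>u\<in>F - {?u}. ?U n u)"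
    by (intro prod.cong refl) (simp add: cnt_step_other)
  also have "?U (Suc n) ?u * (\<Prod>u\<in>F - {?u}. ?U n u) = (\<Prod>u\<in>F. ?U n u) * pr N e ?u (x (Suc n))"
    using assms u by (simp add: step prod.remove[of F ?u])
  also have "\<dots> = (\<Prod>i<Suc n. pr N e (x i) (x (Suc i)))"
    using Suc.IH[OF path] Suc.prems by (simp add: lessThan_Suc)
  finally show ?case by simp
qed

text \<open>Averaged over the environment, the weight of a path factorises over the departed
  vertices by independence, and each factor is the urn moment found in
  \<open>measure_path\<close>.\<close>

theorem emeasure_path_eq_nn_integral:
  assumes path: "nnpath N x n"
  shows "emeasure (errw (gw_tree N) \<Delta>) {X. \<forall>i\<le>n. X i = x i} =
    (\<integral>\<^sup>+e. ennreal (\<Prod>i<n. pr N e (x i) (x (Suc i))) \<partial>env a)"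
proof -
  interpret prob_space "errw (gw_tree N) \<Delta>" by (rule prob_space_errw)
  let ?F = "x ` {..<n}"
  let ?U = "\<lambda>u. urn_moment (stick_mom a u) (N u) (par_cnt x n u) (child_cnt x n u)"
  have U0: "0 \<le> ?U u" for u
    unfolding urn_moment_def by (intro prod_nonneg ballI stick_mom_nonneg a_pos)
  have "(\<integral>\<^sup>+e. ennreal (\<Prod>i<n. pr N e (x i) (x (Suc i))) \<partial>env a) =
      (\<integral>\<^sup>+e. (\<Prod>u\<in>?F. ennreal (urn_mono (N u) (par_cnt x n u) (child_cnt x n u) (bt u (e u)))) \<partial>env a)"
    by (intro nn_integral_cong) (simp add: env_path_weight[OF _ path subset_refl] prod_ennreal urn_mono_nonneg)
  also have "\<dots> = (\<Prod>u\<in>?F. \<integral>\<^sup>+\<beta>. ennreal (urn_mono (N u) (par_cnt x n u) (child_cnt x n u) (bt u \<beta>)) \<partial>env_sticks a u)"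
    unfolding env_def by (rule nn_integral_PiM_prod[OF prob_space_env_sticks[OF a_pos]]) (simp, measurable)
  also have "\<dots> = (\<Prod>u\<in>?F. ennreal (?U u))" by (simp only: nn_integral_urn_mono[OF a_pos])
  also have "\<dots> = ennreal (\<Prod>u\<in>?F. ?U u)" by (intro prod_ennreal U0)
  also have "\<dots> = ennreal (measure (errw (gw_tree N) \<Delta>) {X. \<forall>i\<le>n. X i = x i})"
    by (simp only: measure_path[OF finite_imageI[OF finite_lessThan] path subset_refl])
  finally show ?thesis by (simp add: emeasure_eq_measure)
qed

end

section \<open>Excursions\<close>

text \<open>Sums over sets of words, written as integrals over counting measure so that exchange
  with other integrals and monotone limits come from measure theory.\<close>

definition esum :: "('c \<Rightarrow> ennreal) \<Rightarrow> 'c set \<Rightarrow> ennreal" where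
  "esum f A = (\<integral>\<^sup>+x. f x \<partial>count_space A)"

lemma esum_cong: "(\<And>x. x \<in> A \<Longrightarrow> f x = g x) \<Longrightarrow> esum f A = esum g A"
  unfolding esum_def by (rule nn_integral_cong) simp

lemma esum_mono: "(\<And>x. x \<in> A \<Longrightarrow> f x \<le> g x) \<Longrightarrow> esum f A \<le> esum g A"
  unfolding esum_def by (rule nn_integral_mono) simp

lemma esum_cmult: "esum (\<lambda>x. c * f x) A = c * esum f A"
  unfolding esum_def by (rule nn_integral_cmult) simp

lemma esum_multc: "esum (\<lambda>x. f x * c) A = esum f A * c"
  unfolding esum_def by (rule nn_integral_multc) simp

lemma esum_add: "esum (\<lambda>x. f x + g x) A = esum f A + esum g A"
  unfolding esum_def by (rule nn_integral_add) simp_all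

lemma esum_finite: "finite A \<Longrightarrow> esum f A = (\<Sum>x\<in>A. f x)"
  unfolding esum_def by (rule nn_integral_count_space_finite)

lemma esum_image: "inj_on h A \<Longrightarrow> esum f (h ` A) = esum (\<lambda>x. f (h x)) A"
  unfolding esum_def by (rule nn_integral_bij_count_space[symmetric]) (auto simp: bij_betw_def)

lemma esum_indicator: "esum f A = (\<integral>\<^sup>+x. f x * indicator A x \<partial>count_space UNIV)"
proof -
  have "(\<integral>\<^sup>+x. f x \<partial>count_space A) = (\<integral>\<^sup>+x. f x \<partial>restrict_space (count_space UNIV) A)"
    by (simp add: restrict_count_space)
  also have "\<dots> = (\<integral>\<^sup>+x. f x * indicator A x \<partial>count_space UNIV)"
    by (rule nn_integral_restrict_space) simp
  finally show ?thesis by (simp add: esum_def)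
qed

lemma esum_UN:
  assumes "countable I" and disj: "disjoint_family_on A I"
  shows "esum f (\<Union>i\<in>I. A i) = esum (\<lambda>i. esum f (A i)) I"
proof -
  have "f x * indicator (\<Union>i\<in>I. A i) x = (\<integral>\<^sup>+i. f x * indicator (A i) x \<partial>count_space I)" for x
  proof (cases "x \<in> (\<Union>i\<in>I. A i)")
    case True
    then obtain i0 where i0: "i0 \<in> I" "x \<in> A i0" by auto
    have "(\<integral>\<^sup>+i. f x * indicator (A i) x \<partial>count_space I) = (\<integral>\<^sup>+i. f x * indicator {i0} i \<partial>count_space I)"
      using i0 disj by (intro nn_integral_cong) (auto simp: indicator_def disjoint_family_on_def)
    also have "\<dots> = f x" using i0 by (subst nn_integral_cmult_indicator) auto
    finally show ?thesis using True by simp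
  next
    case False
    then have "(\<integral>\<^sup>+i. f x * indicator (A i) x \<partial>count_space I) = (\<integral>\<^sup>+i. 0 \<partial>count_space I)"
      by (intro nn_integral_cong) (auto simp: indicator_def)
    then show ?thesis using False by simp
  qed
  then have "esum f (\<Union>i\<in>I. A i) = (\<integral>\<^sup>+x. \<integral>\<^sup>+i. f x * indicator (A i) x \<partial>count_space I \<partial>count_space UNIV)"
    unfolding esum_indicator[of f] by simp
  also have "\<dots> = (\<integral>\<^sup>+i. \<integral>\<^sup>+x. f x * indicator (A i) x \<partial>count_space UNIV \<partial>count_space I)"
    by (rule nn_integral_count_space_nn_integral[OF assms(1)]) simp
  finally show ?thesis unfolding esum_indicator[of f] by (simp add: esum_def)
qed

lemma esum_Times:
  assumes "countable A"
  shows "esum f (A \<times> B) = esum (\<lambda>a. esum (\<lambda>b. f (a, b)) B) A"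
proof -
  have "A \<times> B = (\<Union>a\<in>A. Pair a ` B)" by auto
  moreover have "esum f (\<Union>a\<in>A. Pair a ` B) = esum (\<lambda>a. esum f (Pair a ` B)) A"
    by (rule esum_UN[OF assms]) (auto simp: disjoint_family_on_def)
  ultimately show ?thesis by (simp add: esum_image inj_on_def)
qed

lemma esum_incseq:
  assumes "incseq A"
  shows "esum f (\<Union>n. A n) = (SUP n. esum f (A n))"
proof -
  have "(\<integral>\<^sup>+x. (SUP n. f x * indicator (A n) x) \<partial>count_space UNIV) = (SUP n. \<integral>\<^sup>+x. f x * indicator (A n) x \<partial>count_space UNIV)"
  proof (rule nn_integral_monotone_convergence_SUP)
    show "incseq (\<lambda>n x. f x * indicator (A n) x)"
      using assms by (auto simp: incseq_def le_fun_def indicator_def)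
  qed simp
  moreover have "(SUP n. f x * indicator (A n) x) = f x * indicator (\<Union>n. A n) x" for x
  proof (cases "x \<in> (\<Union>n. A n)")
    case True
    then obtain n where n: "x \<in> A n" by auto
    have "(SUP n. f x * indicator (A n) x) = f x"
    proof (rule antisym)
      show "(SUP n. f x * indicator (A n) x) \<le> f x" by (rule SUP_least) (simp add: indicator_def)
      show "f x \<le> (SUP n. f x * indicator (A n) x)" using n by (intro SUP_upper2[of n]) auto
    qed
    then show ?thesis using True by simp
  qed simp
  ultimately show ?thesis unfolding esum_indicator by simp
qed

lemma esum_nat: "esum f UNIV = (\<Sum>n. f n)" for f :: "nat \<Rightarrow> ennreal"
  unfolding esum_def by (rule nn_integral_count_space_nat)

text \<open>\<open>exc N n j u\<close> consists of the walks from \<open>u\<close> to \<open>u\<close> that stay in the subtree of \<open>u\<close>, return to \<open>u\<close>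
  exactly \<open>j\<close> times and reach less than \<open>n\<close> generations below \<open>u\<close>. Such a walk is cut at its first
  return to \<open>u\<close>.\<close>

fun exc :: "(vertex \<Rightarrow> nat) \<Rightarrow> nat \<Rightarrow> nat \<Rightarrow> vertex \<Rightarrow> vertex list set" where
  "exc N 0 j u = {}"
| "exc N (Suc n) 0 u = {[u]}"
| "exc N (Suc n) (Suc j) u = (\<Union>i<N u. (\<lambda>(p, q). u # p @ q) ` ((\<Union>j'. exc N n j' (u @ [i])) \<times> exc N (Suc n) j u))"

lemma exc_props:
  "p \<in> exc N n j u \<Longrightarrow> p \<noteq> [] \<and> hd p = u \<and> last p = u \<and> count_list p u = Suc j \<and> (\<forall>v\<in>set p. prefix u v)"
proof (induction N n j u arbitrary: p rule: exc.induct)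
  case (3 N n j u)
  from 3(3) obtain i j' p' q where i: "i < N u" "p' \<in> exc N n j' (u @ [i])" "q \<in> exc N (Suc n) j u" "p = u # p' @ q"
    by auto
  have p': "\<forall>v\<in>set p'. prefix (u @ [i]) v" using 3(1)[OF _ UNIV_I i(2)] i(1) by auto
  have q: "q \<noteq> []" "last q = u" "count_list q u = Suc j" "\<forall>v\<in>set q. prefix u v" using 3(2)[OF _ i(3)] i(1) by auto
  have "u \<notin> set p'" using p' by (auto dest: prefix_length_le)
  then have "count_list p' u = 0" by (simp add: count_list_0_iff)
  moreover have "\<forall>v\<in>set p'. prefix u v" using p' by (meson append_prefixD)
  ultimately show ?case using q i(4) by auto
qed auto

lemma exc_SucI:
  assumes "i < N u" "p \<in> exc N n j' (u @ [i])" "q \<in> exc N (Suc n) j u"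
  shows "u # p @ q \<in> exc N (Suc n) (Suc j) u"
  unfolding exc.simps(3) using assms by (intro UN_I[of i] image_eqI[of _ _ "(p, q)"]) auto

lemma exc_mono_Suc: "exc N n j u \<subseteq> exc N (Suc n) j u"
proof (induction N n j u rule: exc.induct)
  case (3 N n j u)
  show ?case
  proof
    fix r assume "r \<in> exc N (Suc n) (Suc j) u"
    then obtain i j' p q where i: "i < N u" "p \<in> exc N n j' (u @ [i])" "q \<in> exc N (Suc n) j u" "r = u # p @ q"
      by auto
    have "p \<in> exc N (Suc n) j' (u @ [i])" "q \<in> exc N (Suc (Suc n)) j u"
      using 3(1)[of i j'] 3(2)[of i] i by auto
    with i show "r \<in> exc N (Suc (Suc n)) (Suc j) u"
      by (simp only: exc_SucI)
  qed
qed auto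

lemma exc_mono: "m \<le> n \<Longrightarrow> exc N m j u \<subseteq> exc N n j u"
  by (rule lift_Suc_mono_le[of "\<lambda>n. exc N n j u"]) (rule exc_mono_Suc)

definition excU :: "(vertex \<Rightarrow> nat) \<Rightarrow> nat \<Rightarrow> vertex \<Rightarrow> vertex list set" where
  "excU N j u = (\<Union>n. exc N n j u)"

definition excs :: "(vertex \<Rightarrow> nat) \<Rightarrow> nat \<Rightarrow> vertex \<Rightarrow> vertex list set" where
  "excs N n u = (\<Union>j. exc N n j u)"

definition excsU :: "(vertex \<Rightarrow> nat) \<Rightarrow> vertex \<Rightarrow> vertex list set" where
  "excsU N u = (\<Union>j. excU N j u)"

lemma excU_0: "excU N 0 u = {[u]}"
proof -
  have "exc N n 0 u \<subseteq> {[u]}" for n by (cases n) auto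
  moreover have "[u] \<in> exc N (Suc 0) 0 u" by simp
  ultimately show ?thesis unfolding excU_def by blast
qed

lemma excU_Suc: "excU N (Suc j) u = (\<Union>i<N u. (\<lambda>(p, q). u # p @ q) ` (excsU N (u @ [i]) \<times> excU N j u))"
proof
  show "excU N (Suc j) u \<subseteq> (\<Union>i<N u. (\<lambda>(p, q). u # p @ q) ` (excsU N (u @ [i]) \<times> excU N j u))"
  proof
    fix r assume "r \<in> excU N (Suc j) u"
    then obtain n where n: "r \<in> exc N n (Suc j) u" by (auto simp: excU_def)
    then obtain m where "n = Suc m" by (cases n) auto
    with n show "r \<in> (\<Union>i<N u. (\<lambda>(p, q). u # p @ q) ` (excsU N (u @ [i]) \<times> excU N j u))"
      unfolding excsU_def excU_def by fastforce
  qed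
  show "(\<Union>i<N u. (\<lambda>(p, q). u # p @ q) ` (excsU N (u @ [i]) \<times> excU N j u)) \<subseteq> excU N (Suc j) u"
  proof
    fix r assume "r \<in> (\<Union>i<N u. (\<lambda>(p, q). u # p @ q) ` (excsU N (u @ [i]) \<times> excU N j u))"
    then obtain i p q j' n m where *: "i < N u" "r = u # p @ q" "p \<in> exc N n j' (u @ [i])" "q \<in> exc N m j u"
      by (auto simp: excsU_def excU_def)
    have "n \<le> max n m" "m \<le> Suc (max n m)" by linarith+
    then have "p \<in> exc N (max n m) j' (u @ [i])" "q \<in> exc N (Suc (max n m)) j u"
      using *(3,4) exc_mono[of n "max n m" N j'] exc_mono[of m "Suc (max n m)" N j] by auto
    then have "r \<in> exc N (Suc (max n m)) (Suc j) u" using *(1,2) by (simp only: exc_SucI)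
    then show "r \<in> excU N (Suc j) u" unfolding excU_def by blast
  qed
qed

lemma incseq_exc: "incseq (\<lambda>n. exc N n j u)"
  by (rule incseq_SucI) (rule exc_mono_Suc)

lemma exc_index_unique: "p \<in> exc N n j u \<Longrightarrow> p \<in> exc N n' j' u \<Longrightarrow> j = j'"
  using exc_props by (metis nat.inject)

lemma disjoint_exc: "disjoint_family_on (\<lambda>j. exc N n j u) UNIV" "disjoint_family_on (\<lambda>j. excU N j u) UNIV"
proof -
  show "disjoint_family_on (\<lambda>j. exc N n j u) UNIV"
    unfolding disjoint_family_on_def using exc_index_unique by blast
  show "disjoint_family_on (\<lambda>j. excU N j u) UNIV"
    unfolding disjoint_family_on_def excU_def using exc_index_unique by blast
qed

lemma takeWhile_neq_append: "u \<notin> set p \<Longrightarrow> q \<noteq> [] \<Longrightarrow> hd q = u \<Longrightarrow> takeWhile (\<lambda>v. v \<noteq> u) (p @ q) = p"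
  by (induction p) (cases q; auto)+

text \<open>The concatenation is injective: \<open>p\<close> is recovered as the part between the
  initial \<open>u\<close> and the next one, because words in \<open>P i\<close> stay strictly below
  \<open>u\<close>; the head of \<open>p\<close> recovers \<open>i\<close>.\<close>

lemma esum_first_return:
  fixes P :: "nat \<Rightarrow> vertex list set"
  assumes P: "\<And>i p v. p \<in> P i \<Longrightarrow> p \<noteq> [] \<and> hd p = u @ [i] \<and> (\<forall>v\<in>set p. prefix (u @ [i]) v)"
    and Q: "\<And>q. q \<in> Q \<Longrightarrow> q \<noteq> [] \<and> hd q = u"
  shows "esum f (\<Union>i<N. (\<lambda>(p, q). u # p @ q) ` (P i \<times> Q)) = (\<Sum>i<N. esum (\<lambda>p. esum (\<lambda>q. f (u # p @ q)) Q) (P i))"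
proof -
  have nu: "u \<notin> set p" if "p \<in> P i" for p i using P[OF that] by (auto dest: prefix_length_le)
  have eq: "p = p' \<and> q = q'" if "p @ q = p' @ q'" "p \<in> P i" "p' \<in> P i'" "q \<in> Q" "q' \<in> Q" for p q p' q' i i'
  proof -
    have "takeWhile (\<lambda>v. v \<noteq> u) (p @ q) = p" "takeWhile (\<lambda>v. v \<noteq> u) (p' @ q') = p'"
      using nu[OF that(2)] nu[OF that(3)] Q[OF that(4)] Q[OF that(5)] by (auto intro!: takeWhile_neq_append)
    then show ?thesis using that(1) by auto
  qed
  have "esum f (\<Union>i<N. (\<lambda>(p, q). u # p @ q) ` (P i \<times> Q)) = esum (\<lambda>i. esum f ((\<lambda>(p, q). u # p @ q) ` (P i \<times> Q))) {..<N}"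
  proof (rule esum_UN)
    show "disjoint_family_on (\<lambda>i. (\<lambda>(p, q). u # p @ q) ` (P i \<times> Q)) {..<N}"
      unfolding disjoint_family_on_def
    proof (intro ballI impI)
      fix i i' :: nat assume "i \<noteq> i'"
      show "(\<lambda>(p, q). u # p @ q) ` (P i \<times> Q) \<inter> (\<lambda>(p, q). u # p @ q) ` (P i' \<times> Q) = {}"
      proof (rule ccontr)
        assume "\<not> ?thesis"
        then obtain p q p' q' where "p @ q = p' @ q'" "p \<in> P i" "p' \<in> P i'" "q \<in> Q" "q' \<in> Q" by auto
        with eq have "p = p'" by blast
        with P[OF \<open>p \<in> P i\<close>] P[OF \<open>p' \<in> P i'\<close>] \<open>i \<noteq> i'\<close> show False by auto
      qed
    qed
  qed simp
  also have "\<dots> = (\<Sum>i<N. esum f ((\<lambda>(p, q). u # p @ q) ` (P i \<times> Q)))" by (rule esum_finite) simp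
  also have "\<dots> = (\<Sum>i<N. esum (\<lambda>p. esum (\<lambda>q. f (u # p @ q)) Q) (P i))"
  proof (intro sum.cong refl)
    fix i
    have inj: "inj_on (\<lambda>(p, q). u # p @ q) (P i \<times> Q)"
    proof (rule inj_onI)
      fix x y assume x: "x \<in> P i \<times> Q" "y \<in> P i \<times> Q" and xy: "(\<lambda>(p, q). u # p @ q) x = (\<lambda>(p, q). u # p @ q) y"
      then have "fst x @ snd x = fst y @ snd y" by (simp add: case_prod_beta)
      moreover have "fst x \<in> P i" "fst y \<in> P i" "snd x \<in> Q" "snd y \<in> Q" using x by auto
      ultimately have "fst x = fst y \<and> snd x = snd y" by (rule eq)
      then show "x = y" by (simp add: prod_eq_iff)
    qed
    show "esum f ((\<lambda>(p, q). u # p @ q) ` (P i \<times> Q)) = esum (\<lambda>p. esum (\<lambda>q. f (u # p @ q)) Q) (P i)"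
      by (simp only: esum_image[OF inj] esum_Times[OF countableI_type] prod.case)
  qed
  finally show ?thesis .
qed

lemma excs_props:
  "p \<in> excs N n u \<Longrightarrow> p \<noteq> [] \<and> hd p = u \<and> last p = u \<and> (\<forall>v\<in>set p. prefix u v)"
  "p \<in> excsU N u \<Longrightarrow> p \<noteq> [] \<and> hd p = u \<and> last p = u \<and> (\<forall>v\<in>set p. prefix u v)"
  "p \<in> excU N j u \<Longrightarrow> p \<noteq> [] \<and> hd p = u \<and> last p = u \<and> count_list p u = Suc j \<and> (\<forall>v\<in>set p. prefix u v)"
  unfolding excs_def excsU_def excU_def by (auto dest: exc_props)

lemma esum_exc_Suc:
  "esum f (exc N (Suc n) (Suc j) u) = (\<Sum>i<N u. esum (\<lambda>p. esum (\<lambda>q. f (u # p @ q)) (exc N (Suc n) j u)) (excs N n (u @ [i])))"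
  unfolding exc.simps(3) excs_def[symmetric]
  by (rule esum_first_return) (auto dest: excs_props(1) exc_props)

lemma esum_excU_Suc:
  "esum f (excU N (Suc j) u) = (\<Sum>i<N u. esum (\<lambda>p. esum (\<lambda>q. f (u # p @ q)) (excU N j u)) (excsU N (u @ [i])))"
  unfolding excU_Suc
  by (rule esum_first_return) (auto dest: excs_props)

section \<open>Weights of excursions in a fixed environment\<close>

fun lw :: "(vertex \<Rightarrow> nat) \<Rightarrow> (vertex \<Rightarrow> nat \<Rightarrow> real) \<Rightarrow> vertex list \<Rightarrow> real" where
  "lw N e (x # y # r) = pr N e x y * lw N e (y # r)"
| "lw N e r = 1"

lemma lw_append: "p \<noteq> [] \<Longrightarrow> q \<noteq> [] \<Longrightarrow> lw N e (p @ q) = lw N e p * pr N e (last p) (hd q) * lw N e q"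
proof (induction N e p rule: lw.induct)
  case ("2_2" N e v)
  then show ?case by (cases q) auto
qed auto

lemma lw_Cons: "p \<noteq> [] \<Longrightarrow> lw N e (u # p) = pr N e u (hd p) * lw N e p"
  by (cases p) auto

lemma lw_eq_prod: "lw N e p = (\<Prod>i<length p - 1. pr N e (p ! i) (p ! Suc i))"
proof (induction N e p rule: lw.induct)
  case (1 N e x y r)
  have "length (x # y # r) - 1 = Suc (length (y # r) - 1)" by simp
  then show ?case using 1 by (simp only: prod.lessThan_Suc_shift) simp
qed auto

lemma pr_child: "pr N e u (u @ [i]) = pc (N u) (bt u (e u)) i"
  by (auto simp: pr_def)

lemma pr_parent: "pr N e (u @ [i]) u = pp (N (u @ [i])) (bt (u @ [i]) (e (u @ [i])))"
  by (auto simp: pr_def)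

lemma pp_nonneg: "0 \<le> pp d (bt u \<beta>)" and pp_pos: "u \<noteq> [] \<Longrightarrow> 0 < pp d (bt u \<beta>)"
  and pc_pos: "i < d \<Longrightarrow> 0 < pc d (bt u \<beta>) i"
proof -
  show "0 \<le> pp d (bt u \<beta>)" unfolding pp_def using bt_bounds(2) by (intro prod_nonneg) auto
  show "0 < pp d (bt u \<beta>)" if "u \<noteq> []" unfolding pp_def using that clip01_bounds by (intro prod_pos) (auto simp: bt_def)
  have "0 < (\<Prod>j\<in>{i<..<d}. 1 - bt u \<beta> j)" using clip01_bounds by (intro prod_pos) (auto simp: bt_def)
  then show "0 < pc d (bt u \<beta>) i" if "i < d" unfolding pc_def using bt_bounds(1)[of u \<beta> i] by simp
qed

lemma pc_nonneg: "0 \<le> pc d (bt u \<beta>) i"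
  unfolding pc_def using bt_bounds by (intro mult_nonneg_nonneg prod_nonneg) (auto intro: less_imp_le)

lemma pr_nonneg: "0 \<le> pr N e u v"
  by (auto simp: pr_def pp_nonneg pc_nonneg)

lemma lw_nonneg: "0 \<le> lw N e p"
  by (induction N e p rule: lw.induct) (auto simp: pr_nonneg)

lemma lw_excursion:
  assumes "p \<noteq> []" "hd p = u @ [i]" "last p = u @ [i]" "q \<noteq> []" "hd q = u"
  shows "ennreal (lw N e (u # p @ q)) = ennreal (pc (N u) (bt u (e u)) i) *
    (ennreal (lw N e p) * ennreal (pp (N (u @ [i])) (bt (u @ [i]) (e (u @ [i]))))) * ennreal (lw N e q)"
proof -
  have "lw N e (u # p @ q) = pc (N u) (bt u (e u)) i * (lw N e p * pp (N (u @ [i])) (bt (u @ [i]) (e (u @ [i])))) * lw N e q"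
    using assms by (simp add: lw_Cons lw_append pr_child pr_parent)
  then show ?thesis by (simp add: ennreal_mult lw_nonneg pp_nonneg pc_nonneg)
qed

text \<open>For \<open>v\<close> other than the root, the probability of stepping to the parent
  before reaching generation \<open>n\<close> below \<open>v\<close>; the denominator sums the
  geometric series over the returns to \<open>v\<close>.\<close>

primrec xx :: "(vertex \<Rightarrow> nat) \<Rightarrow> (vertex \<Rightarrow> nat \<Rightarrow> real) \<Rightarrow> nat \<Rightarrow> vertex \<Rightarrow> real" where
  "xx N e 0 = (\<lambda>v. 0)"
| "xx N e (Suc n) = (\<lambda>v. pp (N v) (bt v (e v)) / (1 - (\<Sum>i<N v. pc (N v) (bt v (e v)) i * xx N e n (v @ [i]))))"

definition ss :: "(vertex \<Rightarrow> nat) \<Rightarrow> (vertex \<Rightarrow> nat \<Rightarrow> real) \<Rightarrow> nat \<Rightarrow> vertex \<Rightarrow> real" where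
  "ss N e n v = (\<Sum>i<N v. pc (N v) (bt v (e v)) i * xx N e n (v @ [i]))"

lemma ss_le:
  assumes "\<And>i. 0 \<le> xx N e n (v @ [i]) \<and> xx N e n (v @ [i]) \<le> 1"
  shows "0 \<le> ss N e n v" "ss N e n v \<le> 1 - pp (N v) (bt v (e v))"
proof -
  show "0 \<le> ss N e n v" unfolding ss_def using assms by (intro sum_nonneg mult_nonneg_nonneg pc_nonneg) auto
  have "ss N e n v \<le> (\<Sum>i<N v. pc (N v) (bt v (e v)) i)"
    unfolding ss_def using assms by (intro sum_mono mult_left_le) (auto simp: pc_nonneg)
  then show "ss N e n v \<le> 1 - pp (N v) (bt v (e v))" using pp_plus_pc[of "N v" "bt v (e v)"] by linarith
qed

lemma xx_bounds: "v \<noteq> [] \<Longrightarrow> 0 \<le> xx N e n v \<and> xx N e n v \<le> 1"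
proof (induction n arbitrary: v)
  case (Suc n)
  note ss = ss_le[of N e n v]
  have "0 < pp (N v) (bt v (e v))" using Suc.prems by (rule pp_pos)
  moreover have "0 \<le> ss N e n v" "ss N e n v \<le> 1 - pp (N v) (bt v (e v))" using ss Suc.IH by auto
  ultimately show ?case by (simp add: ss_def[symmetric])
qed simp

lemma ss_bounds: "0 \<le> ss N e n v" "ss N e n v \<le> 1 - pp (N v) (bt v (e v))"
  using ss_le[of N e n v] xx_bounds by auto

lemma geometric_ennreal: "0 \<le> s \<Longrightarrow> s < 1 \<Longrightarrow> (\<Sum>j. ennreal (s ^ j)) = ennreal (1 / (1 - s))"
  by (subst suminf_ennreal2) (auto simp: suminf_geometric intro!: summable_geometric)

text \<open>Both claims are proved together. Cutting at first returns gives weight \<open>ss\<close>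
  to a single loop, hence its \<open>j\<close>-th power to \<open>j\<close> returns; summing over
  \<open>j\<close> and adding the step to the parent gives \<open>xx\<close> one level
  higher.\<close>

lemma esum_lw:
  shows "v \<noteq> [] \<Longrightarrow> esum (\<lambda>p. ennreal (lw N e p) * ennreal (pp (N v) (bt v (e v)))) (excs N n v) = ennreal (xx N e n v)"
    and "esum (\<lambda>p. ennreal (lw N e p)) (exc N (Suc n) j u) = ennreal (ss N e n u ^ j)"
proof (induction n arbitrary: v j u)
  case 0
  {
    case 1
    show ?case by (simp add: excs_def esum_finite)
  next
    case 2
    show ?case
    proof (induction j)
      case 0
      show ?case by (simp add: esum_finite)
    next
      case (Suc j)
      show ?case unfolding esum_exc_Suc by (simp add: excs_def esum_finite ss_def)
    qed
  }
next
  case (Suc n)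
  \<comment> \<open>Stated for general \<open>m\<close>, because it is applied at the old level
    inside \<open>B\<close> and at the new level in the conclusion.\<close>
  have A: "esum (\<lambda>p. ennreal (lw N e p)) (exc N (Suc m) j u) = ennreal (ss N e m u ^ j)"
    if E: "\<And>v. v \<noteq> [] \<Longrightarrow> esum (\<lambda>p. ennreal (lw N e p) * ennreal (pp (N v) (bt v (e v)))) (excs N m v) = ennreal (xx N e m v)"
    for m j u
  proof (induction j)
    case 0
    show ?case by (simp add: esum_finite)
  next
    case (Suc j)
    have "esum (\<lambda>p. ennreal (lw N e p)) (exc N (Suc m) (Suc j) u) =
        (\<Sum>i<N u. esum (\<lambda>p. esum (\<lambda>q. ennreal (pc (N u) (bt u (e u)) i) *
          (ennreal (lw N e p) * ennreal (pp (N (u @ [i])) (bt (u @ [i]) (e (u @ [i]))))) * ennreal (lw N e q)) (exc N (Suc m) j u)) (excs N m (u @ [i])))"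
      unfolding esum_exc_Suc
      by (intro sum.cong refl esum_cong lw_excursion) (auto dest: excs_props(1) exc_props)
    also have "\<dots> = (\<Sum>i<N u. ennreal (pc (N u) (bt u (e u)) i) * ennreal (xx N e m (u @ [i])) * ennreal (ss N e m u ^ j))"
      unfolding esum_cmult esum_multc Suc by (simp add: E[unfolded esum_multc])
    also have "\<dots> = (\<Sum>i<N u. ennreal (pc (N u) (bt u (e u)) i * xx N e m (u @ [i]))) * ennreal (ss N e m u ^ j)"
      by (simp add: sum_distrib_right ennreal_mult pc_nonneg xx_bounds)
    also have "(\<Sum>i<N u. ennreal (pc (N u) (bt u (e u)) i * xx N e m (u @ [i]))) = ennreal (ss N e m u)"
      unfolding ss_def by (intro sum_ennreal mult_nonneg_nonneg pc_nonneg) (simp add: xx_bounds)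
    finally show ?case by (simp add: ennreal_mult[symmetric] ss_bounds)
  qed
  have B: "esum (\<lambda>p. ennreal (lw N e p) * ennreal (pp (N v) (bt v (e v)))) (excs N (Suc n) v) = ennreal (xx N e (Suc n) v)"
    if v: "v \<noteq> []" for v
  proof -
    let ?s = "ss N e n v" and ?p = "pp (N v) (bt v (e v))"
    have s: "0 \<le> ?s" "?s < 1" using ss_bounds[of N e n v] pp_pos[OF v, of "N v" "e v"] by auto
    have An: "esum (\<lambda>p. ennreal (lw N e p)) (exc N (Suc n) j v) = ennreal (?s ^ j)" for j
      by (rule A) (rule Suc(1))
    have "esum (\<lambda>p. ennreal (lw N e p) * ennreal ?p) (excs N (Suc n) v) =
        esum (\<lambda>j. esum (\<lambda>p. ennreal (lw N e p) * ennreal ?p) (exc N (Suc n) j v)) UNIV"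
      unfolding excs_def by (rule esum_UN[OF _ disjoint_exc(1)]) simp
    also have "\<dots> = (\<Sum>j. ennreal (?s ^ j)) * ennreal ?p"
      unfolding esum_multc An esum_nat by simp
    also have "\<dots> = ennreal (1 / (1 - ?s) * ?p)"
      unfolding geometric_ennreal[OF s] by (rule ennreal_mult[symmetric]) (use s pp_nonneg in auto)
    finally show ?thesis by (simp add: ss_def)
  qed
  {
    case 1
    then show ?case by (rule B)
  next
    case 2
    show ?case by (rule A) (rule B)
  }
qed

lemma upt_append: "i \<le> j \<Longrightarrow> j \<le> k \<Longrightarrow> [i..<k] = [i..<j] @ [j..<k]"
  using upt_add_eq_append[of i j "k - j"] by simp

text \<open>Converse to the recursive construction of excursions, by induction on the duration: cut
  at the first return \<open>t1\<close> to \<open>u\<close>. The piece in between is an excursion of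
  a child, the rest one of \<open>u\<close>, and both are shorter.\<close>

lemma excursion_of_path:
  assumes nn: "\<And>n. X (Suc n) \<in> nbrs (gw_tree N) (X n)"
  shows "s \<le> t \<Longrightarrow> X s = u \<Longrightarrow> X t = u \<Longrightarrow> (\<And>r. s \<le> r \<Longrightarrow> r \<le> t \<Longrightarrow> prefix u (X r)) \<Longrightarrow>
    \<exists>j. map X [s..<Suc t] \<in> excU N j u"
proof (induction "t - s" arbitrary: s t u rule: less_induct)
  case less
  have step: "(\<exists>k. X (Suc n) = X n @ [k]) \<or> (\<exists>k. X n = X (Suc n) @ [k])" for n
    using nn[of n] by (auto simp: nbrs_def)
  show ?case
  proof (cases "s = t")
    case True
    then have "map X [s..<Suc t] \<in> excU N 0 u" using less.prems by (simp add: excU_0)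
    then show ?thesis by blast
  next
    case False
    then have st: "s < t" using less.prems by simp
    have "prefix u (X (Suc s))" using less.prems(4)[of "Suc s"] st by simp
    then have "X s \<noteq> X (Suc s) @ [k]" for k using less.prems(2) by (auto dest: prefix_length_le)
    with step[of s] obtain i where i: "X (Suc s) = u @ [i]" using less.prems(2) by auto
    have iN: "i < N u" using nn[of s] i by (auto simp: nbrs_def snoc_mem_gw_tree_iff)
    define t1 where "t1 = (LEAST r. s < r \<and> X r = u)"
    have ex: "s < t \<and> X t = u" using st less.prems by simp
    have t1: "s < t1" "X t1 = u" "t1 \<le> t"
      using LeastI[of "\<lambda>r. s < r \<and> X r = u", OF ex] Least_le[of "\<lambda>r. s < r \<and> X r = u", OF ex] by (auto simp: t1_def)
    have before: "X r \<noteq> u" if "s < r" "r < t1" for r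
      using not_less_Least[of r "\<lambda>r. s < r \<and> X r = u"] that by (auto simp: t1_def)
    have "t1 \<noteq> Suc s" using i t1 by auto
    then have t1s: "Suc s < t1" using t1 by simp
    \<comment> \<open>The walk can leave the subtree of the child only through \<open>u\<close>,
      which it does not visit before \<open>t1\<close>.\<close>
    have sub: "prefix (u @ [i]) (X r)" if "Suc s \<le> r" "r < t1" for r
      using that
    proof (induction r rule: dec_induct)
      case base
      then show ?case by (simp add: i)
    next
      case (step r)
      then have IH: "prefix (u @ [i]) (X r)" by simp
      from \<open>\<And>n. (\<exists>k. X (Suc n) = X n @ [k]) \<or> (\<exists>k. X n = X (Suc n) @ [k])\<close>[of r]
      show ?case
      proof (elim disjE exE)
        fix k assume "X (Suc r) = X r @ [k]"
        then show ?thesis using IH by (simp add: prefix_snoc)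
      next
        fix k assume k: "X r = X (Suc r) @ [k]"
        have "X (Suc r) \<noteq> u" using before[of "Suc r"] step by simp
        with IH show ?thesis unfolding k prefix_snoc by auto
      qed
    qed
    obtain r where r: "t1 = Suc r" using t1 by (cases t1) auto
    have rs: "Suc s \<le> r" using t1s r by simp
    have pr: "prefix (u @ [i]) (X r)" using sub[of r] rs r by simp
    have Xr: "X r = u @ [i]"
      using step[of r]
    proof (elim disjE exE)
      fix k assume "X (Suc r) = X r @ [k]"
      then have "u = X r @ [k]" using t1 r by simp
      with pr show ?thesis by (auto dest: prefix_length_le)
    next
      fix k assume "X r = X (Suc r) @ [k]"
      then have "X r = u @ [k]" using t1 r by simp
      with pr show ?thesis by (auto simp: prefix_snoc dest: prefix_length_le)
    qed
    have lt: "r - Suc s < t - s" using rs t1 r by linarith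
    have "\<exists>j. map X [Suc s..<Suc r] \<in> excU N j (u @ [i])"
      by (rule less.hyps[OF lt rs i Xr]) (use sub r in auto)
    then obtain j1 where j1: "map X [Suc s..<Suc r] \<in> excU N j1 (u @ [i])" by blast
    have lt2: "t - t1 < t - s" using t1 st by linarith
    have "\<exists>j. map X [t1..<Suc t] \<in> excU N j u"
      by (rule less.hyps[OF lt2 t1(3,2) less.prems(3)]) (use less.prems(4) t1 in auto)
    then obtain j2 where j2: "map X [t1..<Suc t] \<in> excU N j2 u" by blast
    have "[s..<Suc t] = s # [Suc s..<Suc t]" using st by (simp add: upt_conv_Cons)
    also have "[Suc s..<Suc t] = [Suc s..<t1] @ [t1..<Suc t]"
      using t1 t1s by (intro upt_append) auto
    finally have "map X [s..<Suc t] = u # map X [Suc s..<Suc r] @ map X [t1..<Suc t]"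
      using less.prems(2) r by simp
    moreover have "map X [Suc s..<Suc r] \<in> excsU N (u @ [i])" using j1 by (auto simp: excsU_def)
    ultimately have "map X [s..<Suc t] \<in> excU N (Suc j2) u"
      unfolding excU_Suc using iN j2 by (intro UN_I[of i] image_eqI[of _ _ "(map X [Suc s..<Suc r], map X [t1..<Suc t])"]) auto
    then show ?thesis by blast
  qed
qed

lemma exc_successively:
  "p \<in> exc N n j u \<Longrightarrow> u \<in> gw_tree N \<Longrightarrow> successively (\<lambda>x y. y \<in> nbrs (gw_tree N) x) p"
proof (induction N n j u arbitrary: p rule: exc.induct)
  case (3 N n j u)
  from 3(3) obtain i j' p' q where i: "i < N u" "p' \<in> exc N n j' (u @ [i])" "q \<in> exc N (Suc n) j u" "p = u # p' @ q"
    by auto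
  have mem: "u @ [i] \<in> gw_tree N" using i 3(4) by (simp add: snoc_mem_gw_tree_iff)
  have p': "successively (\<lambda>x y. y \<in> nbrs (gw_tree N) x) p'" using 3(1)[OF _ UNIV_I i(2)] i(1) mem by auto
  have q: "successively (\<lambda>x y. y \<in> nbrs (gw_tree N) x) q" using 3(2)[OF _ i(3)] i(1) 3(4) by auto
  have "u @ [i] \<in> nbrs (gw_tree N) u" "u \<in> nbrs (gw_tree N) (u @ [i])"
    using mem 3(4) by (auto simp: nbrs_def)
  then show ?case using p' q exc_props[OF i(2)] exc_props[OF i(3)]
    by (simp add: i(4) successively_append_iff successively_Cons)
qed auto

section \<open>Return events of the reinforced walk\<close>

definition cyl :: "vertex list \<Rightarrow> (nat \<Rightarrow> vertex) set" where
  "cyl p = {X. \<forall>i<length p. X i = p ! i}"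

text \<open>For nearest-neighbour trajectories this is the event of at least \<open>k\<close>
  returns to the root; the word records the trajectory up to the \<open>k\<close>-th return.\<close>

definition Ret :: "(vertex \<Rightarrow> nat) \<Rightarrow> nat \<Rightarrow> (nat \<Rightarrow> vertex) set" where
  "Ret N k = (\<Union>p\<in>excU N k []. cyl p)"

text \<open>A word with \<open>k\<close> returns ends at its \<open>k\<close>-th return, so none is
  a proper prefix of another.\<close>

lemma disjoint_cyl: "disjoint_family_on cyl (excU N k [])"
proof -
  have *: "p = q" if p: "p \<in> excU N k []" and q: "q \<in> excU N k []" and X: "X \<in> cyl p" "X \<in> cyl q" and len: "length p \<le> length q" for p q X
  proof -
    have "p = take (length p) q"
      using X len by (intro nth_equalityI) (auto simp: cyl_def)
    then obtain r where r: "q = p @ r" by (metis append_take_drop_id)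
    have "count_list r [] = 0" using excs_props(3)[OF p] excs_props(3)[OF q] r by simp
    then have "[] \<notin> set r" by (simp add: count_list_0_iff)
    then have "r = []" using excs_props(3)[OF q] r last_in_set[of r] by (cases "r = []") auto
    with r show ?thesis by simp
  qed
  show ?thesis unfolding disjoint_family_on_def
  proof (intro ballI impI)
    fix p q assume pq: "p \<in> excU N k []" "q \<in> excU N k []" "p \<noteq> q"
    show "cyl p \<inter> cyl q = {}"
      using *[OF pq(1,2)] *[OF pq(2,1)] pq(3) by (metis disjoint_iff nat_le_linear)
  qed
qed

lemma space_errw: "space (errw T \<Delta>) = UNIV"
  by (simp add: errw_def errw.PF.space_lim space_PiM)

lemma coord_measurable: "(\<lambda>X. X i) \<in> errw T \<Delta> \<rightarrow>\<^sub>M count_space UNIV"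
proof -
  have "(\<lambda>X. X i) \<in> (\<Pi>\<^sub>M n\<in>UNIV. count_space (UNIV :: vertex set)) \<rightarrow>\<^sub>M count_space UNIV"
    by (rule measurable_component_singleton) simp
  then show ?thesis by (simp add: measurable_cong_sets[OF sets_errw refl])
qed

lemma cyl_sets [measurable]: "cyl p \<in> sets (errw T \<Delta>)"
proof -
  note [measurable] = coord_measurable
  have "{X\<in>space (errw T \<Delta>). \<forall>i\<in>{..<length p}. X i = p ! i} \<in> sets (errw T \<Delta>)" by measurable
  then show ?thesis by (simp add: cyl_def space_errw Ball_def)
qed

lemma Ret_sets [measurable]: "Ret N k \<in> sets (errw T \<Delta>)"
  unfolding Ret_def by (intro sets.countable_UN'' ) auto

lemma Ret_all_imp_infinitely_many:
  assumes "\<And>k. X \<in> Ret N k"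
  shows "\<exists>\<^sub>\<infinity>n. X n = []"
proof (rule ccontr)
  assume "\<not> ?thesis"
  then have fin: "finite {n. X n = []}" by (simp add: frequently_cofinite)
  \<comment> \<open>If the root is visited only finitely often, take \<open>k\<close> to be the
    number of visits: a word with \<open>k\<close> returns contains \<open>k\<close> + 1 of
    them.\<close>
  obtain p where p: "p \<in> excU N (card {n. X n = []}) []" "X \<in> cyl p" using assms unfolding Ret_def by auto
  have "count_list p [] = card {i. i < length p \<and> [] = p ! i}"
    by (simp add: count_list_eq_length_filter length_filter_conv_card)
  also have "\<dots> \<le> card {n. X n = []}" using fin p(2) by (intro card_mono) (auto simp: cyl_def)
  finally show False using excs_props(3)[OF p(1)] by simp
qed

lemma Ret_of_count:
  assumes nn: "X 0 = []" "\<And>n. X (Suc n) \<in> nbrs (gw_tree N) (X n)"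
    and t: "X t = []" "count_list (map X [0..<Suc t]) [] = Suc k"
  shows "X \<in> Ret N k"
proof -
  obtain j where j: "map X [0..<Suc t] \<in> excU N j []"
    using excursion_of_path[where X = X and N = N and s = 0 and t = t and u = "[]", OF nn(2)] nn(1) t(1) by auto
  then have "count_list (map X [0..<Suc t]) [] = Suc j" using excs_props(3) by blast
  then have "j = k" unfolding t(2) by simp
  moreover have "X \<in> cyl (map X [0..<Suc t])" by (auto simp: cyl_def simp del: upt_Suc)
  ultimately show ?thesis using j unfolding Ret_def by blast
qed

lemma infinitely_many_imp_Ret:
  assumes nn: "X 0 = []" "\<And>n. X (Suc n) \<in> nbrs (gw_tree N) (X n)" and inf: "\<exists>\<^sub>\<infinity>n. X n = []"
  shows "X \<in> Ret N k"
proof -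
  have "\<exists>t. X t = [] \<and> count_list (map X [0..<Suc t]) [] = Suc k"
  proof (induction k)
    case 0
    show ?case using nn by (intro exI[of _ 0]) simp
  next
    case (Suc k)
    then obtain t where t: "X t = []" "count_list (map X [0..<Suc t]) [] = Suc k" by blast
    from inf obtain t0 where t0: "t < t0 \<and> X t0 = []" by (auto simp: INFM_nat)
    define t1 where "t1 = (LEAST r. t < r \<and> X r = [])"
    have t1: "t < t1" "X t1 = []" using LeastI[of "\<lambda>r. t < r \<and> X r = []", OF t0] by (auto simp: t1_def)
    have before: "X r \<noteq> []" if "t < r" "r < t1" for r
      using not_less_Least[of r "\<lambda>r. t < r \<and> X r = []"] that by (auto simp: t1_def)
    have "[0..<Suc t1] = [0..<Suc t] @ [Suc t..<t1] @ [t1]"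
      using t1 upt_append[of 0 "Suc t" t1] by simp
    moreover have "count_list (map X [Suc t..<t1]) [] = 0"
      unfolding count_list_0_iff
    proof
      assume "[] \<in> set (map X [Suc t..<t1])"
      then obtain r where "X r = []" "t < r" "r < t1" by (auto simp: eq_commute[of "[]"])
      with before show False by blast
    qed
    ultimately have "count_list (map X [0..<Suc t1]) [] = Suc (Suc k)"
      using t t1 by (simp del: upt_Suc)
    with t1 show ?case by blast
  qed
  then obtain t where t: "X t = []" "count_list (map X [0..<Suc t]) [] = Suc k" by blast
  show ?thesis by (rule Ret_of_count[where X = X, OF nn t])
qed

lemma Ret_1_of_return:
  assumes nn: "X 0 = []" "\<And>n. X (Suc n) \<in> nbrs (gw_tree N) (X n)" and n: "n > 0" "X n = []"
  shows "X \<in> Ret N 1"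
proof -
  define t where "t = (LEAST r. 0 < r \<and> X r = [])"
  have t: "0 < t" "X t = []" using LeastI[of "\<lambda>r. 0 < r \<and> X r = []" n] n by (auto simp: t_def)
  have before: "X r \<noteq> []" if "0 < r" "r < t" for r
    using not_less_Least[of r "\<lambda>r. 0 < r \<and> X r = []"] that by (auto simp: t_def)
  have "[0..<Suc t] = 0 # [Suc 0..<t] @ [t]"
    using t upt_append[of 0 "Suc 0" t] by simp
  moreover have "count_list (map X [Suc 0..<t]) [] = 0"
    unfolding count_list_0_iff
  proof
    assume "[] \<in> set (map X [Suc 0..<t])"
    then obtain r where "X r = []" "0 < r" "r < t" by (auto simp: eq_commute[of "[]"])
    with before show False by blast
  qed
  ultimately have "count_list (map X [0..<Suc t]) [] = Suc 1"
    using t nn by (simp del: upt_Suc)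
  then show ?thesis by (rule Ret_of_count[where X = X, OF nn t(2)])
qed

text \<open>The probabilities of the neighbours already add up to 1, which leaves no mass
  elsewhere.\<close>

lemma pmf_step_outside:
  assumes "\<Delta> > 0" "nbrs (gw_tree N) (x n) \<noteq> {}" "v \<notin> nbrs (gw_tree N) (x n)"
  shows "pmf (errw_step (gw_tree N) \<Delta> n x) v = 0"
proof -
  let ?B = "nbrs (gw_tree N) (x n)" and ?p = "errw_step (gw_tree N) \<Delta> n x"
  let ?w = "\<lambda>v. edge_weight \<Delta> x n {x n, v}"
  have fin: "finite ?B" by (rule finite_nbrs_gw_tree)
  have "?w v > 0" for v
    using assms(1) unfolding edge_weight_def by (intro add_pos_nonneg mult_nonneg_nonneg sum_nonneg) auto
  then have pos: "(\<Sum>v\<in>?B. ?w v) > 0" using fin assms(2) by (intro sum_pos) auto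
  have "(\<Sum>v\<in>?B. pmf ?p v) = (\<Sum>v\<in>?B. ?w v / (\<Sum>v\<in>?B. ?w v))"
    by (intro sum.cong refl pmf_errw_step[where T = "gw_tree N" and X = x and n = n, OF assms(1) fin])
  also have "\<dots> = 1" using pos by (simp add: sum_divide_distrib[symmetric])
  finally have "measure_pmf.prob ?p (insert v ?B) = pmf ?p v + 1"
    using fin assms(3) by (subst measure_measure_pmf_finite) auto
  then show ?thesis using measure_pmf.prob_le_1[of ?p "insert v ?B"] pmf_nonneg[of ?p v] by linarith
qed

text \<open>With a child at the root every vertex of the tree has a neighbour, so a violation at a
  given step lies in a countable union of null cylinders.\<close>

lemma AE_nearest_neighbour:
  assumes \<Delta>: "\<Delta> > 0" and N: "N [] > 0"
  shows "AE X in errw (gw_tree N) \<Delta>. X 0 = [] \<and> (\<forall>n. X (Suc n) \<in> nbrs (gw_tree N) (X n))"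
proof -
  interpret prob_space "errw (gw_tree N) \<Delta>" by (rule prob_space_errw)
  note [measurable] = coord_measurable
  let ?T = "gw_tree N"
  have ne: "nbrs ?T u \<noteq> {}" if "u \<in> ?T" for u
    using nbrs_gw_tree[OF that] N by (cases "u = []") auto
  have "{X. X 0 = []} = {X\<in>space (errw ?T \<Delta>). X 0 = []}" by (simp add: space_errw)
  also have "\<dots> \<in> events" by measurable
  finally have "AE X in errw ?T \<Delta>. X \<in> {X. X 0 = []}"
    using measure_errw_0[of ?T \<Delta> "[]"] by (subst AE_in_set_eq_1) auto
  then have z: "AE X in errw ?T \<Delta>. X 0 = []" by simp
  have step: "AE X in errw ?T \<Delta>. nnpath N X n \<longrightarrow> X (Suc n) \<in> nbrs ?T (X n)" for n
  proof -
    define I where "I = {p. length p = Suc (Suc n) \<and> nnpath N (\<lambda>i. p ! i) n \<and> p ! Suc n \<notin> nbrs ?T (p ! n)}"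
    have null: "cyl p \<in> null_sets (errw ?T \<Delta>)" if "p \<in> I" for p
    proof -
      have p: "length p = Suc (Suc n)" "nnpath N (\<lambda>i. p ! i) n" "p ! Suc n \<notin> nbrs ?T (p ! n)" using that by (auto simp: I_def)
      have "cyl p = {X. \<forall>i\<le>Suc n. X i = p ! i}" using p(1) by (auto simp: cyl_def less_Suc_eq_le)
      then have "measure (errw ?T \<Delta>) (cyl p) = measure (errw ?T \<Delta>) {X. \<forall>i\<le>n. X i = p ! i} * pmf (errw_step ?T \<Delta> n (\<lambda>i. p ! i)) (p ! Suc n)"
        by (simp only: measure_errw_Suc)
      also have "pmf (errw_step ?T \<Delta> n (\<lambda>i. p ! i)) (p ! Suc n) = 0"
        by (rule pmf_step_outside[where N = N and x = "\<lambda>i. p ! i" and n = n, OF \<Delta> ne[OF nnpath_mem[OF p(2)]] p(3)])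
      finally show ?thesis by (simp add: null_sets_def emeasure_eq_measure)
    qed
    have "(\<Union>p\<in>I. cyl p) \<in> null_sets (errw ?T \<Delta>)" by (rule null_sets_UN') (auto intro: null)
    from AE_not_in[OF this] show ?thesis
    proof eventually_elim
      case (elim X)
      show ?case
      proof (rule impI, rule ccontr)
        assume path: "nnpath N X n" and bad: "X (Suc n) \<notin> nbrs ?T (X n)"
        let ?p = "map X [0..<Suc (Suc n)]"
        have nth: "?p ! i = X i" if "i < Suc (Suc n)" for i using that by (simp del: upt_Suc)
        have "nnpath N (\<lambda>i. ?p ! i) n" using path unfolding nnpath_def by (simp add: nth del: upt_Suc)
        then have "?p \<in> I" using bad by (simp add: I_def nth del: upt_Suc)
        moreover have "X \<in> cyl ?p" by (auto simp: cyl_def simp del: upt_Suc)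
        ultimately show False using elim by blast
      qed
    qed
  qed
  have "AE X in errw ?T \<Delta>. \<forall>n. nnpath N X n \<longrightarrow> X (Suc n) \<in> nbrs ?T (X n)"
    using step by (simp add: AE_all_countable)
  with z show ?thesis
  proof eventually_elim
    case (elim X)
    have "nnpath N X n" for n
      by (induction n) (use elim in \<open>auto simp: nnpath_Suc, auto simp: nnpath_def\<close>)
    with elim show ?case by blast
  qed
qed

lemma pr_measurable [measurable]: "(\<lambda>e. pr N e u v) \<in> borel_measurable (env a)"
proof -
  have b: "(\<lambda>\<beta>. bt u \<beta> i) \<in> borel_measurable (PiM UNIV (\<lambda>_. borel))" for i
    unfolding bt_def by measurable
  have "(\<lambda>\<beta>. if \<exists>i. v = u @ [i] then pc (N u) (bt u \<beta>) (last v) else pp (N u) (bt u \<beta>)) \<in> borel_measurable (PiM UNIV (\<lambda>_. borel))"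
    unfolding pc_def pp_def by (intro measurable_If borel_measurable_times borel_measurable_prod borel_measurable_diff b) auto
  then have "(\<lambda>\<beta>. if \<exists>i. v = u @ [i] then pc (N u) (bt u \<beta>) (last v) else pp (N u) (bt u \<beta>)) \<in> borel_measurable (env_sticks a u)"
    by (simp add: measurable_cong_sets[OF sets_env_sticks refl])
  moreover have "(\<lambda>e. e u) \<in> env a \<rightarrow>\<^sub>M env_sticks a u"
    unfolding env_def by (rule measurable_component_singleton) simp
  ultimately show ?thesis
    unfolding pr_def by (rule measurable_compose[rotated])
qed

lemma lw_measurable [measurable]: "(\<lambda>e. lw N e p) \<in> borel_measurable (env a)"
  unfolding lw_eq_prod by (intro borel_measurable_prod pr_measurable)

lemma emeasure_cyl:
  assumes "\<Delta> > 0" "a = 1 / (2 * \<Delta>)" "p \<in> excU N k []"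
  shows "emeasure (errw (gw_tree N) \<Delta>) (cyl p) = (\<integral>\<^sup>+e. ennreal (lw N e p) \<partial>env a)"
proof -
  have pr: "p \<noteq> []" "hd p = []" using excs_props(3)[OF assms(3)] by auto
  obtain n where "p \<in> exc N n k []" using assms(3) by (auto simp: excU_def)
  from exc_successively[OF this gw_tree.root]
  have "nnpath N (\<lambda>i. p ! i) (length p - 1)"
    using pr by (auto simp: nnpath_def successively_conv_nth hd_conv_nth)
  from emeasure_path_eq_nn_integral[OF assms(1,2) this]
  have "emeasure (errw (gw_tree N) \<Delta>) {X. \<forall>i\<le>length p - 1. X i = p ! i} = (\<integral>\<^sup>+e. ennreal (lw N e p) \<partial>env a)"
    by (simp only: lw_eq_prod)
  moreover have "{X. \<forall>i\<le>length p - 1. X i = p ! i} = cyl p"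
    using pr by (cases p) (auto simp: cyl_def less_Suc_eq_le)
  ultimately show ?thesis by simp
qed

lemma emeasure_Ret:
  assumes "\<Delta> > 0" "a = 1 / (2 * \<Delta>)"
  shows "emeasure (errw (gw_tree N) \<Delta>) (Ret N k) = (\<integral>\<^sup>+e. esum (\<lambda>p. ennreal (lw N e p)) (excU N k []) \<partial>env a)"
proof -
  have "emeasure (errw (gw_tree N) \<Delta>) (Ret N k) = esum (\<lambda>p. emeasure (errw (gw_tree N) \<Delta>) (cyl p)) (excU N k [])"
    unfolding Ret_def esum_def by (rule emeasure_UN_countable[OF _ _ disjoint_cyl]) auto
  also have "\<dots> = esum (\<lambda>p. \<integral>\<^sup>+e. ennreal (lw N e p) \<partial>env a) (excU N k [])"
    by (rule esum_cong) (rule emeasure_cyl[OF assms])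
  also have "\<dots> = (\<integral>\<^sup>+e. esum (\<lambda>p. ennreal (lw N e p)) (excU N k []) \<partial>env a)"
    unfolding esum_def by (rule nn_integral_count_space_nn_integral[symmetric]) auto
  finally show ?thesis .
qed

section \<open>Recurrence and transience\<close>

locale errw_environment =
  fixes p :: "nat pmf" and a :: real
  assumes a_pos: "a > 0"
begin

abbreviation mark :: "(nat \<times> (nat \<Rightarrow> real)) measure" where
  "mark \<equiv> measure_pmf p \<Otimes>\<^sub>M stick_measure a"

sublocale SM: prob_space "stick_measure a" by (rule prob_space_stick_measure[OF a_pos])

sublocale PS: pair_prob_space "measure_pmf p" "stick_measure a" ..

sublocale MT: marked_tree mark fst "\<lambda>i x. odds i (snd x)"
proof
  show "fst \<in> mark \<rightarrow>\<^sub>M count_space UNIV"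
    using measurable_fst[of "measure_pmf p" "stick_measure a"] by (simp cong: measurable_cong_sets)
  show "(\<lambda>x. odds i (snd x)) \<in> borel_measurable mark" for i
    by (rule measurable_compose[OF measurable_snd odds_measurable_stick])
qed (rule odds_pos)

lemma nn_integral_mark:
  assumes g: "g \<in> borel_measurable (stick_measure a)"
  shows "(\<integral>\<^sup>+x. (if i < fst x then g (snd x) else 0) \<partial>mark) =
    emeasure (measure_pmf p) {i<..} * (\<integral>\<^sup>+\<beta>. g \<beta> \<partial>stick_measure a)"
proof -
  have "(\<integral>\<^sup>+x. (if i < fst x then g (snd x) else 0) \<partial>mark) = (\<integral>\<^sup>+x. indicator {i<..} (fst x) * g (snd x) \<partial>mark)"
    by (intro nn_integral_cong) (auto simp: indicator_def)
  also have "\<dots> = (\<integral>\<^sup>+k. \<integral>\<^sup>+\<beta>. indicator {i<..} (fst (k, \<beta>)) * g (snd (k, \<beta>)) \<partial>stick_measure a \<partial>measure_pmf p)"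
  proof (rule SM.nn_integral_fst[symmetric])
    have "(\<lambda>x. indicator {i<..} (fst x) :: ennreal) \<in> borel_measurable mark"
      by (rule measurable_compose[OF measurable_fst]) simp
    moreover have "(\<lambda>x. g (snd x)) \<in> borel_measurable mark"
      by (rule measurable_compose[OF measurable_snd g])
    ultimately show "(\<lambda>x. indicator {i<..} (fst x) * g (snd x)) \<in> borel_measurable mark"
      by (rule borel_measurable_times_ennreal)
  qed
  also have "\<dots> = (\<integral>\<^sup>+k. (\<integral>\<^sup>+\<beta>. g \<beta> \<partial>stick_measure a) * indicator {i<..} k \<partial>measure_pmf p)"
    by (simp only: fst_conv snd_conv nn_integral_cmult[OF g]) (simp only: mult.commute)
  also have "\<dots> = emeasure (measure_pmf p) {i<..} * (\<integral>\<^sup>+\<beta>. g \<beta> \<partial>stick_measure a)"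
    by (subst nn_integral_cmult_indicator) (auto simp: mult.commute)
  finally show ?thesis .
qed

lemma odds_moment_mark:
  assumes "- a < s" "s < a + 1/2"
  shows "(\<integral>\<^sup>+x. (if i < fst x then ennreal (odds i (snd x) powr s) else 0) \<partial>mark) =
    ennreal (measure_pmf.prob p {i<..} * gmom a s)"
proof -
  have "(\<lambda>\<beta>. ennreal (odds i \<beta> powr s)) \<in> borel_measurable (stick_measure a)" by measurable
  from nn_integral_mark[OF this, of i] show ?thesis
    using gmom_pos[OF a_pos assms]
    by (simp add: odds_moment[OF a_pos assms] measure_pmf.emeasure_eq_measure ennreal_mult)
qed

lemma deg_law: "emeasure mark {x\<in>space mark. fst x = k} = ennreal (pmf p k)"
proof -
  have "{x\<in>space mark. fst x = k} = {k} \<times> space (stick_measure a)"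
    by (auto simp: space_pair_measure)
  then show ?thesis
    by (simp add: SM.emeasure_pair_measure_Times SM.emeasure_space_1 emeasure_pmf_single)
qed

text \<open>The tail formula for the mean, by summing the indicators of i < k over i; it supplies
  the weights \<open>t\<close> of \<open>supercritical_not_AE_Ylim_eq_0\<close>.\<close>

lemma tail_sums:
  assumes "(\<lambda>k. real k * pmf p k) sums m"
  shows "(\<lambda>i. measure_pmf.prob p {i<..}) sums m"
proof -
  have m0: "0 \<le> m" using sums_le[OF _ sums_zero assms] by simp
  have "(\<Sum>i. ennreal (measure_pmf.prob p {i<..})) = (\<Sum>i. \<integral>\<^sup>+k. indicator {i<..} k \<partial>measure_pmf p)"
    by (simp add: measure_pmf.emeasure_eq_measure)
  also have "\<dots> = (\<integral>\<^sup>+k. (\<Sum>i. indicator {i<..} k) \<partial>measure_pmf p)"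
    by (rule nn_integral_suminf[symmetric]) simp
  also have "\<dots> = (\<integral>\<^sup>+k. ennreal (real k) \<partial>measure_pmf p)"
  proof (rule nn_integral_cong)
    fix k :: nat
    have "(\<Sum>i. indicator {i<..} k :: ennreal) = (\<Sum>i<k. indicator {i<..} k)"
      by (rule suminf_finite) auto
    then show "(\<Sum>i. indicator {i<..} k) = ennreal (real k)" by (simp add: ennreal_of_nat_eq_real_of_nat)
  qed
  also have "\<dots> = (\<Sum>k. ennreal (real k * pmf p k))"
    by (simp add: nn_integral_measure_pmf nn_integral_count_space_nat ennreal_mult mult.commute)
  also have "\<dots> = ennreal m"
    using assms by (subst suminf_ennreal2) (auto simp: sums_iff)
  finally have "(\<lambda>i. ennreal (measure_pmf.prob p {i<..})) sums ennreal m" by (metis summableI summable_sums)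
  then show ?thesis using m0 by (subst (asm) sums_ennreal) auto
qed

abbreviation mk :: "(vertex \<Rightarrow> nat) \<Rightarrow> (vertex \<Rightarrow> nat \<Rightarrow> real) \<Rightarrow> vertex \<Rightarrow> vertex \<Rightarrow> nat \<times> (nat \<Rightarrow> real)" where
  "mk N e v \<equiv> (\<lambda>w. (N (v @ w), e (v @ w)))"

definition Y :: "(vertex \<Rightarrow> nat) \<Rightarrow> (vertex \<Rightarrow> nat \<Rightarrow> real) \<Rightarrow> vertex \<Rightarrow> real" where
  "Y N e v = MT.Ylim (mk N e v)"

text \<open>The probability, in a fixed environment, of stepping to a child and coming back to
  \<open>v\<close>.\<close>

definition sv :: "(vertex \<Rightarrow> nat) \<Rightarrow> (vertex \<Rightarrow> nat \<Rightarrow> real) \<Rightarrow> vertex \<Rightarrow> real" where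
  "sv N e v = (\<Sum>i<N v. pc (N v) (bt v (e v)) i * (1 - Y N e (v @ [i])))"

lemma Y_bounds: "0 \<le> Y N e v" "Y N e v \<le> 1"
  using MT.Ylim_bounds by (auto simp: Y_def)

lemma sv_bounds: "0 \<le> sv N e v" "sv N e v \<le> 1 - pp (N v) (bt v (e v))"
proof -
  show "0 \<le> sv N e v" unfolding sv_def using Y_bounds by (intro sum_nonneg mult_nonneg_nonneg pc_nonneg) auto
  have "sv N e v \<le> (\<Sum>i<N v. pc (N v) (bt v (e v)) i)"
    unfolding sv_def using Y_bounds by (intro sum_mono mult_left_le) (auto simp: pc_nonneg)
  then show "sv N e v \<le> 1 - pp (N v) (bt v (e v))" using pp_plus_pc[of "N v" "bt v (e v)"] by linarith
qed

text \<open>The sticks after \<open>i\<close> are a common factor of both step probabilities and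
  cancel in the ratio, so the odds do not see the number \<open>d\<close> of children.\<close>

lemma pc_eq_odds:
  assumes v: "v \<noteq> []" and i: "i < d"
  shows "pc d (bt v \<beta>) i = pp d (bt v \<beta>) * odds i \<beta>"
proof -
  have b: "bt v \<beta> j = clip01 (\<beta> j)" for j using v by (simp add: bt_def)
  have d: "{..<d} = {..i} \<union> {i<..<d}" using i by auto
  have split: "(\<Prod>j<d. 1 - clip01 (\<beta> j)) = (\<Prod>j\<le>i. 1 - clip01 (\<beta> j)) * (\<Prod>j\<in>{i<..<d}. 1 - clip01 (\<beta> j))"
    unfolding d by (rule prod.union_disjoint) auto
  have pos: "(\<Prod>j\<le>i. 1 - clip01 (\<beta> j)) > 0" using clip01_bounds by (intro prod_pos) auto
  have cancel: "x * Q = (P * Q) * (x / P)" if "P > 0" for x P Q :: real using that by simp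
  show ?thesis unfolding pc_def pp_def odds_def b split by (rule cancel[OF pos])
qed

lemma one_minus_weighted:
  assumes v: "v \<noteq> []"
  shows "1 - (\<Sum>i<N v. pc (N v) (bt v (e v)) i * (1 - y i)) =
    pp (N v) (bt v (e v)) * (1 + (\<Sum>i<N v. odds i (e v) * y i))"
proof -
  have "(\<Sum>i<N v. pc (N v) (bt v (e v)) i * (1 - y i)) =
      (\<Sum>i<N v. pc (N v) (bt v (e v)) i) - (\<Sum>i<N v. pc (N v) (bt v (e v)) i * y i)"
    by (simp add: right_diff_distrib sum_subtractf)
  moreover have "(\<Sum>i<N v. pc (N v) (bt v (e v)) i * y i) = pp (N v) (bt v (e v)) * (\<Sum>i<N v. odds i (e v) * y i)"
    by (simp add: sum_distrib_left pc_eq_odds[OF v] mult.assoc)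
  ultimately show ?thesis using pp_plus_pc[of "N v" "bt v (e v)"] by (simp add: distrib_left)
qed

text \<open>Dividing the recursion of \<open>xx\<close> by the parent's probability turns step
  probabilities into odds, and 1 - 1/(1 + S) is \<open>esc S\<close>.\<close>

lemma xx_eq_Yn: "v \<noteq> [] \<Longrightarrow> xx N e n v = 1 - MT.Yn n (mk N e v)"
proof (induction n arbitrary: v)
  case (Suc n)
  let ?p = "pp (N v) (bt v (e v))" and ?y = "\<lambda>i. MT.Yn n (mk N e (v @ [i]))"
  let ?S = "\<Sum>i<N v. odds i (e v) * ?y i"
  have S: "0 \<le> ?S" using MT.Yn_bounds odds_pos by (intro sum_nonneg mult_nonneg_nonneg) (auto intro: less_imp_le)
  have "xx N e (Suc n) v = ?p / (1 - (\<Sum>i<N v. pc (N v) (bt v (e v)) i * (1 - ?y i)))"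
    by (simp add: Suc.IH)
  also have "\<dots> = ?p / (?p * (1 + ?S))" by (simp only: one_minus_weighted[where N = N and e = e and y = ?y, OF Suc.prems])
  also have "\<dots> = 1 / (1 + ?S)" using pp_pos[OF Suc.prems, of "N v" "e v"] by simp
  also have "\<dots> = 1 - esc ?S" using S by (simp add: esc_def field_simps)
  also have "esc ?S = MT.Yn (Suc n) (mk N e v)" by simp
  finally show ?case .
qed simp

lemma ss_LIMSEQ: "(\<lambda>n. ss N e n v) \<longlonglongrightarrow> sv N e v"
  unfolding ss_def sv_def Y_def
  by (intro tendsto_intros) (simp add: xx_eq_Yn del: append_assoc, intro tendsto_intros MT.Ylim_LIMSEQ)

text \<open>Let the allowed depth grow in \<open>esum_lw\<close>: the sets of excursions increase,
  and \<open>ss\<close> converges to \<open>sv\<close>.\<close>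

lemma esum_lw_excU: "esum (\<lambda>q. ennreal (lw N e q)) (excU N k v) = ennreal (sv N e v ^ k)"
proof -
  let ?f = "\<lambda>n. esum (\<lambda>q. ennreal (lw N e q)) (exc N n k v)"
  have "incseq ?f"
  proof (rule incseq_SucI)
    fix n
    show "?f n \<le> ?f (Suc n)"
      unfolding esum_indicator using exc_mono_Suc[of N n k v]
      by (intro nn_integral_mono mult_left_mono) (auto simp: indicator_def)
  qed
  then have "?f \<longlonglongrightarrow> (SUP n. ?f n)" by (rule LIMSEQ_SUP)
  then have "(\<lambda>n. ?f (Suc n)) \<longlonglongrightarrow> (SUP n. ?f n)" by (rule LIMSEQ_Suc)
  then have "(\<lambda>n. ennreal (ss N e n v ^ k)) \<longlonglongrightarrow> (SUP n. ?f n)" by (simp only: esum_lw(2))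
  moreover have "(\<lambda>n. ennreal (ss N e n v ^ k)) \<longlonglongrightarrow> ennreal (sv N e v ^ k)"
    by (intro tendsto_ennrealI tendsto_power ss_LIMSEQ)
  ultimately have "(SUP n. ?f n) = ennreal (sv N e v ^ k)" by (rule LIMSEQ_unique)
  then show ?thesis unfolding excU_def by (simp add: esum_incseq[OF incseq_exc])
qed

lemma Y_eq: "v \<noteq> [] \<Longrightarrow> pp (N v) (bt v (e v)) / (1 - sv N e v) = 1 - Y N e v"
proof -
  assume v: "v \<noteq> []"
  let ?p = "pp (N v) (bt v (e v))"
  let ?S = "\<Sum>i<N v. odds i (e v) * Y N e (v @ [i])"
  have S: "0 \<le> ?S" using Y_bounds odds_pos by (intro sum_nonneg mult_nonneg_nonneg) (auto intro: less_imp_le)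
  have "?p / (1 - sv N e v) = ?p / (?p * (1 + ?S))" by (simp only: sv_def one_minus_weighted[where N = N and e = e and y = "\<lambda>i. Y N e (v @ [i])", OF v])
  also have "\<dots> = 1 / (1 + ?S)" using pp_pos[OF v, of "N v" "e v"] by simp
  also have "\<dots> = 1 - esc ?S" using S by (simp add: esc_def field_simps)
  also have "esc ?S = Y N e v"
    unfolding Y_def MT.Ylim_eq[of "mk N e v"] MT.Ysum_def by simp
  finally show ?thesis .
qed

lemma esum_lw_excsU:
  assumes v: "v \<noteq> []"
  shows "esum (\<lambda>q. ennreal (lw N e q)) (excsU N v) * ennreal (pp (N v) (bt v (e v))) = ennreal (1 - Y N e v)"
proof -
  have s: "0 \<le> sv N e v" "sv N e v < 1"
    using sv_bounds[of N e v] pp_pos[OF v, of "N v" "e v"] by auto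
  have "esum (\<lambda>q. ennreal (lw N e q)) (excsU N v) = esum (\<lambda>j. esum (\<lambda>q. ennreal (lw N e q)) (excU N j v)) UNIV"
    unfolding excsU_def by (rule esum_UN[OF _ disjoint_exc(2)]) simp
  also have "\<dots> = ennreal (1 / (1 - sv N e v))"
    unfolding esum_lw_excU esum_nat by (rule geometric_ennreal[OF s])
  also have "\<dots> * ennreal (pp (N v) (bt v (e v))) = ennreal (pp (N v) (bt v (e v)) / (1 - sv N e v))"
    using s pp_nonneg by (simp add: ennreal_mult[symmetric])
  finally show ?thesis by (simp only: Y_eq[OF v])
qed

text \<open>In a fixed environment the returns are independent trials, so the return events of the
  reinforced walk are the moments of one random variable.\<close>

lemma emeasure_Ret_eq:
  assumes "\<Delta> > 0" "a = 1 / (2 * \<Delta>)"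
  shows "emeasure (errw (gw_tree N) \<Delta>) (Ret N k) = (\<integral>\<^sup>+e. ennreal (sv N e [] ^ k) \<partial>env a)"
  by (simp only: emeasure_Ret[OF assms] esum_lw_excU)

lemma recurrent_of_Y:
  assumes "\<Delta> > 0" "a = 1 / (2 * \<Delta>)" and N: "N [] > 0"
    and Y: "AE e in env a. \<forall>i<N []. Y N e [i] = 0"
  shows "errw_recurrent (gw_tree N) \<Delta>"
proof -
  interpret E: prob_space "env a" by (rule prob_space_env[OF a_pos])
  interpret W: prob_space "errw (gw_tree N) \<Delta>" by (rule prob_space_errw)
  \<comment> \<open>The first stick of the root is frozen at 1, so no mass goes to a parent, and
    certain return from all children gives \<open>sv\<close> = 1.\<close>
  have pp0: "pp (N []) (bt [] \<beta>) = 0" for \<beta>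
    unfolding pp_def using N by (intro prod_zero) (auto simp: bt_def)
  have "AE X in errw (gw_tree N) \<Delta>. X \<in> Ret N k" for k
  proof -
    have "emeasure (errw (gw_tree N) \<Delta>) (Ret N k) = (\<integral>\<^sup>+e. ennreal (sv N e [] ^ k) \<partial>env a)"
      by (rule emeasure_Ret_eq[OF assms(1,2)])
    also have "\<dots> = (\<integral>\<^sup>+e. 1 \<partial>env a)"
    proof (rule nn_integral_cong_AE, use Y in eventually_elim)
      fix e assume "\<forall>i<N []. Y N e [i] = 0"
      then have "sv N e [] = 1" using pp_plus_pc[of "N []" "bt [] (e [])"] by (simp add: sv_def pp0)
      then show "ennreal (sv N e [] ^ k) = 1" by simp
    qed
    finally have "W.prob (Ret N k) = 1" by (simp add: E.emeasure_space_1 W.emeasure_eq_measure)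
    then show ?thesis using W.AE_in_set_eq_1[OF Ret_sets] by simp
  qed
  then have "AE X in errw (gw_tree N) \<Delta>. \<forall>k. X \<in> Ret N k" by (simp add: AE_all_countable)
  then show ?thesis unfolding errw_recurrent_def
  proof (rule eventually_mono)
    fix X assume "\<forall>k. X \<in> Ret N k"
    then show "\<exists>\<^sub>\<infinity>n. X n = []" by (intro Ret_all_imp_infinitely_many[of X N]) auto
  qed
qed

lemma Y_measurable:
  assumes "v \<noteq> []"
  shows "(\<lambda>e. Y N e v) \<in> borel_measurable (env a)"
proof -
  have "(\<lambda>e. mk N e v) \<in> env a \<rightarrow>\<^sub>M MT.Om"
  proof (rule measurable_PiM_single')
    fix w
    have "(\<lambda>e. e (v @ w)) \<in> env a \<rightarrow>\<^sub>M env_sticks a (v @ w)"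
      unfolding env_def by (rule measurable_component_singleton) simp
    then have "(\<lambda>e. e (v @ w)) \<in> env a \<rightarrow>\<^sub>M stick_measure a"
      using assms by (simp add: env_sticks_child)
    then show "(\<lambda>e. (N (v @ w), e (v @ w))) \<in> env a \<rightarrow>\<^sub>M mark"
      by (intro measurable_Pair) simp_all
  next
    show "(\<lambda>e w. (N (v @ w), e (v @ w))) \<in> space (env a) \<rightarrow> (UNIV \<rightarrow>\<^sub>E space mark)"
      using assms sets_eq_imp_space_eq[OF sets_env_sticks] sets_eq_imp_space_eq[OF sets_stick_measure]
      by (auto simp: env_def space_PiM space_pair_measure)
  qed
  from measurable_compose[OF this MT.Ylim_measurable] show ?thesis unfolding Y_def .
qed

lemma pc_root_measurable:
  fixes N :: "vertex \<Rightarrow> nat"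
  shows "(\<lambda>e. pc (N []) (bt [] (e [])) j) \<in> borel_measurable (env a)"
proof -
  have "pr N e [] [j] = pc (N []) (bt [] (e [])) j" for e using pr_child[of N e "[]" j] by simp
  then show ?thesis using pr_measurable[of N "[]" "[j]" a] by (simp only:)
qed

text \<open>One child with positive escape probability suffices: its step probability is positive,
  so \<open>sv\<close> is below 1, and its moments tend to 0 together with the probability of all
  returns.\<close>

lemma transient_of_Y:
  assumes \<Delta>: "\<Delta> > 0" "a = 1 / (2 * \<Delta>)" and i: "i < N []"
    and Y: "AE e in env a. Y N e [i] > 0"
  shows "errw_transient (gw_tree N) \<Delta>"
proof -
  interpret E: prob_space "env a" by (rule prob_space_env[OF a_pos])
  interpret W: prob_space "errw (gw_tree N) \<Delta>" by (rule prob_space_errw)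
  have pcm: "(\<lambda>e. pc (N []) (bt [] (e [])) j) \<in> borel_measurable (env a)" for j
    by (rule pc_root_measurable)
  have svm: "(\<lambda>e. sv N e []) \<in> borel_measurable (env a)"
    unfolding sv_def
    by (intro borel_measurable_sum borel_measurable_times borel_measurable_diff borel_measurable_const pcm Y_measurable) simp
  have "(\<lambda>k. \<integral>\<^sup>+e. ennreal (sv N e [] ^ k) \<partial>env a) \<longlonglongrightarrow> (\<integral>\<^sup>+e. 0 \<partial>env a)"
  proof (rule nn_integral_dominated_convergence[where w = "\<lambda>_. 1"])
    show "AE e in env a. ennreal (sv N e [] ^ k) \<le> 1" for k
      using sv_bounds pp_nonneg by (intro AE_I2) (auto simp: ennreal_le_1 intro!: power_le_one order_trans[OF sv_bounds(2)])
    show "AE e in env a. (\<lambda>k. ennreal (sv N e [] ^ k)) \<longlonglongrightarrow> 0"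
      using Y
    proof eventually_elim
      fix e assume y: "Y N e [i] > 0"
      have "sv N e [] < (\<Sum>i<N []. pc (N []) (bt [] (e [])) i)"
        unfolding sv_def
      proof (rule sum_strict_mono_ex1)
        show "\<forall>j\<in>{..<N []}. pc (N []) (bt [] (e [])) j * (1 - Y N e ([] @ [j])) \<le> pc (N []) (bt [] (e [])) j"
          using Y_bounds by (auto intro!: mult_left_le simp: pc_nonneg)
        show "\<exists>j\<in>{..<N []}. pc (N []) (bt [] (e [])) j * (1 - Y N e ([] @ [j])) < pc (N []) (bt [] (e [])) j"
          using y i pc_pos[OF i, of "[]" "e []"] by (intro bexI[of _ i]) auto
      qed simp
      also have "\<dots> \<le> 1" using pp_plus_pc[of "N []" "bt [] (e [])"] pp_nonneg[of "N []" "[]" "e []"] by linarith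
      finally have "(\<lambda>k. sv N e [] ^ k) \<longlonglongrightarrow> 0" using sv_bounds by (intro LIMSEQ_realpow_zero) auto
      from tendsto_ennrealI[OF this] show "(\<lambda>k. ennreal (sv N e [] ^ k)) \<longlonglongrightarrow> 0" by simp
    qed
  qed (use svm in \<open>auto simp: E.emeasure_space_1\<close>)
  then have lim: "(\<lambda>k. emeasure (errw (gw_tree N) \<Delta>) (Ret N k)) \<longlonglongrightarrow> 0"
    by (simp add: emeasure_Ret_eq[OF \<Delta>])
  have Is: "(\<Inter>k. Ret N k) \<in> sets (errw (gw_tree N) \<Delta>)" by (rule sets.countable_INT) (auto intro: Ret_sets)
  have "emeasure (errw (gw_tree N) \<Delta>) (\<Inter>k. Ret N k) \<le> 0"
    by (rule LIMSEQ_le_const[OF lim]) (auto intro!: exI[of _ 0] emeasure_mono Ret_sets)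
  then have "(\<Inter>k. Ret N k) \<in> null_sets (errw (gw_tree N) \<Delta>)" using Is by auto
  note notin = AE_not_in[OF this]
  have "AE X in errw (gw_tree N) \<Delta>. X 0 = [] \<and> (\<forall>n. X (Suc n) \<in> nbrs (gw_tree N) (X n))"
    using i by (intro AE_nearest_neighbour[OF \<Delta>(1)]) auto
  with notin show ?thesis unfolding errw_transient_def
  proof eventually_elim
    fix X assume X: "X \<notin> (\<Inter>k. Ret N k)" "X 0 = [] \<and> (\<forall>n. X (Suc n) \<in> nbrs (gw_tree N) (X n))"
    show "\<not> (\<exists>\<^sub>\<infinity>n. X n = [])"
    proof
      assume "\<exists>\<^sub>\<infinity>n. X n = []"
      then have "X \<in> Ret N k" for k using X(2) by (intro infinitely_many_imp_Ret) auto
      with X(1) show False by blast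
    qed
  qed
qed

end

section \<open>Return time\<close>

lemma return_time_cyl:
  assumes p: "p \<in> excU N 1 []" and X: "X \<in> cyl p"
  shows "of_nat (length p - 1) \<le> return_time X"
  unfolding return_time_def
proof (rule INF_greatest)
  fix n assume n: "n \<in> {n. n > 0 \<and> X n = []}"
  have pr: "p \<noteq> []" "hd p = []" "last p = []" "count_list p [] = 2" using excs_props(3)[OF p] by auto
  have "length p - 1 \<le> n"
  proof (rule ccontr)
    assume "\<not> ?thesis"
    then have n': "n < length p - 1" by simp
    \<comment> \<open>An earlier return would be a third visit to the root in a word that has
      exactly two, at its ends.\<close>
    have "{0, n, length p - 1} \<subseteq> {i. i < length p \<and> [] = p ! i}"
      using pr n n' X by (auto simp: cyl_def hd_conv_nth last_conv_nth)
    then have "card {0, n, length p - 1} \<le> card {i. i < length p \<and> [] = p ! i}"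
      by (intro card_mono) auto
    also have "\<dots> = count_list p []" by (simp add: count_list_eq_length_filter length_filter_conv_card)
    also have "card {0, n, length p - 1} = 3" using n n' by auto
    finally show False using pr by simp
  qed
  then show "of_nat (length p - 1) \<le> (of_nat n :: ennreal)" by (simp add: of_nat_mono)
qed

lemma nn_integral_return_time_ge:
  assumes "\<Delta> > 0" "a = 1 / (2 * \<Delta>)"
  shows "(\<integral>\<^sup>+e. esum (\<lambda>q. of_nat (length q - 1) * ennreal (lw N e q)) (excU N 1 []) \<partial>env a) \<le>
    (\<integral>\<^sup>+X. return_time X \<partial>errw (gw_tree N) \<Delta>)"
proof -
  have "(\<integral>\<^sup>+e. esum (\<lambda>q. of_nat (length q - 1) * ennreal (lw N e q)) (excU N 1 []) \<partial>env a) =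
      esum (\<lambda>q. \<integral>\<^sup>+e. of_nat (length q - 1) * ennreal (lw N e q) \<partial>env a) (excU N 1 [])"
    unfolding esum_def by (rule nn_integral_count_space_nn_integral) auto
  also have "\<dots> = esum (\<lambda>q. of_nat (length q - 1) * emeasure (errw (gw_tree N) \<Delta>) (cyl q)) (excU N 1 [])"
    by (rule esum_cong) (simp add: nn_integral_cmult emeasure_cyl[OF assms])
  also have "\<dots> = esum (\<lambda>q. \<integral>\<^sup>+X. of_nat (length q - 1) * indicator (cyl q) X \<partial>errw (gw_tree N) \<Delta>) (excU N 1 [])"
    by (rule esum_cong) (subst nn_integral_cmult_indicator, auto)
  also have "\<dots> = (\<integral>\<^sup>+X. esum (\<lambda>q. of_nat (length q - 1) * indicator (cyl q) X) (excU N 1 []) \<partial>errw (gw_tree N) \<Delta>)"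
    unfolding esum_def by (rule nn_integral_count_space_nn_integral[symmetric]) auto
  also have "\<dots> \<le> (\<integral>\<^sup>+X. return_time X \<partial>errw (gw_tree N) \<Delta>)"
  proof (rule nn_integral_mono)
    fix X
    show "esum (\<lambda>q. of_nat (length q - 1) * indicator (cyl q) X) (excU N 1 []) \<le> return_time X"
    proof (cases "\<exists>q\<in>excU N 1 []. X \<in> cyl q")
      case True
      then obtain q where q: "q \<in> excU N 1 []" "X \<in> cyl q" by blast
      have "esum (\<lambda>q'. of_nat (length q' - 1) * indicator (cyl q') X) (excU N 1 []) =
          esum (\<lambda>q'. of_nat (length q - 1) * indicator {q} q') (excU N 1 [])"
        using q disjoint_cyl[of N 1] by (intro esum_cong) (auto simp: indicator_def disjoint_family_on_def)
      also have "\<dots> = of_nat (length q - 1)"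
        using q(1) unfolding esum_def by (subst nn_integral_cmult_indicator) auto
      also have "\<dots> \<le> return_time X" by (rule return_time_cyl[OF q])
      finally show ?thesis .
    next
      case False
      then have "esum (\<lambda>q. of_nat (length q - 1) * indicator (cyl q) X) (excU N 1 []) = esum (\<lambda>q. 0) (excU N 1 [])"
        by (intro esum_cong) (auto simp: indicator_def)
      then show ?thesis by (simp add: esum_def)
    qed
  qed
  finally show ?thesis .
qed

section \<open>Mean excursion lengths and their growth along the tree\<close>

context errw_environment
begin

text \<open>The number of vertices of the word counts the steps, including the final one to the
  parent, whose probability is the last factor. If the escape probability is 0, the weights sum to 1
  and this is an expectation.\<close>

definition ell :: "(vertex \<Rightarrow> nat) \<Rightarrow> (vertex \<Rightarrow> nat \<Rightarrow> real) \<Rightarrow> vertex \<Rightarrow> ennreal" where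
  "ell N e v = esum (\<lambda>q. of_nat (length q) * ennreal (lw N e q)) (excsU N v) * ennreal (pp (N v) (bt v (e v)))"

text \<open>The mean length of an excursion into the subtree of \<open>v\<close>, set to infinity if the excursion
  escapes with positive probability.\<close>

definition J :: "(vertex \<Rightarrow> nat) \<Rightarrow> (vertex \<Rightarrow> nat \<Rightarrow> real) \<Rightarrow> vertex \<Rightarrow> ennreal" where
  "J N e v = (if Y N e v = 0 then ell N e v else \<infinity>)"

text \<open>The word \<open>v # p @ q\<close> is longer than \<open>p\<close> and \<open>q\<close>
  together by 1. By hypothesis the excursions of each child have total mass 1, so the length of
  \<open>q\<close> contributes the previous sum times the child's probability.\<close>

lemma esum_length_Suc:
  assumes one: "\<And>i. i < N v \<Longrightarrow> Y N e (v @ [i]) = 0"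
  shows "esum (\<lambda>q. of_nat (length q) * ennreal (lw N e q)) (excU N (Suc j) v) =
    (\<Sum>i<N v. ennreal (pc (N v) (bt v (e v)) i) * (1 + ell N e (v @ [i]))) * ennreal (sv N e v ^ j) +
    (\<Sum>i<N v. ennreal (pc (N v) (bt v (e v)) i)) * esum (\<lambda>q. of_nat (length q) * ennreal (lw N e q)) (excU N j v)"
proof -
  let ?L = "esum (\<lambda>q. of_nat (length q) * ennreal (lw N e q)) (excU N j v)"
  let ?c = "\<lambda>i. ennreal (pc (N v) (bt v (e v)) i)" and ?w = "\<lambda>q. ennreal (lw N e q)"
  let ?p = "\<lambda>i. ennreal (pp (N (v @ [i])) (bt (v @ [i]) (e (v @ [i]))))"
  have X: "esum (\<lambda>q. ennreal (lw N e q)) (excsU N (v @ [i])) * ?p i = 1" if "i < N v" for i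
    using esum_lw_excsU[of "v @ [i]" N e] one[OF that] by simp
  have first: "esum (\<lambda>p. esum (\<lambda>q. of_nat (length (v # p @ q)) * ?w (v # p @ q)) (excU N j v)) (excsU N (v @ [i])) =
      ?c i * (1 + ell N e (v @ [i])) * ennreal (sv N e v ^ j) + ?c i * ?L" if i: "i < N v" for i
  proof -
    have "esum (\<lambda>q. of_nat (length (v # p @ q)) * ?w (v # p @ q)) (excU N j v) =
        (?c i * ?p i * ennreal (sv N e v ^ j)) * (?w p + of_nat (length p) * ?w p) + (?c i * ?p i * ?L) * ?w p"
      if p: "p \<in> excsU N (v @ [i])" for p
    proof -
      have "esum (\<lambda>q. of_nat (length (v # p @ q)) * ?w (v # p @ q)) (excU N j v) =
          esum (\<lambda>q. (?c i * (?w p * ?p i) * (1 + of_nat (length p))) * ?w q + (?c i * (?w p * ?p i)) * (of_nat (length q) * ?w q)) (excU N j v)"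
      proof (rule esum_cong)
        fix q assume q: "q \<in> excU N j v"
        have "?w (v # p @ q) = ?c i * (?w p * ?p i) * ?w q"
          using excs_props(2)[OF p] excs_props(3)[OF q] by (intro lw_excursion) auto
        then show "of_nat (length (v # p @ q)) * ?w (v # p @ q) =
            (?c i * (?w p * ?p i) * (1 + of_nat (length p))) * ?w q + (?c i * (?w p * ?p i)) * (of_nat (length q) * ?w q)"
          by (simp add: distrib_left distrib_right mult_ac add_ac)
      qed
      also have "\<dots> = (?c i * (?w p * ?p i) * (1 + of_nat (length p))) * ennreal (sv N e v ^ j) + (?c i * (?w p * ?p i)) * ?L"
        unfolding esum_add esum_cmult esum_lw_excU ..
      finally show ?thesis by (simp add: distrib_left distrib_right mult_ac)
    qed
    then have "esum (\<lambda>p. esum (\<lambda>q. of_nat (length (v # p @ q)) * ?w (v # p @ q)) (excU N j v)) (excsU N (v @ [i])) =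
        esum (\<lambda>p. (?c i * ?p i * ennreal (sv N e v ^ j)) * (?w p + of_nat (length p) * ?w p) + (?c i * ?p i * ?L) * ?w p) (excsU N (v @ [i]))"
      by (rule esum_cong)
    also have "\<dots> = (?c i * ?p i * ennreal (sv N e v ^ j)) * (esum ?w (excsU N (v @ [i])) + esum (\<lambda>p. of_nat (length p) * ?w p) (excsU N (v @ [i])))
        + (?c i * ?p i * ?L) * esum ?w (excsU N (v @ [i]))"
      unfolding esum_add esum_cmult ..
    also have "\<dots> = ?c i * ennreal (sv N e v ^ j) * (esum ?w (excsU N (v @ [i])) * ?p i + ell N e (v @ [i])) + ?c i * ?L * (esum ?w (excsU N (v @ [i])) * ?p i)"
      unfolding ell_def by (simp add: distrib_left distrib_right mult_ac)
    also have "\<dots> = ?c i * (1 + ell N e (v @ [i])) * ennreal (sv N e v ^ j) + ?c i * ?L"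
      unfolding X[OF i] by (simp add: mult_ac)
    finally show ?thesis .
  qed
  have "esum (\<lambda>q. of_nat (length q) * ?w q) (excU N (Suc j) v) =
      (\<Sum>i<N v. ?c i * (1 + ell N e (v @ [i])) * ennreal (sv N e v ^ j) + ?c i * ?L)"
    unfolding esum_excU_Suc by (rule sum.cong[OF refl], rule first) simp
  then show ?thesis by (simp only: sum.distrib sum_distrib_right)
qed

text \<open>A renewal inequality: summing \<open>esum_length_Suc\<close> over the number of returns
  gives S/p + (1 - p) Z \<le> Z, with p the parent's probability. Hence S/p is at most p Z, the mean
  length at \<open>v\<close>, and the division by p turns step probabilities into odds.\<close>

lemma J_ge:
  assumes v: "v \<noteq> []"
  shows "(\<Sum>i<N v. ennreal (odds i (e v)) * (1 + J N e (v @ [i]))) \<le> J N e v"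
proof (cases "Y N e v = 0")
  case False
  then show ?thesis by (simp add: J_def)
next
  case True
  let ?p = "pp (N v) (bt v (e v))" and ?c = "\<lambda>i. pc (N v) (bt v (e v)) i"
  have p: "0 < ?p" by (rule pp_pos[OF v])
  have "MT.Ylim (mk N e v) = 0" using True by (simp add: Y_def)
  then have Y0: "Y N e (v @ [i]) = 0" if "i < N v" for i
    using MT.Ylim_eq_0_iff[of "mk N e v"] that by (simp add: Y_def)
  have s: "sv N e v = 1 - ?p"
    using pp_plus_pc[of "N v" "bt v (e v)"] Y0 unfolding sv_def by simp
  then have s01: "0 \<le> 1 - ?p" using sv_bounds(1)[of N e v] by simp
  define S where "S = (\<Sum>i<N v. ennreal (?c i) * (1 + ell N e (v @ [i])))"
  let ?L = "\<lambda>j. esum (\<lambda>q. of_nat (length q) * ennreal (lw N e q)) (excU N j v)"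
  define Z where "Z = (\<Sum>j. ?L j)"
  have csum: "(\<Sum>i<N v. ennreal (?c i)) = ennreal (1 - ?p)"
  proof -
    have "(\<Sum>i<N v. ennreal (?c i)) = ennreal (\<Sum>i<N v. ?c i)" by (rule sum_ennreal) (rule pc_nonneg)
    also have "(\<Sum>i<N v. ?c i) = 1 - ?p" using pp_plus_pc[of "N v" "bt v (e v)"] by linarith
    finally show ?thesis .
  qed
  have LS: "?L (Suc j) = S * ennreal ((1 - ?p) ^ j) + ennreal (1 - ?p) * ?L j" for j
    using esum_length_Suc[of N v e j] Y0 by (simp only: S_def csum s)
  have ellZ: "ell N e v = Z * ennreal ?p"
  proof -
    have "esum (\<lambda>q. of_nat (length q) * ennreal (lw N e q)) (excsU N v) = esum ?L UNIV"
      unfolding excsU_def by (rule esum_UN[OF _ disjoint_exc(2)]) simp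
    then show ?thesis by (simp only: ell_def esum_nat Z_def)
  qed
  have geo: "(\<Sum>j. ennreal ((1 - ?p) ^ j)) = ennreal (1 / ?p)"
    using geometric_ennreal[OF s01] p by simp
  have "(\<Sum>j. ?L (Suc j)) = S * ennreal (1 / ?p) + ennreal (1 - ?p) * Z"
  proof -
    have "(\<Sum>j. ?L (Suc j)) = (\<Sum>j. S * ennreal ((1 - ?p) ^ j)) + (\<Sum>j. ennreal (1 - ?p) * ?L j)"
      unfolding LS by (rule suminf_add[symmetric]) auto
    also have "\<dots> = S * ennreal (1 / ?p) + ennreal (1 - ?p) * Z"
      unfolding ennreal_suminf_cmult geo Z_def ..
    finally show ?thesis .
  qed
  moreover have "(\<Sum>j. ?L (Suc j)) \<le> Z"
  proof -
    have "Z = ?L 0 + (\<Sum>j. ?L (Suc j))"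
      unfolding Z_def using suminf_offset[of ?L 1] by simp
    then show ?thesis by simp
  qed
  ultimately have le: "S * ennreal (1 / ?p) + ennreal (1 - ?p) * Z \<le> Z" by simp
  \<comment> \<open>Cancelling the common term requires finite \<open>Z\<close>; for infinite
    \<open>Z\<close> the right side is infinite.\<close>
  have SZ: "S * ennreal (1 / ?p) \<le> Z * ennreal ?p"
  proof (cases "Z = \<infinity>")
    case True
    then show ?thesis using p by (simp add: ennreal_top_mult)
  next
    case False
    have "Z = ennreal ?p * Z + ennreal (1 - ?p) * Z"
      using p s01 by (simp add: distrib_right[symmetric] ennreal_plus[symmetric] del: ennreal_plus)
    with le have "S * ennreal (1 / ?p) + ennreal (1 - ?p) * Z \<le> ennreal ?p * Z + ennreal (1 - ?p) * Z" by simp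
    moreover have "ennreal (1 - ?p) * Z \<noteq> \<infinity>" using False by (simp add: ennreal_mult_eq_top_iff)
    ultimately show ?thesis by (simp add: ennreal_add_left_cancel_le add.commute[of _ "ennreal (1 - ?p) * Z"] mult.commute)
  qed
  have "(\<Sum>i<N v. ennreal (odds i (e v)) * (1 + J N e (v @ [i]))) = S * ennreal (1 / ?p)"
    unfolding S_def sum_distrib_right
  proof (intro sum.cong refl)
    fix i assume "i \<in> {..<N v}"
    then have i: "i < N v" by simp
    have "?c i * (1 / ?p) = odds i (e v)" using pc_eq_odds[OF v i, of "e v"] p by simp
    then have "ennreal (odds i (e v)) = ennreal (?c i) * ennreal (1 / ?p)"
      using p pc_nonneg by (metis ennreal_mult less_imp_le zero_le_divide_1_iff)
    then show "ennreal (odds i (e v)) * (1 + J N e (v @ [i])) = ennreal (?c i) * (1 + ell N e (v @ [i])) * ennreal (1 / ?p)"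
      using Y0[OF i] by (simp add: J_def mult_ac)
  qed
  also have "\<dots> \<le> J N e v" using SZ True by (simp add: J_def ellZ)
  finally show ?thesis .
qed

lemma ell_measurable: "(\<lambda>e. ell N e v) \<in> borel_measurable (env a)"
proof -
  have sum: "(\<lambda>e. esum (\<lambda>q. of_nat (length q) * ennreal (lw N e q)) (excsU N v)) \<in> borel_measurable (env a)"
    unfolding esum_def
  proof (rule sigma_finite_measure.borel_measurable_nn_integral)
    show "sigma_finite_measure (count_space (excsU N v))" by (rule sigma_finite_measure_count_space_countable) simp
    show "(\<lambda>(e, q). of_nat (length q) * ennreal (lw N e q)) \<in> borel_measurable (env a \<Otimes>\<^sub>M count_space (excsU N v))"
    proof -
      have "(\<lambda>(q, e). of_nat (length q) * ennreal (lw N e q)) \<in> borel_measurable (count_space (excsU N v) \<Otimes>\<^sub>M env a)"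
        by (rule measurable_pair_measure_countable1) auto
      from measurable_pair_swap[OF this] show ?thesis by (simp add: case_prod_beta')
    qed
  qed
  show ?thesis
  proof (cases "v = []")
    case True
    have "(\<lambda>\<beta>. pp (N v) (bt v \<beta>)) \<in> borel_measurable (PiM UNIV (\<lambda>_. borel))"
      unfolding pp_def bt_def by measurable
    then have "(\<lambda>\<beta>. pp (N v) (bt v \<beta>)) \<in> borel_measurable (env_sticks a v)"
      by (simp add: measurable_cong_sets[OF sets_env_sticks refl])
    moreover have "(\<lambda>e. e v) \<in> env a \<rightarrow>\<^sub>M env_sticks a v"
      unfolding env_def by (rule measurable_component_singleton) simp
    ultimately have "(\<lambda>e. pp (N v) (bt v (e v))) \<in> borel_measurable (env a)"
      by (rule measurable_compose[rotated])
    then show ?thesis unfolding ell_def using sum by (intro borel_measurable_times_ennreal measurable_compose[OF _ measurable_ennreal])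
  next
    case False
    then obtain w i where w: "v = w @ [i]" by (metis rev_exhaust)
    have "pr N e v w = pp (N v) (bt v (e v))" for e using pr_parent[of N e w i] w by simp
    then have "(\<lambda>e. pp (N v) (bt v (e v))) \<in> borel_measurable (env a)"
      using pr_measurable[of N v w a] by (simp only:)
    then show ?thesis unfolding ell_def using sum by (intro borel_measurable_times_ennreal measurable_compose[OF _ measurable_ennreal])
  qed
qed

lemma J_measurable: "v \<noteq> [] \<Longrightarrow> (\<lambda>e. J N e v) \<in> borel_measurable (env a)"
proof -
  assume v: "v \<noteq> []"
  note [measurable] = ell_measurable Y_measurable[OF v]
  show ?thesis unfolding J_def by measurable
qed

lemma lw_cong: "(\<And>u. u \<in> set q \<Longrightarrow> e u = e' u) \<Longrightarrow> lw N e q = lw N e' q"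
  by (induction N e q rule: lw.induct) (auto simp: pr_def)

lemma J_depends: "depends_on (\<lambda>e. J N e v) {u. prefix v u}"
  unfolding depends_on_def
proof (intro allI impI)
  fix e e' :: "vertex \<Rightarrow> nat \<Rightarrow> real" assume *: "\<forall>u\<in>{u. prefix v u}. e u = e' u"
  have eq: "e u = e' u" if "prefix v u" for u using bspec[OF *, of u] that by simp
  have "mk N e v = mk N e' v" by (rule ext) (simp add: eq)
  then have Y: "Y N e v = Y N e' v" by (simp only: Y_def)
  have "lw N e q = lw N e' q" if "q \<in> excsU N v" for q
    using excs_props(2)[OF that] by (intro lw_cong eq) blast
  then have "esum (\<lambda>q. of_nat (length q) * ennreal (lw N e q)) (excsU N v) = esum (\<lambda>q. of_nat (length q) * ennreal (lw N e' q)) (excsU N v)"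
    by (intro esum_cong) simp
  then show "J N e v = J N e' v" unfolding J_def ell_def Y by (simp only: eq[OF prefix_order.refl])
qed

text \<open>The odds at \<open>v\<close> are independent of the environment below the child, so
  their mean, at least 1, multiplies the mean of 1 + J.\<close>

lemma nn_integral_J_Suc:
  assumes v: "v \<noteq> []" and i: "i < N v"
  shows "1 + (\<integral>\<^sup>+e. J N e (v @ [i]) \<partial>env a) \<le> (\<integral>\<^sup>+e. J N e v \<partial>env a)"
proof -
  interpret E: prob_space "env a" by (rule prob_space_env[OF a_pos])
  have om: "(\<lambda>e. ennreal (odds i (e v))) \<in> borel_measurable (env a)"
    unfolding env_def
    by (rule measurable_compose[OF measurable_component_singleton[of v UNIV]])
       (simp_all add: env_sticks_child[OF v])
  have Jm: "(\<lambda>e. J N e (v @ [i])) \<in> borel_measurable (env a)" by (rule J_measurable) simp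
  have "1 + (\<integral>\<^sup>+e. J N e (v @ [i]) \<partial>env a) = 1 * (\<integral>\<^sup>+e. 1 + J N e (v @ [i]) \<partial>env a)"
    using Jm by (simp add: nn_integral_add E.emeasure_space_1)
  also have "\<dots> \<le> (\<integral>\<^sup>+e. ennreal (odds i (e v)) \<partial>env a) * (\<integral>\<^sup>+e. 1 + J N e (v @ [i]) \<partial>env a)"
  proof (rule mult_right_mono)
    have "(\<integral>\<^sup>+e. ennreal (odds i (e v)) \<partial>env a) = (\<integral>\<^sup>+\<beta>. ennreal (odds i \<beta>) \<partial>env_sticks a v)"
      unfolding env_def by (rule nn_integral_PiM_component[OF prob_space_env_sticks[OF a_pos]]) (simp add: env_sticks_child[OF v])
    also have "\<dots> \<ge> 1" unfolding env_sticks_child[OF v] by (rule odds_mean_ge_1[OF a_pos])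
    finally show "1 \<le> (\<integral>\<^sup>+e. ennreal (odds i (e v)) \<partial>env a)" .
  qed simp
  also have "\<dots> = (\<integral>\<^sup>+e. ennreal (odds i (e v)) * (1 + J N e (v @ [i])) \<partial>env a)"
    unfolding env_def
  proof (rule nn_integral_PiM_indep2[OF prob_space_env_sticks[OF a_pos], symmetric])
    show "(\<lambda>e. ennreal (odds i (e v))) \<in> borel_measurable (PiM UNIV (env_sticks a))" using om by (simp add: env_def)
    show "(\<lambda>e. 1 + J N e (v @ [i])) \<in> borel_measurable (PiM UNIV (env_sticks a))"
      using Jm by (simp add: env_def)
    show "depends_on (\<lambda>e. ennreal (odds i (e v))) {v}" by (simp add: depends_on_def)
    show "depends_on (\<lambda>e. 1 + J N e (v @ [i])) {u. prefix (v @ [i]) u}"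
      unfolding depends_on_def
    proof (intro allI impI)
      fix e e' :: "vertex \<Rightarrow> nat \<Rightarrow> real" assume "\<forall>u\<in>{u. prefix (v @ [i]) u}. e u = e' u"
      then have "J N e (v @ [i]) = J N e' (v @ [i])"
        by (rule J_depends[of N "v @ [i]", unfolded depends_on_def, THEN spec, THEN spec, THEN mp])
      then show "1 + J N e (v @ [i]) = 1 + J N e' (v @ [i])" by (rule arg_cong)
    qed
    show "{v} \<inter> {u. prefix (v @ [i]) u} = {}" by (auto dest: prefix_length_le)
  qed
  also have "\<dots> \<le> (\<integral>\<^sup>+e. J N e v \<partial>env a)"
  proof (rule nn_integral_mono)
    fix e
    have "ennreal (odds i (e v)) * (1 + J N e (v @ [i])) \<le> (\<Sum>i<N v. ennreal (odds i (e v)) * (1 + J N e (v @ [i])))"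
      by (rule member_le_sum) (use i in auto)
    also have "\<dots> \<le> J N e v" by (rule J_ge[OF v])
    finally show "ennreal (odds i (e v)) * (1 + J N e (v @ [i])) \<le> J N e v" .
  qed
  finally show ?thesis .
qed

lemma gw_tree_prefix: "u @ w \<in> gw_tree N \<Longrightarrow> u \<in> gw_tree N"
  by (induction w rule: rev_induct) (auto simp: snoc_mem_gw_tree_iff append_assoc[symmetric] simp del: append_assoc)

lemma nn_integral_J_ge_height:
  "v \<noteq> [] \<Longrightarrow> v @ w \<in> gw_tree N \<Longrightarrow> of_nat (length w) \<le> (\<integral>\<^sup>+e. J N e v \<partial>env a)"
proof (induction w arbitrary: v)
  case (Cons i w)
  have mem: "(v @ [i]) @ w \<in> gw_tree N" using Cons.prems by simp
  then have "i < N v" using gw_tree_prefix[OF mem] by (simp add: snoc_mem_gw_tree_iff)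
  have "of_nat (length (i # w)) = 1 + (of_nat (length w) :: ennreal)" by simp
  also have "\<dots> \<le> 1 + (\<integral>\<^sup>+e. J N e (v @ [i]) \<partial>env a)" using Cons.IH[OF _ mem] by (intro add_left_mono) simp
  also have "\<dots> \<le> (\<integral>\<^sup>+e. J N e v \<partial>env a)" by (rule nn_integral_J_Suc[where N = N and v = v and i = i, OF Cons.prems(1) \<open>i < N v\<close>])
  finally show ?case .
qed simp

text \<open>Some child of the root has an infinite subtree, which by finite branching contains words
  of every length.\<close>

lemma ex_infinite_J:
  assumes "infinite (gw_tree N)"
  shows "\<exists>i<N []. (\<integral>\<^sup>+e. J N e [i] \<partial>env a) = \<infinity>"
proof -
  from assms obtain i where i: "i < N []" "infinite (gw_tree (\<lambda>w. N (i # w)))"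
    using finite_gw_tree_children[of N] by auto
  have "of_nat n \<le> (\<integral>\<^sup>+e. J N e [i] \<partial>env a)" for n
  proof -
    have "\<not> dead n (\<lambda>w. N (i # w))" using i(2) dead_imp_finite by blast
    then obtain w where w: "w \<in> gw_tree (\<lambda>w. N (i # w))" "n \<le> length w"
      using dead_if_bounded[of "\<lambda>w. N (i # w)" n] by (meson not_le)
    have "[i] @ w \<in> gw_tree N" using w i by (simp add: Cons_mem_gw_tree_iff)
    then have "of_nat (length w) \<le> (\<integral>\<^sup>+e. J N e [i] \<partial>env a)" by (intro nn_integral_J_ge_height) auto
    moreover have "(of_nat n :: ennreal) \<le> of_nat (length w)" using w(2) by (simp add: of_nat_mono)
    ultimately show ?thesis by (rule order_trans[rotated])
  qed
  then have ge: "of_nat n \<le> (\<integral>\<^sup>+e. J N e [i] \<partial>env a)" for n .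
  have "(\<integral>\<^sup>+e. J N e [i] \<partial>env a) = \<infinity>"
  proof (rule ccontr)
    assume "\<not> ?thesis"
    then obtain r where r: "(\<integral>\<^sup>+e. J N e [i] \<partial>env a) = ennreal r" "0 \<le> r"
      by (cases "\<integral>\<^sup>+e. J N e [i] \<partial>env a") auto
    obtain n where "r < real n" using reals_Archimedean2 by blast
    moreover have "ennreal (real n) \<le> ennreal r"
      using ge[of n] unfolding r(1) by (simp add: ennreal_of_nat_eq_real_of_nat)
    ultimately show False using r(2) by simp
  qed
  with i show ?thesis by blast
qed

text \<open>If escape through child \<open>i\<close> has positive probability, the return time is
  infinite with positive probability. Otherwise the excursions through \<open>i\<close> alone have
  infinite mean, because the root's step probability has positive mean and is independent of
  \<open>J\<close> below. The result holds for every infinite tree, not just almost every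
  one.\<close>

theorem infinite_return_time:
  assumes \<Delta>: "\<Delta> > 0" "a = 1 / (2 * \<Delta>)" and inf: "infinite (gw_tree N)"
  shows "(\<integral>\<^sup>+X. return_time X \<partial>errw (gw_tree N) \<Delta>) = \<infinity>"
proof -
  interpret E: prob_space "env a" by (rule prob_space_env[OF a_pos])
  interpret W: prob_space "errw (gw_tree N) \<Delta>" by (rule prob_space_errw)
  obtain i where i: "i < N []" "(\<integral>\<^sup>+e. J N e [i] \<partial>env a) = \<infinity>" using ex_infinite_J[OF inf] by blast
  then have N: "N [] > 0" by simp
  show ?thesis
  proof (cases "AE e in env a. Y N e [i] = 0")
    case False
    have Rs: "Ret N 1 \<in> W.events" by (rule Ret_sets)
    have "emeasure (errw (gw_tree N) \<Delta>) (Ret N 1) \<noteq> 1"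
    proof
      assume "emeasure (errw (gw_tree N) \<Delta>) (Ret N 1) = 1"
      then have int1: "(\<integral>\<^sup>+e. ennreal (sv N e []) \<partial>env a) = 1"
        using emeasure_Ret_eq[OF \<Delta>, of N 1] by simp
      have svm: "(\<lambda>e. sv N e []) \<in> borel_measurable (env a)"
        unfolding sv_def
        by (intro borel_measurable_sum borel_measurable_times borel_measurable_diff borel_measurable_const pc_root_measurable Y_measurable) simp
      have sv1: "sv N e [] \<le> 1" for e using sv_bounds(2)[of N e "[]"] pp_nonneg[of "N []" "[]" "e []"] by linarith
      have "(\<integral>\<^sup>+e. 1 - ennreal (sv N e []) \<partial>env a) = (\<integral>\<^sup>+e. 1 \<partial>env a) - (\<integral>\<^sup>+e. ennreal (sv N e []) \<partial>env a)"
        by (rule nn_integral_diff) (use svm sv1 int1 in \<open>auto simp: ennreal_le_1\<close>)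
      also have "\<dots> = 0" by (simp add: int1 E.emeasure_space_1)
      finally have "AE e in env a. 1 - ennreal (sv N e []) = 0"
        using svm by (subst (asm) nn_integral_0_iff_AE) auto
      then have "AE e in env a. Y N e [i] = 0"
      proof eventually_elim
        case (elim e)
        have "ennreal 1 \<le> ennreal (sv N e [])" using elim by (simp add: diff_eq_0_iff_ennreal)
        then have s1: "1 \<le> sv N e []" using sv_bounds(1)[of N e "[]"] by (subst (asm) ennreal_le_iff) auto
        let ?f = "\<lambda>i. pc (N []) (bt [] (e [])) i * Y N e [i]"
        have "sv N e [] = (\<Sum>i<N []. pc (N []) (bt [] (e [])) i) - (\<Sum>i<N []. ?f i)"
          by (simp add: sv_def right_diff_distrib sum_subtractf)
        then have "(\<Sum>i<N []. ?f i) \<le> 0"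
          using s1 pp_plus_pc[of "N []" "bt [] (e [])"] pp_nonneg[of "N []" "[]" "e []"] by linarith
        moreover have "?f i \<le> (\<Sum>i<N []. ?f i)"
          by (rule member_le_sum) (use i Y_bounds pc_nonneg in auto)
        ultimately have "?f i \<le> 0" by linarith
        then show ?case using pc_pos[OF i(1), of "[]" "e []"] Y_bounds(1)[of N e "[i]"]
          by (auto simp: mult_le_0_iff)
      qed
      with False show False by simp
    qed
    then have "W.prob (Ret N 1) \<noteq> 1" by (simp add: W.emeasure_eq_measure)
    then have "W.prob (space (errw (gw_tree N) \<Delta>) - Ret N 1) \<noteq> 0"
      using W.prob_compl[OF Rs] by simp
    then have pos: "emeasure (errw (gw_tree N) \<Delta>) (space (errw (gw_tree N) \<Delta>) - Ret N 1) \<noteq> 0"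
      by (simp add: W.emeasure_eq_measure)
    have "(\<integral>\<^sup>+X. \<infinity> * indicator (space (errw (gw_tree N) \<Delta>) - Ret N 1) X \<partial>errw (gw_tree N) \<Delta>) \<le>
        (\<integral>\<^sup>+X. return_time X \<partial>errw (gw_tree N) \<Delta>)"
    proof (rule nn_integral_mono_AE)
      show "AE X in errw (gw_tree N) \<Delta>. \<infinity> * indicator (space (errw (gw_tree N) \<Delta>) - Ret N 1) X \<le> return_time X"
        using AE_nearest_neighbour[where N = N, OF \<Delta>(1) N]
      proof eventually_elim
        case (elim X)
        show ?case
        proof (cases "X \<in> Ret N 1")
          case False
          have "{n. n > 0 \<and> X n = []} = {}"
            using Ret_1_of_return[of X N] elim False by auto
          then have "return_time X = \<top>" unfolding return_time_def by (simp only: image_empty Inf_empty)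
          then show ?thesis by simp
        qed simp
      qed
    qed
    also have "(\<integral>\<^sup>+X. \<infinity> * indicator (space (errw (gw_tree N) \<Delta>) - Ret N 1) X \<partial>errw (gw_tree N) \<Delta>) = \<infinity>"
      using pos Rs by (subst nn_integral_cmult_indicator) (auto simp: ennreal_top_mult)
    finally show ?thesis by (simp add: top_unique)
  next
    case True
    let ?c = "\<lambda>e. ennreal (pc (N []) (bt [] (e [])) i)"
    have cm: "?c \<in> borel_measurable (env a)" by (intro measurable_compose[OF pc_root_measurable measurable_ennreal])
    have Jm: "(\<lambda>e. J N e [i]) \<in> borel_measurable (env a)" by (rule J_measurable) simp
    have "(\<integral>\<^sup>+e. ?c e \<partial>env a) \<noteq> 0"
    proof
      assume "(\<integral>\<^sup>+e. ?c e \<partial>env a) = 0"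
      then have "AE e in env a. ?c e = 0" using cm by (subst (asm) nn_integral_0_iff_AE) auto
      then have "AE e in env a. False"
      proof eventually_elim
        case (elim e)
        then have "pc (N []) (bt [] (e [])) i \<le> 0" by (simp add: ennreal_eq_0_iff)
        moreover have "0 < pc (N []) (bt [] (e [])) i" by (rule pc_pos[OF i(1)])
        ultimately show ?case by linarith
      qed
      then show False by simp
    qed
    then have "\<infinity> = (\<integral>\<^sup>+e. ?c e \<partial>env a) * (\<integral>\<^sup>+e. J N e [i] \<partial>env a)"
      unfolding i(2) by (simp add: ennreal_mult_top)
    also have "\<dots> = (\<integral>\<^sup>+e. ?c e * J N e [i] \<partial>env a)"
      unfolding env_def
    proof (rule nn_integral_PiM_indep2[OF prob_space_env_sticks[OF a_pos], symmetric])
      show "?c \<in> borel_measurable (PiM UNIV (env_sticks a))" using cm by (simp add: env_def)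
      show "(\<lambda>e. J N e [i]) \<in> borel_measurable (PiM UNIV (env_sticks a))" using Jm by (simp add: env_def)
      show "depends_on ?c {[]}" by (simp add: depends_on_def)
      show "depends_on (\<lambda>e. J N e [i]) {u. prefix [i] u}" by (rule J_depends)
    qed auto
    also have "\<dots> \<le> (\<integral>\<^sup>+e. esum (\<lambda>q. of_nat (length q - 1) * ennreal (lw N e q)) (excU N 1 []) \<partial>env a)"
    proof (rule nn_integral_mono_AE, use True in eventually_elim)
      fix e assume Y: "Y N e [i] = 0"
      let ?p = "ennreal (pp (N [i]) (bt [i] (e [i])))"
      have "?c e * J N e [i] = esum (\<lambda>q. of_nat (length q) * (?c e * (ennreal (lw N e q) * ?p))) (excsU N [i])"
        unfolding J_def ell_def using Y by (simp add: esum_cmult[symmetric] esum_multc[symmetric] mult_ac)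
      also have "\<dots> \<le> esum (\<lambda>q. esum (\<lambda>r. of_nat (length ([] # q @ r) - 1) * ennreal (lw N e ([] # q @ r))) (excU N 0 [])) (excsU N [i])"
      proof (rule esum_mono)
        fix q assume q: "q \<in> excsU N [i]"
        have w: "ennreal (lw N e ([] # q @ [[]])) = ?c e * (ennreal (lw N e q) * ?p) * ennreal (lw N e [[]])"
          using excs_props(2)[OF q] lw_excursion[of q "[]" i "[[]]" N e] by simp
        have "of_nat (length q) * (?c e * (ennreal (lw N e q) * ?p)) \<le> of_nat (Suc (length q)) * (?c e * (ennreal (lw N e q) * ?p))"
          by (intro mult_right_mono) (auto simp del: of_nat_Suc intro!: of_nat_mono)
        also have "\<dots> = of_nat (length ([] # q @ [[]]) - 1) * ennreal (lw N e ([] # q @ [[]]))"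
          unfolding w by simp
        also have "\<dots> = esum (\<lambda>r. of_nat (length ([] # q @ r) - 1) * ennreal (lw N e ([] # q @ r))) (excU N 0 [])"
          by (simp only: excU_0) (simp add: esum_finite add.commute)
        finally show "of_nat (length q) * (?c e * (ennreal (lw N e q) * ?p)) \<le>
            esum (\<lambda>r. of_nat (length ([] # q @ r) - 1) * ennreal (lw N e ([] # q @ r))) (excU N 0 [])" .
      qed
      also have "\<dots> \<le> (\<Sum>i<N []. esum (\<lambda>q. esum (\<lambda>r. of_nat (length ([] # q @ r) - 1) * ennreal (lw N e ([] # q @ r))) (excU N 0 [])) (excsU N [i]))"
        by (rule member_le_sum[of i "{..<N []}" "\<lambda>i. esum (\<lambda>q. esum (\<lambda>r. of_nat (length ([] # q @ r) - 1) * ennreal (lw N e ([] # q @ r))) (excU N 0 [])) (excsU N [i])"]) (use i in auto)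
      also have "\<dots> = esum (\<lambda>q. of_nat (length q - 1) * ennreal (lw N e q)) (excU N 1 [])"
        using esum_excU_Suc[of "\<lambda>q. of_nat (length q - 1) * ennreal (lw N e q)" N 0 "[]"] by simp
      finally show "?c e * J N e [i] \<le> esum (\<lambda>q. of_nat (length q - 1) * ennreal (lw N e q)) (excU N 1 [])" .
    qed
    also have "\<dots> \<le> (\<integral>\<^sup>+X. return_time X \<partial>errw (gw_tree N) \<Delta>)"
      by (rule nn_integral_return_time_ge[OF \<Delta>])
    finally show ?thesis by (simp add: top_unique)
  qed
qed

text \<open>The root has no parent and hence a different law of sticks, so the results on i.i.d.
  marks apply only to the subtrees of its children. The shift moves offspring numbers and
  environment there simultaneously.\<close>

lemma AE_children:
  assumes "AE N in gw_offspring p. AE e in PiM UNIV (\<lambda>_. stick_measure a). R N e"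
  shows "AE N in gw_offspring p. \<forall>i. AE e in env a. R (\<lambda>w. N ([i] @ w)) (\<lambda>w. e ([i] @ w))"
proof -
  define Q where "Q N \<longleftrightarrow> (AE e in PiM UNIV (\<lambda>_. stick_measure a). R N e)" for N
  have "AE N in PiM UNIV (\<lambda>_. measure_pmf p). Q (\<lambda>w. N ([i] @ w))" for i
    by (rule AE_PiM_subtree[where M = "\<lambda>_. measure_pmf p" and v = "[i]" and P = Q, OF measure_pmf.prob_space_axioms])
       (use assms in \<open>simp only: Q_def gw_offspring_def\<close>)
  then have "AE N in gw_offspring p. AE e in PiM UNIV (\<lambda>_. stick_measure a). R (\<lambda>w. N ([i] @ w)) e" for i
    by (simp only: Q_def gw_offspring_def)
  then have "AE N in gw_offspring p. \<forall>i. AE e in PiM UNIV (\<lambda>_. stick_measure a). R (\<lambda>w. N ([i] @ w)) e"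
    by (simp add: AE_all_countable)
  then show ?thesis
  proof (rule eventually_mono)
    fix N assume *: "\<forall>i. AE e in PiM UNIV (\<lambda>_. stick_measure a). R (\<lambda>w. N ([i] @ w)) e"
    show "\<forall>i. AE e in env a. R (\<lambda>w. N ([i] @ w)) (\<lambda>w. e ([i] @ w))"
    proof
      fix i
      have "AE e in PiM UNIV (\<lambda>w. env_sticks a ([i] @ w)). R (\<lambda>w. N ([i] @ w)) e"
      proof -
        have "(\<lambda>w. env_sticks a ([i] @ w)) = (\<lambda>_. stick_measure a)"
          by (rule ext, rule env_sticks_child) simp
        then show ?thesis using spec[OF *, of i] by (simp only:)
      qed
      from AE_PiM_subtree[where M = "env_sticks a" and v = "[i]", OF prob_space_env_sticks[OF a_pos] this]
      show "AE e in env a. R (\<lambda>w. N ([i] @ w)) (\<lambda>w. e ([i] @ w))" unfolding env_def .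
    qed
  qed
qed

theorem recurrent_AE:
  assumes \<Delta>: "\<Delta> > 0" "a = 1 / (2 * \<Delta>)" and m: "(\<lambda>k. real k * pmf p k) sums m" and le: "m * rho a \<le> 1"
  shows "AE N in gw_offspring p. infinite (gw_tree N) \<longrightarrow> errw_recurrent (gw_tree N) \<Delta>"
proof -
  have sum: "(\<Sum>i<n. h i) = (\<Sum>i. (if i < n then h i else 0 :: ennreal))" for n and h :: "nat \<Rightarrow> ennreal"
    by (subst suminf_finite[of "{..<n}"]) auto
  have "(\<integral>\<^sup>+x. (\<Sum>i<fst x. ennreal (odds i (snd x) powr (1/4))) \<partial>mark) =
      (\<Sum>i. \<integral>\<^sup>+x. (if i < fst x then ennreal (odds i (snd x) powr (1/4)) else 0) \<partial>mark)"
    unfolding sum using MT.deg_m MT.A_m by (intro nn_integral_suminf) measurable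
  also have "\<dots> = (\<Sum>i. ennreal (measure_pmf.prob p {i<..} * rho a))"
    using a_pos by (subst odds_moment_mark) (auto simp: gmom_quarter)
  also have "\<dots> = ennreal (m * rho a)"
    using sums_mult2[OF tail_sums[OF m], of "rho a"] rho_pos[OF a_pos]
    by (subst suminf_ennreal2) (auto simp: sums_iff)
  also have "\<dots> \<le> 1" using le by (simp add: ennreal_le_1)
  finally have "AE z in MT.Om. MT.Ylim z = 0" by (intro MT.Ylim_eq_0_AE[of "1/4"]) auto
  then have "AE z in MT.Om. MT.Ylim (\<lambda>i. (fst (z i), snd (z i))) = 0" by simp
  from AE_PiM_pair_iterated[OF measure_pmf.prob_space_axioms SM.prob_space_axioms this]
  have "AE N in gw_offspring p. AE e in PiM UNIV (\<lambda>_. stick_measure a). MT.Ylim (\<lambda>i. (N i, e i)) = 0"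
    unfolding gw_offspring_def .
  from AE_children[OF this] show ?thesis
  proof (rule eventually_mono, intro impI)
    fix N assume Y: "\<forall>i. AE e in env a. MT.Ylim (\<lambda>w. (N ([i] @ w), e ([i] @ w))) = 0" and inf: "infinite (gw_tree N)"
    have "N [] > 0" using inf finite_gw_tree_children[of N] by (cases "N []") auto
    moreover have "AE e in env a. \<forall>i<N []. Y N e [i] = 0"
      using Y unfolding Y_def by (subst AE_all_countable) auto
    ultimately show "errw_recurrent (gw_tree N) \<Delta>" by (rule recurrent_of_Y[OF \<Delta>])
  qed
qed

theorem transient_AE:
  assumes \<Delta>: "\<Delta> > 0" "a = 1 / (2 * \<Delta>)" and m: "(\<lambda>k. real k * pmf p k) sums m" "m > 1" and gt: "m * rho a > 1"
  shows "AE N in gw_offspring p. infinite (gw_tree N) \<longrightarrow> errw_transient (gw_tree N) \<Delta>"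
proof -
  have "\<not> (AE z in MT.Om. MT.Ylim z = 0)"
    by (rule MT.supercritical_not_AE_Ylim_eq_0[OF a_pos _ _ tail_sums[OF m(1)] gt])
       (use a_pos in \<open>auto intro!: odds_moment_mark\<close>)
  from MT.surviving_AE[OF this deg_law m]
  have "AE z in MT.Om. infinite (gw_tree (\<lambda>u. fst (z u))) \<longrightarrow> MT.Ylim (\<lambda>i. (fst (z i), snd (z i))) > 0" by simp
  from AE_PiM_pair_iterated[where R = "\<lambda>N e. infinite (gw_tree N) \<longrightarrow> MT.Ylim (\<lambda>i. (N i, e i)) > 0",
      OF measure_pmf.prob_space_axioms SM.prob_space_axioms this]
  have "AE N in gw_offspring p. AE e in PiM UNIV (\<lambda>_. stick_measure a). infinite (gw_tree N) \<longrightarrow> MT.Ylim (\<lambda>i. (N i, e i)) > 0"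
    unfolding gw_offspring_def .
  from AE_children[OF this] show ?thesis
  proof (rule eventually_mono, intro impI)
    fix N assume Y: "\<forall>i. AE e in env a. infinite (gw_tree (\<lambda>w. N ([i] @ w))) \<longrightarrow> MT.Ylim (\<lambda>w. (N ([i] @ w), e ([i] @ w))) > 0"
      and inf: "infinite (gw_tree N)"
    from inf obtain i where i: "i < N []" "infinite (gw_tree (\<lambda>w. N (i # w)))"
      using finite_gw_tree_children[of N] by auto
    have "AE e in env a. Y N e [i] > 0" using spec[OF Y, of i] i(2) by (simp add: Y_def)
    then show "errw_transient (gw_tree N) \<Delta>" by (rule transient_of_Y[where N = N and i = i, OF \<Delta> i(1)])
  qed
qed

end

theorem theorem4p3:
  fixes p :: "nat pmf" and m \<Delta> :: real
  assumes "(\<lambda>k. real k * pmf p k) sums m" and "m > 1" and "\<Delta> > 0"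
  shows "(\<exists>!\<Delta>\<^sub>0. \<Delta>\<^sub>0 > 0 \<and> gamma_ratio \<Delta>\<^sub>0 = 1 / m) \<and>
    (\<forall>\<Delta>\<^sub>0. \<Delta>\<^sub>0 > 0 \<and> gamma_ratio \<Delta>\<^sub>0 = 1 / m \<longrightarrow>
      (\<Delta> < \<Delta>\<^sub>0 \<longrightarrow> (AE N in gw_offspring p. infinite (gw_tree N) \<longrightarrow> errw_transient (gw_tree N) \<Delta>)) \<and>
      (\<Delta> \<ge> \<Delta>\<^sub>0 \<longrightarrow> (AE N in gw_offspring p. infinite (gw_tree N) \<longrightarrow> errw_recurrent (gw_tree N) \<Delta>))) \<and>
    (AE N in gw_offspring p. infinite (gw_tree N) \<longrightarrow>
      (\<integral>\<^sup>+X. return_time X \<partial>errw (gw_tree N) \<Delta>) = \<infinity>)"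
proof -
  define a where "a = 1 / (2 * \<Delta>)"
  interpret errw_environment p a by standard (use assms in \<open>simp add: a_def\<close>)
  have ratio: "gamma_ratio \<Delta> = rho a" using assms by (simp add: gamma_ratio_eq_rho a_def)
  show ?thesis
  proof (intro conjI allI impI)
    show "\<exists>!\<Delta>\<^sub>0. \<Delta>\<^sub>0 > 0 \<and> gamma_ratio \<Delta>\<^sub>0 = 1 / m" by (rule ex1_gamma_ratio[OF assms(2)])
    show "AE N in gw_offspring p. infinite (gw_tree N) \<longrightarrow> (\<integral>\<^sup>+X. return_time X \<partial>errw (gw_tree N) \<Delta>) = \<infinity>"
      by (intro AE_I2 impI infinite_return_time[OF assms(3) a_def])
  next
    fix \<Delta>\<^sub>0 :: real assume D: "\<Delta>\<^sub>0 > 0 \<and> gamma_ratio \<Delta>\<^sub>0 = 1 / m"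
    {
      assume "\<Delta> < \<Delta>\<^sub>0"
      then have "1 / m < rho a" using gamma_ratio_strict_antimono[OF assms(3), of \<Delta>\<^sub>0] D ratio by simp
      then have "m * rho a > 1" using assms(2) by (simp add: field_simps)
      then show "AE N in gw_offspring p. infinite (gw_tree N) \<longrightarrow> errw_transient (gw_tree N) \<Delta>"
        by (rule transient_AE[OF assms(3) a_def assms(1,2)])
    next
      assume "\<Delta> \<ge> \<Delta>\<^sub>0"
      \<comment> \<open>At the critical parameter itself m rho a = 1, which the fractional moment
        argument still covers.\<close>
      then have "rho a \<le> 1 / m"
        using gamma_ratio_strict_antimono[of \<Delta>\<^sub>0 \<Delta>] D ratio by (cases "\<Delta> = \<Delta>\<^sub>0") auto
      then have "m * rho a \<le> 1" using assms(2) by (simp add: field_simps)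
      then show "AE N in gw_offspring p. infinite (gw_tree N) \<longrightarrow> errw_recurrent (gw_tree N) \<Delta>"
        by (rule recurrent_AE[OF assms(3) a_def assms(1)])
    }
  qed
qed

end
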